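(* Let $\theta>0$. Let $(u^{\mathrm{OPT}},\gamma^{\mathrm{OPT}},\zeta^{\mathrm{OPT}})$ be a solution of the joint problem (R), and for each $i=1,\dots,n$ let $(u^{*i},\gamma^{*i},\zeta^{*i})$ be a solution of the decoupled problem (D$_i$) and $\bar u^i$ a solution of the problem (M$_i$), all defined in the context. Write $u^*=(u^{*1},\dots,u^{*n})$, $\gamma^*=(\gamma^{*1},\dots,\gamma^{*n})$, $\zeta^*=(\zeta^{*1},\dots,\zeta^{*n})$ and $\bar u=(\bar u^1,\dots,\bar u^n)$. Suppose that $\mathbb{E}[\bar J^P[\bar u,0,0]]>0$, and set $$\rho:=\frac{-\frac1\theta\log\mathbb{E}\big[\exp(-\theta\bar J^P[u^*,\gamma^*,\zeta^*])\big]}{\mathbb{E}\big[\bar J^P[\bar u,0,0]\big]}.$$ Then $$\rho\left(-\frac1\theta\log\mathbb{E}\big[\exp(-\theta\bar J^P[u^{\mathrm{OPT}},\gamma^{\mathrm{OPT}},\zeta^{\mathrm{OPT}}])\big]\right)\le-\frac1\theta\log\mathbb{E}\big[\exp(-\theta\bar J^P[u^*,\gamma^*,\zeta^*])\big].$$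
   Context: Fix $T>0$ and $n\ge 1$. On a probability space $(\Omega,\mathcal{F},\mathbb{P})$ let $W^0,W^1,\dots,W^n$ be mutually independent one-dimensional standard Brownian motions on $[0,T]$. For $i\in\{1,\dots,n\}$ put $W^{(i)}:=(W^0,W^i)$ and let $\{\mathcal{F}_t^{(i)}\}_{0\le t\le T}$ be the filtration generated by $W^{(i)}$. Admissible sets: $\mathcal{U}^i\subset\mathbb{R}$ is compact; $\mathbb{U}^i$ is the set of $\mathcal{U}^i$-valued $\{\mathcal{F}_t^{(i)}\}$-progressively measurable processes; $\Gamma^i$ is the set of $\mathbb{R}^{1\times2}$-valued $\{\mathcal{F}_t^{(i)}\}$-progressively measurable processes $\xi^i=(\xi^{i,1},\xi^{i,2})$ with $\mathbb{E}[\int_0^T\|\xi_t^i\|^2dt]<\infty$. Put $\mathbb{U}=\prod_i\mathbb{U}^i$, $\Gamma=\prod_i\Gamma^i$. For $\xi^i\in\Gamma^i$, $\xi_t^i\,dW_t^{(i)}:=\xi_t^{i,1}dW_t^0+\xi_t^{i,2}dW_t^i$. Log-price: $dw_t=r_0(\nu(t)-w_t)\,dt+\sigma_0(t)\,dW_t^0$ with $w_0\in\mathbb{R}$ given, where $r_0$ is a constant and $\nu,\sigma_0:[0,T]\to\mathbb{R}$ are deterministic with $\sigma_0$ bounded. Load states: $dx_t^i=f_i(x_t^i,u_t^i)\,dt$, $x_0^i=x^{0i}\in\mathbb{R}$, where $f_i:\mathbb{R}\times\mathcal{U}^i\to\mathbb{R}$ is continuous, differentiable in its first argument, and for some $K$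 satisfies $|\partial f_i(\boldsymbol{x},\boldsymbol{u})/\partial\boldsymbol{x}|\le K$, $|f_i(\boldsymbol{x},\boldsymbol{u})|\le K(1+|\boldsymbol{x}|+|\boldsymbol{u}|)$. Running payoffs and volatilities: $r_i^P(t,w,x,u):=(\mu_i(t)-e^{w})(u+l_i(t))+e^{w}p_i(t)$, $\sigma_i^P(t,w):=(\mu_i(t)-e^{w})\tilde\sigma_i(t)$, $r_i^A(t,x,u):=-\mu_i(t)(l_i(t)+u)+r_i(x,u)$, $\sigma_i^A(t):=-\mu_i(t)\tilde\sigma_i(t)$, where $\mu_i,\tilde\sigma_i$ are bounded deterministic functions on $[0,T]$, $l_i,p_i:[0,T]\to\mathbb{R}$ are deterministic functions, and $r_i:\mathbb{R}\times\mathbb{R}\to\mathbb{R}$ is a comfort function (all measurable). It is assumed that $|r_i^A(t,\boldsymbol{x},\boldsymbol{u})|\le B_0+B_1|\boldsymbol{x}|$ for some constants $B_0,B_1$ and all $t\in[0,T]$, $\boldsymbol{x}\in\mathbb{R}$, $\boldsymbol{u}\in\mathcal{U}^i$. Constants: $b_i\in\mathbb{R}$, $S_i\in\mathbb{R}$. Joint problem (R): maximize $-\frac1\theta\log\mathbb{E}[\exp(-\theta\bar J^P[u,\gamma,\zeta])]$ over $u\in\mathbb{U}$, $\gamma\in\Gamma$, $\zeta\in\Gamma$, subject to the dynamics of $w$ and $x^i$ above and, for all $i=1,\dots,n$, $$dv_t^i=-r_i^A(t,x_t^i,u_t^i)\,dt+\gamma_t^{i,1}dW_t^0+(\gamma_t^{i,2}-\sigma_i^A(t))\,dW_t^i,\quad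 v_0^i=b_i,$$ $$dy_t^i=-\|\gamma_t^i\|^2dt+\zeta_t^i\,dW_t^{(i)},\quad y_0^i=S_i,\quad y_T^i\ge0\ \text{a.s.},$$ where $$\bar J^P[u,\gamma,\zeta]:=\sum_{i=1}^n\Big(\int_0^T r_i^P(t,w_t,x_t^i,u_t^i)\,dt+\int_0^T\sigma_i^P(t,w_t)\,dW_t^i-v_T^i\Big).$$ Decoupled problem (D$_i$): maximize $-\frac1\theta\log\mathbb{E}[\exp(-\theta\bar J_i^P[u^i,\gamma^i,\zeta^i])]$ over $u^i\in\mathbb{U}^i$, $\gamma^i\in\Gamma^i$, $\zeta^i\in\Gamma^i$, subject to the dynamics of $w$ and $x^i$ above and $dy_t^i=-\|\gamma_t^i\|^2dt+\zeta_t^i\,dW_t^{(i)}$, $y_0^i=S_i$, $y_T^i\ge0$ a.s., where $$\bar J_i^P[u^i,\gamma^i,\zeta^i]:=-b_i+\int_0^T\big(r_i^P(t,w_t,x_t^i,u_t^i)+r_i^A(t,x_t^i,u_t^i)\big)dt+\int_0^T\big(\sigma_i^P(t,w_t)+\sigma_i^A(t)\big)dW_t^i-\int_0^T\gamma_t^i\,dW_t^{(i)}.$$ Problem (M$_i$): maximize $\mathbb{E}[\bar J_i^P[u^i,0,0]]$ over $u^i\in\mathbb{U}^i$ subject to the dynamics of $w$ and $x^i$ above.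
   Formalization: The formal theorem adds the hypothesis ρ ≥ 0; without it the claim is false (e.g. n=1, w=0, only feasible payoff m − W_T with m>0 and θ > 2m/T), and for real ρ < 0 it can hold only if the joint optimum equals E[J̄^P[ū,0,0]]. *)

theory Defs
  imports "HOL-Probability.Probability"
begin

section \<open>Brownian motion, filtrations and the Ito integral\<close>

definition natural_filtration ::
  "'a measure \<Rightarrow> ('k \<Rightarrow> real \<Rightarrow> 'a \<Rightarrow> real) \<Rightarrow> 'k set \<Rightarrow> real \<Rightarrow> 'a measure" where
  "natural_filtration M W K t =
     sigma (space M) {W k s -` B \<inter> space M | k s B. k \<in> K \<and> s \<in> {0..t} \<and> B \<in> sets borel}"

definition standard_brownian_motion ::
  "'a measure \<Rightarrow> real \<Rightarrow> (real \<Rightarrow> 'a \<Rightarrow> real) \<Rightarrow> bool" where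
  "standard_brownian_motion M T B \<longleftrightarrow>
     (\<forall>t\<in>{0..T}. B t \<in> borel_measurable M) \<and>
     (AE \<omega> in M. B 0 \<omega> = 0) \<and>
     (AE \<omega> in M. continuous_on {0..T} (\<lambda>t. B t \<omega>)) \<and>
     (\<forall>s t. 0 \<le> s \<and> s < t \<and> t \<le> T \<longrightarrow>
        distributed M lborel (\<lambda>\<omega>. B t \<omega> - B s \<omega>) (normal_density 0 (sqrt (t - s))) \<and>
        prob_space.indep_set M
          (sets (natural_filtration M (\<lambda>_::unit. B) UNIV s))
          (sets (vimage_algebra (space M) (\<lambda>\<omega>. B t \<omega> - B s \<omega>) borel)))"

definition progressively_measurable ::
  "(real \<Rightarrow> 'a measure) \<Rightarrow> real \<Rightarrow> (real \<Rightarrow> 'a \<Rightarrow> 'b::topological_space) \<Rightarrow> bool" where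
  "progressively_measurable F T X \<longleftrightarrow>
     (\<forall>t\<in>{0..T}. (\<lambda>(s, \<omega>). X s \<omega>) \<in> borel_measurable (restrict_space borel {0..t} \<Otimes>\<^sub>M F t))"

text \<open>\<open>elementary F B t \<phi> Z\<close>: \<open>\<phi>\<close> is a bounded step process on \<open>[0,t]\<close>, adapted to \<open>F\<close>,
  and \<open>Z\<close> is its integral with respect to \<open>B\<close>.\<close>

definition elementary ::
  "(real \<Rightarrow> 'a measure) \<Rightarrow> (real \<Rightarrow> 'a \<Rightarrow> real) \<Rightarrow> real \<Rightarrow> (real \<Rightarrow> 'a \<Rightarrow> real) \<Rightarrow> ('a \<Rightarrow> real) \<Rightarrow> bool"
where
  "elementary F B t \<phi> Z \<longleftrightarrow>
     (\<exists>(m::nat) (\<tau>::nat \<Rightarrow> real) (H::nat \<Rightarrow> 'a \<Rightarrow> real).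
        0 \<le> \<tau> 0 \<and> (\<forall>k<m. \<tau> k \<le> \<tau> (Suc k)) \<and> \<tau> m \<le> t \<and>
        (\<forall>k<m. H k \<in> borel_measurable (F (\<tau> k)) \<and> (\<exists>C. \<forall>\<omega>\<in>space (F (\<tau> k)). \<bar>H k \<omega>\<bar> \<le> C)) \<and>
        \<phi> = (\<lambda>s \<omega>. \<Sum>k<m. H k \<omega> * indicator {\<tau> k<..\<tau> (Suc k)} s) \<and>
        Z = (\<lambda>\<omega>. \<Sum>k<m. H k \<omega> * (B (\<tau> (Suc k)) \<omega> - B (\<tau> k) \<omega>)))"

text \<open>\<open>ito_integral M F B t \<xi> I\<close>: the random variable \<open>I\<close> is a version of \<open>\<integral>\<^sub>0\<^sup>t \<xi>\<^sub>s dB\<^sub>s\<close>, that is,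
  an \<open>L\<^sup>2\<close>-limit of integrals of adapted step processes approximating \<open>\<xi>\<close> in \<open>L\<^sup>2([0,t] \<times> \<Omega>)\<close>.
  It is a relation because \<open>I\<close> is determined only up to null sets.\<close>

definition ito_integral ::
  "'a measure \<Rightarrow> (real \<Rightarrow> 'a measure) \<Rightarrow> (real \<Rightarrow> 'a \<Rightarrow> real) \<Rightarrow> real \<Rightarrow>
   (real \<Rightarrow> 'a \<Rightarrow> real) \<Rightarrow> ('a \<Rightarrow> real) \<Rightarrow> bool" where
  "ito_integral M F B t \<xi> I \<longleftrightarrow>
     (\<lambda>(s, \<omega>). \<xi> s \<omega>) \<in> borel_measurable (restrict_space borel {0..t} \<Otimes>\<^sub>M M) \<and>
     I \<in> borel_measurable M \<and>
     (\<exists>\<phi> Z. (\<forall>j::nat. elementary F B t (\<phi> j) (Z j)) \<and>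
        (\<lambda>j. \<integral>\<^sup>+\<omega>. (\<integral>\<^sup>+s\<in>{0..t}. ennreal ((\<xi> s \<omega> - \<phi> j s \<omega>)\<^sup>2) \<partial>lborel) \<partial>M) \<longlonglongrightarrow> 0 \<and>
        (\<lambda>j. \<integral>\<^sup>+\<omega>. ennreal ((I \<omega> - Z j \<omega>)\<^sup>2) \<partial>M) \<longlonglongrightarrow> 0)"

text \<open>Integration against several driving noises \<open>(W k)\<close>, \<open>k \<in> K\<close>, with respect to the filtration
  they generate: \<open>I\<close> is a version of \<open>\<Sum>k\<in>K. \<integral>\<^sub>0\<^sup>t c\<^sup>k\<^sub>s dW\<^sup>k\<^sub>s\<close>.\<close>

definition ito_integrals ::
  "'a measure \<Rightarrow> ('k \<Rightarrow> real \<Rightarrow> 'a \<Rightarrow> real) \<Rightarrow> 'k set \<Rightarrow> real \<Rightarrow>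
   ('k \<Rightarrow> real \<Rightarrow> 'a \<Rightarrow> real) \<Rightarrow> ('a \<Rightarrow> real) \<Rightarrow> bool" where
  "ito_integrals M W K t c I \<longleftrightarrow>
     (\<exists>Y. (\<forall>k\<in>K. ito_integral M (natural_filtration M W K) (W k) t (c k) (Y k)) \<and>
          I = (\<lambda>\<omega>. \<Sum>k\<in>K. Y k \<omega>))"

text \<open>\<open>X\<close> is a continuous process with \<open>dX\<^sub>t = a\<^sub>t dt + \<Sum>k\<in>K. c\<^sup>k\<^sub>t dW\<^sup>k\<^sub>t\<close> on \<open>[0,T]\<close> and \<open>X\<^sub>0 = \<xi>\<close>;
  for \<open>K = {}\<close> this is the ordinary differential equation \<open>dX\<^sub>t = a\<^sub>t dt\<close>.\<close>

definition ito_process ::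
  "'a measure \<Rightarrow> ('k \<Rightarrow> real \<Rightarrow> 'a \<Rightarrow> real) \<Rightarrow> 'k set \<Rightarrow> real \<Rightarrow> real \<Rightarrow> (real \<Rightarrow> 'a \<Rightarrow> real) \<Rightarrow>
   ('k \<Rightarrow> real \<Rightarrow> 'a \<Rightarrow> real) \<Rightarrow> (real \<Rightarrow> 'a \<Rightarrow> real) \<Rightarrow> bool" where
  "ito_process M W K T \<xi> a c X \<longleftrightarrow>
     (\<forall>t\<in>{0..T}. X t \<in> borel_measurable M) \<and>
     (\<forall>\<omega>\<in>space M. continuous_on {0..T} (\<lambda>t. X t \<omega>)) \<and>
     (AE \<omega> in M. set_integrable lborel {0..T} (\<lambda>s. a s \<omega>)) \<and>
     (\<forall>t\<in>{0..T}. \<exists>I. ito_integrals M W K t c I \<and>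
        (AE \<omega> in M. X t \<omega> = \<xi> + (LINT s:{0..t}|lborel. a s \<omega>) + I \<omega>))"


section \<open>The model\<close>

text \<open>The noise \<open>W\<^sup>0\<close> is common to all agents \<open>i = 1, \<dots>, n\<close>; indexed data are only
  relevant for these \<open>i\<close>, and functions of time only on \<open>[0,T]\<close>.\<close>

record 'a contract_data =
  prb :: "'a measure"
  horizon :: real
  agents :: nat
  noise :: "nat \<Rightarrow> real \<Rightarrow> 'a \<Rightarrow> real"               \<comment> \<open>\<open>W\<close>\<close>
  logprice :: "real \<Rightarrow> 'a \<Rightarrow> real"                    \<comment> \<open>\<open>w\<close>\<close>
  logprice_init :: real                              \<comment> \<open>\<open>w\<^sub>0\<close>\<close>
  logprice_rate :: real                              \<comment> \<open>\<open>r\<^sub>0\<close>\<close>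
  logprice_level :: "real \<Rightarrow> real"                   \<comment> \<open>\<open>\<nu>\<close>\<close>
  logprice_vol :: "real \<Rightarrow> real"                     \<comment> \<open>\<open>\<sigma>\<^sub>0\<close>\<close>
  control_set :: "nat \<Rightarrow> real set"                   \<comment> \<open>\<open>\<U>\<^sup>i\<close>\<close>
  load_drift :: "nat \<Rightarrow> real \<Rightarrow> real \<Rightarrow> real"         \<comment> \<open>\<open>f\<^sub>i\<close>\<close>
  load_init :: "nat \<Rightarrow> real"                         \<comment> \<open>\<open>x\<^sup>0\<^sup>i\<close>\<close>
  mu_coeff :: "nat \<Rightarrow> real \<Rightarrow> real"                  \<comment> \<open>\<open>\<mu>\<^sub>i\<close>\<close>
  sigma_coeff :: "nat \<Rightarrow> real \<Rightarrow> real"               \<comment> \<open>\<open>\<sigma>\<close>-tilde\<close>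
  l_coeff :: "nat \<Rightarrow> real \<Rightarrow> real"                   \<comment> \<open>\<open>l\<^sub>i\<close>\<close>
  p_coeff :: "nat \<Rightarrow> real \<Rightarrow> real"                   \<comment> \<open>\<open>p\<^sub>i\<close>\<close>
  comfort :: "nat \<Rightarrow> real \<Rightarrow> real \<Rightarrow> real"            \<comment> \<open>\<open>r\<^sub>i\<close>\<close>
  b_const :: "nat \<Rightarrow> real"                           \<comment> \<open>\<open>b\<^sub>i\<close>\<close>
  S_const :: "nat \<Rightarrow> real"                           \<comment> \<open>\<open>S\<^sub>i\<close>\<close>

definition rP :: "'a contract_data \<Rightarrow> nat \<Rightarrow> real \<Rightarrow> real \<Rightarrow> real \<Rightarrow> real \<Rightarrow> real" where
  "rP md i t w x u = (mu_coeff md i t - exp w) * (u + l_coeff md i t) + exp w * p_coeff md i t"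

definition sigmaP :: "'a contract_data \<Rightarrow> nat \<Rightarrow> real \<Rightarrow> real \<Rightarrow> real" where
  "sigmaP md i t w = (mu_coeff md i t - exp w) * sigma_coeff md i t"

definition rA :: "'a contract_data \<Rightarrow> nat \<Rightarrow> real \<Rightarrow> real \<Rightarrow> real \<Rightarrow> real" where
  "rA md i t x u = - mu_coeff md i t * (l_coeff md i t + u) + comfort md i x u"

definition sigmaA :: "'a contract_data \<Rightarrow> nat \<Rightarrow> real \<Rightarrow> real" where
  "sigmaA md i t = - mu_coeff md i t * sigma_coeff md i t"

abbreviation (input) measurable_on_horizon :: "real \<Rightarrow> (real \<Rightarrow> real) \<Rightarrow> bool" where
  "measurable_on_horizon T g \<equiv> g \<in> borel_measurable (restrict_space borel {0..T})"

abbreviation (input) bounded_on_horizon :: "real \<Rightarrow> (real \<Rightarrow> real) \<Rightarrow> bool" where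
  "bounded_on_horizon T g \<equiv> bounded (g ` {0..T})"

locale contract_model = prob_space "prb md" for md :: "'a contract_data" +
  assumes horizon_pos: "horizon md > 0"
    and agents_pos: "agents md \<ge> 1"
    and noise_brownian: "\<And>k. k \<le> agents md \<Longrightarrow>
      standard_brownian_motion (prb md) (horizon md) (noise md k)"
    and noise_indep:
      "indep_sets (\<lambda>k. sets (natural_filtration (prb md) (noise md) {k} (horizon md))) {..agents md}"
    and logprice_level_measurable: "measurable_on_horizon (horizon md) (logprice_level md)"
    and logprice_vol_measurable: "measurable_on_horizon (horizon md) (logprice_vol md)"
    and logprice_vol_bounded: "bounded_on_horizon (horizon md) (logprice_vol md)"
    and logprice_dynamics:
      "ito_process (prb md) (noise md) {0} (horizon md) (logprice_init md)
         (\<lambda>t \<omega>. logprice_rate md * (logprice_level md t - logprice md t \<omega>))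
         (\<lambda>_ t _. logprice_vol md t) (logprice md)"
    and control_set_compact: "\<And>i. i \<in> {1..agents md} \<Longrightarrow> compact (control_set md i)"
    and load_drift_continuous: "\<And>i. i \<in> {1..agents md} \<Longrightarrow>
      continuous_on (UNIV \<times> control_set md i) (\<lambda>(x, u). load_drift md i x u)"
    and load_drift_bounds: "\<And>i. i \<in> {1..agents md} \<Longrightarrow>
      \<exists>K. \<forall>x. \<forall>u\<in>control_set md i.
        (\<exists>D. ((\<lambda>x. load_drift md i x u) has_real_derivative D) (at x) \<and> \<bar>D\<bar> \<le> K) \<and>
        \<bar>load_drift md i x u\<bar> \<le> K * (1 + \<bar>x\<bar> + \<bar>u\<bar>)"
    and mu_measurable: "\<And>i. i \<in> {1..agents md} \<Longrightarrow> measurable_on_horizon (horizon md) (mu_coeff md i)"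
    and mu_bounded: "\<And>i. i \<in> {1..agents md} \<Longrightarrow> bounded_on_horizon (horizon md) (mu_coeff md i)"
    and sigma_measurable: "\<And>i. i \<in> {1..agents md} \<Longrightarrow>
      measurable_on_horizon (horizon md) (sigma_coeff md i)"
    and sigma_bounded: "\<And>i. i \<in> {1..agents md} \<Longrightarrow>
      bounded_on_horizon (horizon md) (sigma_coeff md i)"
    and l_measurable: "\<And>i. i \<in> {1..agents md} \<Longrightarrow> measurable_on_horizon (horizon md) (l_coeff md i)"
    and p_measurable: "\<And>i. i \<in> {1..agents md} \<Longrightarrow> measurable_on_horizon (horizon md) (p_coeff md i)"
    and comfort_measurable: "\<And>i. i \<in> {1..agents md} \<Longrightarrow>
      (\<lambda>(x, u). comfort md i x u) \<in> borel_measurable borel"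
    and rA_bound: "\<And>i. i \<in> {1..agents md} \<Longrightarrow>
      \<exists>B\<^sub>0 B\<^sub>1. \<forall>t\<in>{0..horizon md}. \<forall>x. \<forall>u\<in>control_set md i. \<bar>rA md i t x u\<bar> \<le> B\<^sub>0 + B\<^sub>1 * \<bar>x\<bar>"


section \<open>Controls, states and payoffs\<close>

abbreviation agent_filtration :: "'a contract_data \<Rightarrow> nat \<Rightarrow> real \<Rightarrow> 'a measure" where
  "agent_filtration md i \<equiv> natural_filtration (prb md) (noise md) {0, i}"

definition controls :: "'a contract_data \<Rightarrow> nat \<Rightarrow> (real \<Rightarrow> 'a \<Rightarrow> real) set" where
  "controls md i = {u. progressively_measurable (agent_filtration md i) (horizon md) u \<and>
     (\<forall>t\<in>{0..horizon md}. \<forall>\<omega>\<in>space (prb md). u t \<omega> \<in> control_set md i)}"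

definition loadings :: "'a contract_data \<Rightarrow> nat \<Rightarrow> (real \<Rightarrow> 'a \<Rightarrow> real \<times> real) set" where
  "loadings md i = {\<xi>. progressively_measurable (agent_filtration md i) (horizon md) \<xi> \<and>
     (\<integral>\<^sup>+\<omega>. (\<integral>\<^sup>+t\<in>{0..horizon md}. ennreal ((norm (\<xi> t \<omega>))\<^sup>2) \<partial>lborel) \<partial>prb md) < \<infinity>}"

text \<open>A row vector \<open>\<xi>\<^sup>i = (\<xi>\<^sup>i\<^sup>,\<^sup>1, \<xi>\<^sup>i\<^sup>,\<^sup>2)\<close> as coefficients of the noises \<open>0\<close> and \<open>i\<close>.\<close>

definition noise_coeffs :: "(real \<Rightarrow> 'a \<Rightarrow> real \<times> real) \<Rightarrow> nat \<Rightarrow> real \<Rightarrow> 'a \<Rightarrow> real" where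
  "noise_coeffs \<xi> k t \<omega> = (if k = 0 then fst (\<xi> t \<omega>) else snd (\<xi> t \<omega>))"

definition load_state ::
  "'a contract_data \<Rightarrow> nat \<Rightarrow> (real \<Rightarrow> 'a \<Rightarrow> real) \<Rightarrow> (real \<Rightarrow> 'a \<Rightarrow> real) \<Rightarrow> bool" where
  "load_state md i u x \<longleftrightarrow>
     ito_process (prb md) (noise md) {} (horizon md) (load_init md i)
       (\<lambda>t \<omega>. load_drift md i (x t \<omega>) (u t \<omega>)) (\<lambda>_ _ _. 0) x"

definition benefit_state ::
  "'a contract_data \<Rightarrow> nat \<Rightarrow> (real \<Rightarrow> 'a \<Rightarrow> real) \<Rightarrow> (real \<Rightarrow> 'a \<Rightarrow> real \<times> real) \<Rightarrow>
   (real \<Rightarrow> 'a \<Rightarrow> real) \<Rightarrow> (real \<Rightarrow> 'a \<Rightarrow> real) \<Rightarrow> bool" where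
  "benefit_state md i u \<gamma> x v \<longleftrightarrow>
     ito_process (prb md) (noise md) {0, i} (horizon md) (b_const md i)
       (\<lambda>t \<omega>. - rA md i t (x t \<omega>) (u t \<omega>))
       (noise_coeffs (\<lambda>t \<omega>. (fst (\<gamma> t \<omega>), snd (\<gamma> t \<omega>) - sigmaA md i t))) v"

definition risk_state ::
  "'a contract_data \<Rightarrow> nat \<Rightarrow> (real \<Rightarrow> 'a \<Rightarrow> real \<times> real) \<Rightarrow> (real \<Rightarrow> 'a \<Rightarrow> real \<times> real) \<Rightarrow>
   (real \<Rightarrow> 'a \<Rightarrow> real) \<Rightarrow> bool" where
  "risk_state md i \<gamma> \<zeta> y \<longleftrightarrow>
     ito_process (prb md) (noise md) {0, i} (horizon md) (S_const md i)
       (\<lambda>t \<omega>. - (norm (\<gamma> t \<omega>))\<^sup>2) (noise_coeffs \<zeta>) y"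

definition risk_constraint ::
  "'a contract_data \<Rightarrow> nat \<Rightarrow> (real \<Rightarrow> 'a \<Rightarrow> real \<times> real) \<Rightarrow> (real \<Rightarrow> 'a \<Rightarrow> real \<times> real) \<Rightarrow> bool" where
  "risk_constraint md i \<gamma> \<zeta> \<longleftrightarrow>
     (\<exists>y. risk_state md i \<gamma> \<zeta> y \<and> (AE \<omega> in prb md. y (horizon md) \<omega> \<ge> 0))"

text \<open>\<open>joint_payoff md u \<gamma> \<zeta> J\<close>: the random variable \<open>J\<close> is a version of the payoff of the joint
  problem under \<open>(u, \<gamma>, \<zeta>)\<close>. The process \<open>y\<close>, and hence \<open>\<zeta>\<close>, does not enter the value of \<open>J\<close>.\<close>

definition joint_payoff ::
  "'a contract_data \<Rightarrow> (nat \<Rightarrow> real \<Rightarrow> 'a \<Rightarrow> real) \<Rightarrow> (nat \<Rightarrow> real \<Rightarrow> 'a \<Rightarrow> real \<times> real) \<Rightarrow>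
   (nat \<Rightarrow> real \<Rightarrow> 'a \<Rightarrow> real \<times> real) \<Rightarrow> ('a \<Rightarrow> real) \<Rightarrow> bool" where
  "joint_payoff md u \<gamma> \<zeta> J \<longleftrightarrow>
     J \<in> borel_measurable (prb md) \<and>
     (\<exists>x v y G.
        (\<forall>i\<in>{1..agents md}.
           load_state md i (u i) (x i) \<and>
           benefit_state md i (u i) (\<gamma> i) (x i) (v i) \<and>
           risk_state md i (\<gamma> i) (\<zeta> i) (y i) \<and>
           (AE \<omega> in prb md. set_integrable lborel {0..horizon md}
              (\<lambda>t. rP md i t (logprice md t \<omega>) (x i t \<omega>) (u i t \<omega>))) \<and>
           ito_integral (prb md) (agent_filtration md i) (noise md i) (horizon md)
              (\<lambda>t \<omega>. sigmaP md i t (logprice md t \<omega>)) (G i)) \<and>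
        (AE \<omega> in prb md. J \<omega> =
           (\<Sum>i=1..agents md.
              (LINT t:{0..horizon md}|lborel. rP md i t (logprice md t \<omega>) (x i t \<omega>) (u i t \<omega>))
              + G i \<omega> - v i (horizon md) \<omega>)))"

definition decoupled_payoff ::
  "'a contract_data \<Rightarrow> nat \<Rightarrow> (real \<Rightarrow> 'a \<Rightarrow> real) \<Rightarrow> (real \<Rightarrow> 'a \<Rightarrow> real \<times> real) \<Rightarrow>
   (real \<Rightarrow> 'a \<Rightarrow> real \<times> real) \<Rightarrow> ('a \<Rightarrow> real) \<Rightarrow> bool" where
  "decoupled_payoff md i u \<gamma> \<zeta> J \<longleftrightarrow>
     J \<in> borel_measurable (prb md) \<and>
     (\<exists>x y G I.
        load_state md i u x \<and>
        risk_state md i \<gamma> \<zeta> y \<and>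
        (AE \<omega> in prb md. set_integrable lborel {0..horizon md}
           (\<lambda>t. rP md i t (logprice md t \<omega>) (x t \<omega>) (u t \<omega>) + rA md i t (x t \<omega>) (u t \<omega>))) \<and>
        ito_integral (prb md) (agent_filtration md i) (noise md i) (horizon md)
           (\<lambda>t \<omega>. sigmaP md i t (logprice md t \<omega>) + sigmaA md i t) G \<and>
        ito_integrals (prb md) (noise md) {0, i} (horizon md) (noise_coeffs \<gamma>) I \<and>
        (AE \<omega> in prb md. J \<omega> = - b_const md i
           + (LINT t:{0..horizon md}|lborel.
                rP md i t (logprice md t \<omega>) (x t \<omega>) (u t \<omega>) + rA md i t (x t \<omega>) (u t \<omega>))
           + G \<omega> - I \<omega>))"


section \<open>The optimization problems\<close>

definition ln_ennreal :: "ennreal \<Rightarrow> ereal" where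
  "ln_ennreal z = (if z = 0 then - \<infinity> else if z = \<infinity> then \<infinity> else ereal (ln (enn2real z)))"

text \<open>The criterion \<open>-(1/\<theta>) log E[exp(-\<theta>J)]\<close>; it is \<open>-\<infinity>\<close> if the expectation is infinite.\<close>

definition risk_value :: "'a measure \<Rightarrow> real \<Rightarrow> ('a \<Rightarrow> real) \<Rightarrow> ereal" where
  "risk_value M \<theta> J = - (ereal (1 / \<theta>) * ln_ennreal (\<integral>\<^sup>+\<omega>. ennreal (exp (- \<theta> * J \<omega>)) \<partial>M))"

definition joint_feasible ::
  "'a contract_data \<Rightarrow> (nat \<Rightarrow> real \<Rightarrow> 'a \<Rightarrow> real) \<Rightarrow> (nat \<Rightarrow> real \<Rightarrow> 'a \<Rightarrow> real \<times> real) \<Rightarrow>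
   (nat \<Rightarrow> real \<Rightarrow> 'a \<Rightarrow> real \<times> real) \<Rightarrow> bool" where
  "joint_feasible md u \<gamma> \<zeta> \<longleftrightarrow>
     (\<forall>i\<in>{1..agents md}. u i \<in> controls md i \<and> \<gamma> i \<in> loadings md i \<and> \<zeta> i \<in> loadings md i \<and>
        risk_constraint md i (\<gamma> i) (\<zeta> i))"

definition joint_solution ::
  "'a contract_data \<Rightarrow> real \<Rightarrow> (nat \<Rightarrow> real \<Rightarrow> 'a \<Rightarrow> real) \<Rightarrow>
   (nat \<Rightarrow> real \<Rightarrow> 'a \<Rightarrow> real \<times> real) \<Rightarrow> (nat \<Rightarrow> real \<Rightarrow> 'a \<Rightarrow> real \<times> real) \<Rightarrow> bool" where
  "joint_solution md \<theta> u \<gamma> \<zeta> \<longleftrightarrow>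
     joint_feasible md u \<gamma> \<zeta> \<and>
     (\<exists>J. joint_payoff md u \<gamma> \<zeta> J \<and>
        (\<forall>u' \<gamma>' \<zeta>' J'. joint_feasible md u' \<gamma>' \<zeta>' \<and> joint_payoff md u' \<gamma>' \<zeta>' J' \<longrightarrow>
           risk_value (prb md) \<theta> J' \<le> risk_value (prb md) \<theta> J))"

definition decoupled_feasible ::
  "'a contract_data \<Rightarrow> nat \<Rightarrow> (real \<Rightarrow> 'a \<Rightarrow> real) \<Rightarrow> (real \<Rightarrow> 'a \<Rightarrow> real \<times> real) \<Rightarrow>
   (real \<Rightarrow> 'a \<Rightarrow> real \<times> real) \<Rightarrow> bool" where
  "decoupled_feasible md i u \<gamma> \<zeta> \<longleftrightarrow>
     u \<in> controls md i \<and> \<gamma> \<in> loadings md i \<and> \<zeta> \<in> loadings md i \<and> risk_constraint md i \<gamma> \<zeta>"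

definition decoupled_solution ::
  "'a contract_data \<Rightarrow> real \<Rightarrow> nat \<Rightarrow> (real \<Rightarrow> 'a \<Rightarrow> real) \<Rightarrow>
   (real \<Rightarrow> 'a \<Rightarrow> real \<times> real) \<Rightarrow> (real \<Rightarrow> 'a \<Rightarrow> real \<times> real) \<Rightarrow> bool" where
  "decoupled_solution md \<theta> i u \<gamma> \<zeta> \<longleftrightarrow>
     decoupled_feasible md i u \<gamma> \<zeta> \<and>
     (\<exists>J. decoupled_payoff md i u \<gamma> \<zeta> J \<and>
        (\<forall>u' \<gamma>' \<zeta>' J'. decoupled_feasible md i u' \<gamma>' \<zeta>' \<and> decoupled_payoff md i u' \<gamma>' \<zeta>' J' \<longrightarrow>
           risk_value (prb md) \<theta> J' \<le> risk_value (prb md) \<theta> J))"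

abbreviation no_loading :: "real \<Rightarrow> 'a \<Rightarrow> real \<times> real" where
  "no_loading \<equiv> (\<lambda>_ _. 0)"

definition mean_solution :: "'a contract_data \<Rightarrow> nat \<Rightarrow> (real \<Rightarrow> 'a \<Rightarrow> real) \<Rightarrow> bool" where
  "mean_solution md i u \<longleftrightarrow>
     u \<in> controls md i \<and>
     (\<exists>J. decoupled_payoff md i u no_loading no_loading J \<and>
        (\<forall>u' J'. u' \<in> controls md i \<and> decoupled_payoff md i u' no_loading no_loading J' \<longrightarrow>
           prob_space.expectation (prb md) J' \<le> prob_space.expectation (prb md) J))"

end

theory Submission
  imports Defs
begin

text \<open>Write \<open>V(J) = -(1/\<theta>) log E[exp(-\<theta>J)]\<close>. Since \<open>\<rho> \<cdot> E[J_bar] = V(J_star)\<close> and \<open>\<rho> \<ge> 0\<close>, the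
claim follows from the bound \<open>V(J_opt) \<le> E[J_bar]\<close>. It has two halves.

By Jensen's inequality \<open>V(J_opt) \<le> E[J_opt]\<close> (\<open>risk_value_le_expectation\<close>): a risk-averse criterion
never exceeds the risk-neutral one. In the mean the noise disappears. Ito integrals have expectation
zero, so inserting the dynamics of \<open>v\<^sup>i\<close> turns the expected joint payoff into
\<open>\<Sum>\<^sub>i (-b\<^sub>i + E[\<integral> (r\<^sub>i\<^sup>P + r\<^sub>i\<^sup>A) dt])\<close>, in which the loadings no longer occur and the \<open>i\<close>-th term depends on
the control of agent \<open>i\<close> alone. That term is the objective of the risk-neutral problem of agent \<open>i\<close>,
which \<open>u_bar i\<close> maximises; summing gives \<open>E[J_opt] \<le> E[J_bar]\<close>
(\<open>joint_expectation_le_mean_optimum\<close>).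

The splitting of the expectation is legitimate only if each \<open>\<integral> (r\<^sub>i\<^sup>P + r\<^sub>i\<^sup>A) dt\<close> is integrable, and this
is where the work lies. The terms with \<open>\<mu>\<^sub>i\<close> cancel in \<open>r\<^sub>i\<^sup>P + r\<^sub>i\<^sup>A\<close>, leaving
\<open>e\<^sup>w (p\<^sub>i - l\<^sub>i) - e\<^sup>w u + r\<^sub>i(x, u)\<close>. The controls are bounded, the load is bounded by Gronwall's
inequality, and \<open>p\<^sub>i - l\<^sub>i\<close> is a deterministic function that is integrable in time because the payoff
is integrable along at least one path. Hence all reduces to \<open>sup\<^sub>t E[exp w\<^sub>t] < \<infinity>\<close>
(\<open>exp_logprice_bounded_mean\<close>). The log-price solves a linear equation driven by \<open>\<integral> \<sigma>\<^sub>0 dW\<^sup>0\<close>, so it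
suffices to bound the exponential moments of an Ito integral with bounded deterministic integrand
(\<open>ito_integral_exp_moment\<close>). The integral is given as an \<open>L\<^sup>2\<close>-limit of integrals of step processes
that may be random even though \<open>\<sigma>\<^sub>0\<close> is not; replacing their coefficients by the means of \<open>\<sigma>\<^sub>0\<close> over
the partition intervals does not worsen the approximation and makes the approximants Gaussian.

Payoffs are determined only up to the choice of versions. The pathwise uniqueness of the load
(\<open>load_state_unique\<close>) makes the expected payoff independent of that choice.\<close>

section \<open>Analytic preliminaries\<close>

text \<open>Jensen's inequality for the exponential, from its tangent at the mean. With a nonnegative
integral on the right the case of an infinite exponential moment is included.\<close>

lemma (in prob_space) exp_expectation_le:
  assumes X: "integrable M X"
  shows "ennreal (exp (expectation X)) \<le> (\<integral>\<^sup>+\<omega>. ennreal (exp (X \<omega>)) \<partial>M)"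
proof -
  define m where "m = expectation X"
  have tangent: "exp m * (1 + X \<omega> - m) \<le> exp (X \<omega>)" for \<omega>
  proof -
    have "exp m * (1 + (X \<omega> - m)) \<le> exp m * exp (X \<omega> - m)"
      by (intro mult_left_mono exp_ge_add_one_self) simp
    thus ?thesis by (simp add: exp_diff algebra_simps)
  qed
  have int: "integrable M (\<lambda>\<omega>. exp m * (1 + X \<omega> - m))" using X by simp
  have "exp m = expectation (\<lambda>\<omega>. exp m * (1 + X \<omega> - m))"
    using X by (simp add: m_def prob_space)
  hence "ennreal (exp m) = ennreal (expectation (\<lambda>\<omega>. exp m * (1 + X \<omega> - m)))" by simp
  also have "\<dots> \<le> (\<integral>\<^sup>+\<omega>. ennreal (exp m * (1 + X \<omega> - m)) \<partial>M)"
  proof -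
    have "expectation (\<lambda>\<omega>. exp m * (1 + X \<omega> - m)) \<le> expectation (\<lambda>\<omega>. max 0 (exp m * (1 + X \<omega> - m)))"
      by (intro integral_mono int integrable_max) auto
    hence "ennreal (expectation (\<lambda>\<omega>. exp m * (1 + X \<omega> - m)))
        \<le> ennreal (expectation (\<lambda>\<omega>. max 0 (exp m * (1 + X \<omega> - m))))"
      by (rule ennreal_leI)
    also have "\<dots> = (\<integral>\<^sup>+\<omega>. ennreal (max 0 (exp m * (1 + X \<omega> - m))) \<partial>M)"
      by (rule nn_integral_eq_integral[symmetric]) (auto intro!: integrable_max int)
    also have "\<dots> = (\<integral>\<^sup>+\<omega>. ennreal (exp m * (1 + X \<omega> - m)) \<partial>M)"
      by (intro nn_integral_cong) (simp only: ennreal_max_0)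
    finally show ?thesis .
  qed
  also have "\<dots> \<le> (\<integral>\<^sup>+\<omega>. ennreal (exp (X \<omega>)) \<partial>M)"
    by (intro nn_integral_mono ennreal_leI tangent)
  finally show ?thesis by (simp add: m_def)
qed

text \<open>Jensen's inequality bounds the exponential moment from below by a positive number, which rules out
the convention for the logarithm of zero; an infinite moment gives the value \<open>-\<infinity>\<close>.\<close>

lemma (in prob_space) risk_value_le_expectation:
  assumes J: "integrable M J" and \<theta>: "0 < \<theta>"
  shows "risk_value M \<theta> J \<le> ereal (expectation J)"
proof -
  define z where "z = (\<integral>\<^sup>+\<omega>. ennreal (exp (- \<theta> * J \<omega>)) \<partial>M)"
  have le: "ennreal (exp (- \<theta> * expectation J)) \<le> z"
    using exp_expectation_le[of "\<lambda>\<omega>. - \<theta> * J \<omega>"] J by (simp add: z_def)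
  hence z0: "z \<noteq> 0" by (auto simp: ennreal_eq_0_iff)
  have rv: "risk_value M \<theta> J = - (ereal (1 / \<theta>) * ln_ennreal z)"
    by (simp add: risk_value_def z_def)
  show ?thesis
  proof (cases "z = \<infinity>")
    case True
    thus ?thesis using \<theta> unfolding rv by (simp add: ln_ennreal_def)
  next
    case False
    have "z \<noteq> top" using False by (simp add: infinity_ennreal_def)
    then obtain r where r: "0 \<le> r" "z = ennreal r" by (cases z) auto
    have exp_le: "exp (- \<theta> * expectation J) \<le> r" using le r by simp
    hence "- \<theta> * expectation J \<le> ln r" by (meson exp_gt_zero ln_exp ln_le_cancel_iff less_le_trans ln_ge_iff)
    hence "- (1 / \<theta> * ln r) \<le> expectation J" using \<theta> by (simp add: field_simps)
    moreover have "ln_ennreal z = ereal (ln r)"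
      using z0 False r by (simp add: ln_ennreal_def)
    ultimately show ?thesis unfolding rv by simp
  qed
qed

lemma (in prob_space) L1_le_L2:
  fixes X :: "'a \<Rightarrow> real"
  assumes [measurable]: "X \<in> borel_measurable M"
    and fin: "(\<integral>\<^sup>+\<omega>. ennreal ((X \<omega>)\<^sup>2) \<partial>M) < \<infinity>"
  shows "integrable M X" "ennreal ((expectation (\<lambda>\<omega>. \<bar>X \<omega>\<bar>))\<^sup>2) \<le> (\<integral>\<^sup>+\<omega>. ennreal ((X \<omega>)\<^sup>2) \<partial>M)"
proof -
  have sq: "integrable M (\<lambda>\<omega>. (X \<omega>)\<^sup>2)"
    using fin by (intro integrableI_bounded) auto
  show int: "integrable M X" by (rule square_integrable_imp_integrable[OF _ sq]) simp
  have "0 \<le> variance (\<lambda>\<omega>. \<bar>X \<omega>\<bar>)" by (rule variance_positive)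
  also have "\<dots> = expectation (\<lambda>\<omega>. (X \<omega>)\<^sup>2) - (expectation (\<lambda>\<omega>. \<bar>X \<omega>\<bar>))\<^sup>2"
    using int sq by (subst variance_eq) auto
  finally have "ennreal ((expectation (\<lambda>\<omega>. \<bar>X \<omega>\<bar>))\<^sup>2) \<le> ennreal (expectation (\<lambda>\<omega>. (X \<omega>)\<^sup>2))"
    by (intro ennreal_leI) simp
  thus "ennreal ((expectation (\<lambda>\<omega>. \<bar>X \<omega>\<bar>))\<^sup>2) \<le> (\<integral>\<^sup>+\<omega>. ennreal ((X \<omega>)\<^sup>2) \<partial>M)"
    using sq by (subst nn_integral_eq_integral) auto
qed

lemma (in prob_space) AE_witness:
  assumes "AE \<omega> in M. P \<omega>"
  obtains \<omega> where "\<omega> \<in> space M" "P \<omega>"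
proof -
  have "\<exists>\<omega>\<in>space M. P \<omega>"
  proof (rule ccontr)
    assume "\<not> ?thesis"
    hence "AE \<omega> in M. \<not> P \<omega>" by (intro AE_I2) auto
    with assms have "AE \<omega> in M. False" by eventually_elim auto
    thus False by simp
  qed
  thus ?thesis using that by blast
qed

text \<open>Jensen's inequality for the uniform distribution on \<open>[0,T]\<close>: it turns the exponential of a time
integral into a time integral of exponentials, whose expectation can be computed pointwise in time.\<close>

lemma exp_integral_le:
  fixes f :: "real \<Rightarrow> real"
  assumes T: "0 < T" and f: "continuous_on {0..T} f"
  shows "ennreal (exp (LINT s:{0..T}|lborel. f s))
    \<le> (\<integral>\<^sup>+s\<in>{0..T}. ennreal (exp (T * f s)) \<partial>lborel) / ennreal T"
proof -
  define U where "U = uniform_measure lborel {0..T}"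
  interpret U: prob_space U
    unfolding U_def using T by (intro prob_space_uniform_measure) auto
  define g where "g s = indicator {0..T} s *\<^sub>R f s" for s
  have gint: "integrable lborel g"
    using borel_integrable_compact[OF compact_Icc f] by (simp add: g_def[abs_def] set_integrable_def)
  hence gm [measurable]: "g \<in> borel_measurable lborel" by simp
  have Udens: "U = density lborel (\<lambda>s. ennreal (indicator {0..T} s / T))"
    using T divide_ennreal[of 1 T]
    by (auto simp: U_def uniform_measure_def indicator_def intro!: density_cong)
  have "integrable U (\<lambda>s. T * g s)"
  proof -
    have "integrable lborel (\<lambda>s. (indicator {0..T} s / T) *\<^sub>R (T * g s))"
      by (rule Bochner_Integration.integrable_cong[THEN iffD1, OF refl _ gint])
        (use T in \<open>auto simp: g_def indicator_def\<close>)
    thus ?thesis unfolding Udens using T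
      by (subst integrable_density) (auto simp: indicator_def)
  qed
  note jensen = U.exp_expectation_le[OF this]
  have "integral\<^sup>L U (\<lambda>s. T * g s) = (\<integral>s. (indicator {0..T} s / T) *\<^sub>R (T * g s) \<partial>lborel)"
    unfolding Udens using T by (subst integral_density) (auto simp: indicator_def)
  also have "\<dots> = (LINT s:{0..T}|lborel. f s)"
    unfolding set_lebesgue_integral_def
    by (rule Bochner_Integration.integral_cong) (use T in \<open>auto simp: g_def indicator_def\<close>)
  finally have mean: "integral\<^sup>L U (\<lambda>s. T * g s) = (LINT s:{0..T}|lborel. f s)" .
  have "(\<integral>\<^sup>+s. ennreal (exp (T * g s)) \<partial>U)
      = (\<integral>\<^sup>+s. ennreal (exp (T * g s)) * indicator {0..T} s \<partial>lborel) / emeasure lborel {0..T}"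
    unfolding U_def by (rule nn_integral_uniform_measure) auto
  also have "\<dots> = (\<integral>\<^sup>+s\<in>{0..T}. ennreal (exp (T * f s)) \<partial>lborel) / ennreal T"
    using T by (intro arg_cong2[where f="(/)"] nn_integral_cong) (auto simp: g_def indicator_def)
  finally show ?thesis using jensen mean by simp
qed

lemma set_integrable_continuous_Icc:
  fixes f :: "real \<Rightarrow> real"
  assumes "continuous_on {a..b} f"
  shows "set_integrable lborel {a..b} f"
  using borel_integrable_compact[OF compact_Icc assms] by (simp add: set_integrable_def)

lemma continuous_on_set_lebesgue_integral:
  fixes f :: "real \<Rightarrow> real"
  assumes "set_integrable lborel {0..T} f"
  shows "continuous_on {0..T} (\<lambda>t. LINT s:{0..t}|lborel. f s)"
proof -
  have "f integrable_on {0..T}" using set_borel_integral_eq_integral(1)[OF assms] .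
  hence "continuous_on {0..T} (\<lambda>t. integral {0..t} f)"
    by (rule indefinite_integral_continuous_1)
  moreover have "integral {0..t} f = (LINT s:{0..t}|lborel. f s)" if "t \<in> {0..T}" for t
    by (rule set_borel_integral_eq_integral(2)[symmetric])
      (rule set_integrable_subset[OF assms], use that in auto)
  ultimately show ?thesis by (simp cong: continuous_on_cong_simp)
qed

lemma set_integral_abs_le:
  fixes f g :: "real \<Rightarrow> real"
  assumes f: "set_integrable lborel A f" and g: "set_integrable lborel A g"
    and le: "\<And>s. s \<in> A \<Longrightarrow> \<bar>f s\<bar> \<le> g s"
  shows "\<bar>LINT s:A|lborel. f s\<bar> \<le> (LINT s:A|lborel. g s)"
proof -
  have "\<bar>LINT s:A|lborel. f s\<bar> \<le> (LINT s:A|lborel. \<bar>f s\<bar>)"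
    unfolding set_lebesgue_integral_def
    by (rule order_trans[OF integral_abs_bound]) (simp add: abs_mult)
  also have "\<dots> \<le> (LINT s:A|lborel. g s)"
    by (rule set_integral_mono) (use set_integrable_abs[OF f] g le in auto)
  finally show ?thesis .
qed

text \<open>Equations between processes hold almost surely at each fixed time. Countably many times suffice to
get them almost surely at all times.\<close>

lemma continuous_zero_on_rationals:
  fixes d :: "real \<Rightarrow> real"
  assumes T: "0 < T" and d: "continuous_on {0..T} d" and zero: "\<And>t. t \<in> \<rat> \<inter> {0..T} \<Longrightarrow> d t = 0"
    and t: "t \<in> {0..T}"
  shows "d t = 0"
proof -
  have "{0<..<T} \<inter> closure \<rat> \<subseteq> closure ({0<..<T} \<inter> \<rat>)" by (rule open_Int_closure_subset) simp
  hence "{0<..<T} \<subseteq> closure ({0<..<T} \<inter> \<rat>)" by (simp add: Rats_closure_real)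
  hence "closure {0<..<T} \<subseteq> closure ({0<..<T} \<inter> \<rat>)" by (rule closure_minimal) simp
  hence sub: "{0..T} \<subseteq> closure ({0<..<T} \<inter> \<rat>)" using T by simp
  moreover have "closure ({0<..<T} \<inter> \<rat>) \<subseteq> {0..T}" by (rule closure_minimal) auto
  ultimately have "continuous_on (closure ({0<..<T} \<inter> \<rat>)) d"
    using d continuous_on_subset by blast
  thus ?thesis
    by (rule continuous_constant_on_closure) (use zero sub t in auto)
qed

text \<open>The function \<open>exp (-K t) (A + K \<integral>\<^sub>0\<^sup>t g)\<close> is nonincreasing.\<close>

lemma gronwall:
  fixes g :: "real \<Rightarrow> real"
  assumes g: "continuous_on {0..T} g" and K: "0 \<le> K"
    and le: "\<And>t. t \<in> {0..T} \<Longrightarrow> g t \<le> A + K * (LINT s:{0..t}|lborel. g s)"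
    and t: "t \<in> {0..T}"
  shows "g t \<le> A * exp (K * t)"
proof -
  define G where "G t = integral {0..t} g" for t
  \<comment> \<open>Negated, because the monotonicity criterion is for nondecreasing functions.\<close>
  define h where "h t = - exp (- K * t) * (A + K * G t)" for t
  have LG: "(LINT s:{0..t}|lborel. g s) = G t" if "t \<in> {0..T}" for t
    unfolding G_def
    by (rule set_borel_integral_eq_integral(2), rule set_integrable_continuous_Icc,
        rule continuous_on_subset[OF g]) (use that in auto)
  have dG: "(G has_real_derivative g t) (at t within {0..T})" if "t \<in> {0..T}" for t
    using integral_has_real_derivative[OF g that] by (simp add: G_def[abs_def])
  have dh: "(h has_real_derivative K * exp (- K * t) * (A + K * G t - g t)) (at t within {0..T})"
    if "t \<in> {0..T}" for t
    unfolding h_def by (rule derivative_eq_intros dG[OF that] refl)+ (simp add: algebra_simps)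
  have "h 0 \<le> h t"
  proof (cases "t = 0")
    case False
    hence pos: "0 \<le> t" using t by auto
    show ?thesis
    proof (rule DERIV_nonneg_imp_increasing_open[OF pos])
      show "continuous_on {0..t} h"
        by (rule DERIV_continuous_on[OF DERIV_subset[OF dh]]) (use t in auto)
      fix x assume x: "0 < x" "x < t"
      hence "at x within {0..T} = at x" using t by (intro at_within_Icc_at) auto
      with dh[of x] x t have "(h has_real_derivative K * exp (- K * x) * (A + K * G x - g x)) (at x)"
        by auto
      moreover have "0 \<le> K * exp (- K * x) * (A + K * G x - g x)"
        using le[of x] LG[of x] x t K by (intro mult_nonneg_nonneg) auto
      ultimately show "\<exists>y. (h has_real_derivative y) (at x) \<and> 0 \<le> y" by blast
    qed
  qed simp
  hence "exp (- K * t) * (A + K * G t) \<le> A" by (simp add: h_def G_def)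
  hence "exp (K * t) * (exp (- K * t) * (A + K * G t)) \<le> exp (K * t) * A"
    by (rule mult_left_mono) simp
  hence "A + K * G t \<le> A * exp (K * t)"
    by (simp add: mult.assoc[symmetric] exp_add[symmetric] mult.commute)
  with le[OF t] LG[OF t] show ?thesis by simp
qed

text \<open>Applied to paths of the log-price: \<open>g\<close> collects the initial value, the deterministic drift and the
noise. The bound involves \<open>g\<close> only at time \<open>t\<close> and through a time average, so that moments of \<open>g\<close> at
fixed times control those of \<open>w\<close>.\<close>

lemma linear_ode_bound:
  fixes w :: "real \<Rightarrow> real"
  assumes w: "continuous_on {0..T} w"
    and g: "\<And>t. t \<in> {0..T} \<Longrightarrow> g t = w t + r * (LINT s:{0..t}|lborel. w s)"
    and t: "t \<in> {0..T}"
  shows "\<bar>w t\<bar> \<le> \<bar>g t\<bar> + \<bar>r\<bar> * exp (\<bar>r\<bar> * T) * (LINT s:{0..T}|lborel. \<bar>g s\<bar>)"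
proof -
  define V where "V t = (LINT s:{0..t}|lborel. \<bar>w s\<bar>)" for t
  define A where "A = (LINT s:{0..T}|lborel. \<bar>g s\<bar>)"
  have wi: "set_integrable lborel {0..t} w" and awi: "set_integrable lborel {0..t} (\<lambda>s. \<bar>w s\<bar>)"
    if "t \<in> {0..T}" for t
    using that by (auto intro!: set_integrable_continuous_Icc continuous_intros
        continuous_on_subset[OF w])
  have "continuous_on {0..T} (\<lambda>t. w t + r * (LINT s:{0..t}|lborel. w s))"
    using t by (intro continuous_intros w continuous_on_set_lebesgue_integral wi) auto
  hence gc: "continuous_on {0..T} g" using g by (simp cong: continuous_on_cong_simp)
  hence gi: "set_integrable lborel {0..t} (\<lambda>s. \<bar>g s\<bar>)" if "t \<in> {0..T}" for t
    using that by (auto intro!: set_integrable_continuous_Icc continuous_intros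
        continuous_on_subset[OF gc])
  have Vc: "continuous_on {0..T} V"
    unfolding V_def using t by (intro continuous_on_set_lebesgue_integral awi) auto
  have pw: "\<bar>w t\<bar> \<le> \<bar>g t\<bar> + \<bar>r\<bar> * V t" if "t \<in> {0..T}" for t
  proof -
    have "\<bar>w t\<bar> \<le> \<bar>g t\<bar> + \<bar>r\<bar> * \<bar>LINT s:{0..t}|lborel. w s\<bar>"
      using g[OF that] by (simp add: abs_mult[symmetric])
    moreover have "\<bar>LINT s:{0..t}|lborel. w s\<bar> \<le> V t"
      unfolding V_def by (rule set_integral_abs_le[OF wi[OF that] awi[OF that]]) simp
    ultimately show ?thesis by (smt (verit) mult_left_mono abs_ge_zero)
  qed
  \<comment> \<open>The integrated inequality has the constant \<open>A\<close>, to which Gronwall applies.\<close>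
  have V0: "V t \<le> A + \<bar>r\<bar> * (LINT s:{0..t}|lborel. V s)" if "t \<in> {0..T}" for t
  proof -
    have Vi: "set_integrable lborel {0..t} (\<lambda>s. \<bar>r\<bar> * V s)"
      using that by (auto intro!: set_integrable_continuous_Icc continuous_intros
        continuous_on_subset[OF Vc])
    have "V t \<le> (LINT s:{0..t}|lborel. \<bar>g s\<bar> + \<bar>r\<bar> * V s)"
      unfolding V_def using that pw
      by (intro set_integral_mono awi set_integral_add gi Vi[unfolded V_def]) (auto simp: V_def)
    also have "\<dots> = (LINT s:{0..t}|lborel. \<bar>g s\<bar>) + (LINT s:{0..t}|lborel. \<bar>r\<bar> * V s)"
      using that by (intro set_integral_add gi Vi)
    also have "(LINT s:{0..t}|lborel. \<bar>r\<bar> * V s) = \<bar>r\<bar> * (LINT s:{0..t}|lborel. V s)"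
      by simp
    also have "(LINT s:{0..t}|lborel. \<bar>g s\<bar>) \<le> A"
      unfolding A_def set_lebesgue_integral_def
      using gi[OF that] gi[of T] that
      by (intro integral_mono) (auto simp: set_integrable_def indicator_def)
    finally show ?thesis by simp
  qed
  have A0: "0 \<le> A" unfolding A_def set_lebesgue_integral_def by (intro integral_nonneg_AE) auto
  have "V t \<le> A * exp (\<bar>r\<bar> * t)" by (rule gronwall[OF Vc _ V0 t]) auto
  also have "\<dots> \<le> A * exp (\<bar>r\<bar> * T)"
    using t A0 by (intro mult_left_mono) (auto intro!: mult_left_mono)
  finally have "\<bar>r\<bar> * V t \<le> \<bar>r\<bar> * (A * exp (\<bar>r\<bar> * T))" by (rule mult_left_mono) simp
  thus ?thesis using pw[OF t] by (simp add: A_def mult_ac)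
qed

section \<open>Ito integrals against a Brownian motion with independent increments\<close>

text \<open>Completing the square: exponential tilting shifts the mean of a normal density.\<close>

lemma normal_density_exp:
  assumes s: "0 < s"
  shows "normal_density 0 s x * exp (c * x) = exp (c\<^sup>2 * s\<^sup>2 / 2) * normal_density (c * s\<^sup>2) s x"
proof -
  have "- x\<^sup>2 / (2 * s\<^sup>2) + c * x = c\<^sup>2 * s\<^sup>2 / 2 - (x - c * s\<^sup>2)\<^sup>2 / (2 * s\<^sup>2)"
    using s by (simp add: field_simps power2_eq_square)
  hence "exp (- x\<^sup>2 / (2 * s\<^sup>2)) * exp (c * x)
      = exp (c\<^sup>2 * s\<^sup>2 / 2) * exp (- (x - c * s\<^sup>2)\<^sup>2 / (2 * s\<^sup>2))"
    by (simp add: exp_add[symmetric])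
  thus ?thesis by (simp add: normal_density_def mult_ac)
qed

lemma has_bochner_integral_normal_exp:
  assumes s: "0 < s"
  shows "has_bochner_integral lborel (\<lambda>x. normal_density 0 s x * exp (c * x)) (exp (c\<^sup>2 * s\<^sup>2 / 2))"
proof -
  have "has_bochner_integral lborel (normal_density (c * s\<^sup>2) s) 1"
    using s by (simp add: has_bochner_integral_iff integral_normal_density)
  from has_bochner_integral_mult_right[OF this, of "exp (c\<^sup>2 * s\<^sup>2 / 2)"]
  show ?thesis by (simp add: normal_density_exp[OF s])
qed

text \<open>A step integrand is integrated against the increments of \<open>B\<close>, so all that is used of a
  Brownian motion and its filtration is that increments are Gaussian and independent of the past.\<close>

locale brownian_filtration = prob_space M
  for M :: "'a measure" and F :: "real \<Rightarrow> 'a measure" and B :: "real \<Rightarrow> 'a \<Rightarrow> real" and T :: real +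
  assumes subalg: "\<And>s. 0 \<le> s \<Longrightarrow> s \<le> T \<Longrightarrow> subalgebra M (F s)"
    and filtration: "\<And>s t. 0 \<le> s \<Longrightarrow> s \<le> t \<Longrightarrow> t \<le> T \<Longrightarrow> sets (F s) \<subseteq> sets (F t)"
    and adapted: "\<And>s. 0 \<le> s \<Longrightarrow> s \<le> T \<Longrightarrow> B s \<in> borel_measurable (F s)"
    and normal_increment: "\<And>s t. 0 \<le> s \<Longrightarrow> s < t \<Longrightarrow> t \<le> T \<Longrightarrow>
      distributed M lborel (\<lambda>\<omega>. B t \<omega> - B s \<omega>) (normal_density 0 (sqrt (t - s)))"
    and indep_increment: "\<And>s t. 0 \<le> s \<Longrightarrow> s < t \<Longrightarrow> t \<le> T \<Longrightarrow>
      indep_set (sets (F s)) (sets (vimage_algebra (space M) (\<lambda>\<omega>. B t \<omega> - B s \<omega>) borel))"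
begin

lemma space_F: "0 \<le> s \<Longrightarrow> s \<le> T \<Longrightarrow> space (F s) = space M"
  using subalg by (simp add: subalgebra_def)

lemma measurable_from_F:
  "0 \<le> s \<Longrightarrow> s \<le> T \<Longrightarrow> X \<in> borel_measurable (F s) \<Longrightarrow> X \<in> borel_measurable M"
  using measurable_from_subalg[OF subalg] by blast

lemma measurable_F_mono:
  "0 \<le> s \<Longrightarrow> s \<le> t \<Longrightarrow> t \<le> T \<Longrightarrow> X \<in> borel_measurable (F s) \<Longrightarrow> X \<in> borel_measurable (F t)"
  using filtration[of s t] space_F[of s] space_F[of t]
  by (intro measurable_from_subalg[of "F t" "F s"]) (auto simp: subalgebra_def)

lemma measurable_B [measurable]: "0 \<le> s \<Longrightarrow> s \<le> T \<Longrightarrow> B s \<in> borel_measurable M"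
  using adapted measurable_from_F by blast

lemma indep_mult:
  fixes X :: "'a \<Rightarrow> real" and f :: "real \<Rightarrow> real"
  assumes st: "0 \<le> s" "s < t" "t \<le> T"
    and X: "X \<in> borel_measurable (F s)" "integrable M X"
    and f [measurable]: "f \<in> borel_measurable borel"
    and fi: "integrable M (\<lambda>\<omega>. f (B t \<omega> - B s \<omega>))"
  shows "integrable M (\<lambda>\<omega>. X \<omega> * f (B t \<omega> - B s \<omega>))"
    and "expectation (\<lambda>\<omega>. X \<omega> * f (B t \<omega> - B s \<omega>)) = expectation X * expectation (\<lambda>\<omega>. f (B t \<omega> - B s \<omega>))"
proof -
  let ?D = "\<lambda>\<omega>. B t \<omega> - B s \<omega>"
  have [measurable]: "X \<in> borel_measurable M" "B t \<in> borel_measurable M" "B s \<in> borel_measurable M"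
    using X st by (auto intro: measurable_from_F)
  have "{X -` A \<inter> space M |A. A \<in> sets borel} \<subseteq> sets (F s)"
    using measurable_sets[OF X(1)] space_F[of s] st by auto
  hence 1: "sigma_sets (space M) {X -` A \<inter> space M |A. A \<in> sets borel} \<subseteq> sets (F s)"
    using space_F[of s] st sets.sigma_sets_subset[of _ "F s"] by auto
  have "{(\<lambda>\<omega>. f (?D \<omega>)) -` A \<inter> space M |A. A \<in> sets borel}
      \<subseteq> sets (vimage_algebra (space M) ?D borel)"
  proof clarify
    fix A :: "real set" assume "A \<in> sets borel"
    hence "f -` A \<in> sets borel" using measurable_sets[OF f, of A] by simp
    hence "?D -` (f -` A) \<inter> space M \<in> sets (vimage_algebra (space M) ?D borel)"
      by (rule in_vimage_algebra)
    thus "(\<lambda>\<omega>. f (?D \<omega>)) -` A \<inter> space M \<in> sets (vimage_algebra (space M) ?D borel)"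
      by (simp add: vimage_def)
  qed
  hence 2: "sigma_sets (space M) {(\<lambda>\<omega>. f (?D \<omega>)) -` A \<inter> space M |A. A \<in> sets borel}
      \<subseteq> sets (vimage_algebra (space M) ?D borel)"
    using sets.sigma_sets_subset[of _ "vimage_algebra (space M) ?D borel"] by auto
  have "indep_set (sigma_sets (space M) {X -` A \<inter> space M |A. A \<in> sets borel})
     (sigma_sets (space M) {(\<lambda>\<omega>. f (?D \<omega>)) -` A \<inter> space M |A. A \<in> sets borel})"
    using indep_increment[OF st] unfolding indep_set_def
    by (rule indep_sets_mono_sets) (use 1 2 in \<open>auto split: bool.split\<close>)
  hence ind: "indep_var borel X borel (\<lambda>\<omega>. f (?D \<omega>))"
    unfolding indep_var_eq by simp
  show "integrable M (\<lambda>\<omega>. X \<omega> * f (?D \<omega>))"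
    by (rule indep_var_integrable[OF ind X(2) fi])
  show "expectation (\<lambda>\<omega>. X \<omega> * f (?D \<omega>)) = expectation X * expectation (\<lambda>\<omega>. f (?D \<omega>))"
    by (rule indep_var_lebesgue_integral[OF ind X(2) fi])
qed

text \<open>The first two moments yield the mean and the isometry of step integrals, the exponential moment
their tails.\<close>

lemma increment_moments:
  assumes st: "0 \<le> s" "s < t" "t \<le> T"
  shows "has_bochner_integral M (\<lambda>\<omega>. B t \<omega> - B s \<omega>) 0"
    and "has_bochner_integral M (\<lambda>\<omega>. (B t \<omega> - B s \<omega>)\<^sup>2) (t - s)"
    and "has_bochner_integral M (\<lambda>\<omega>. exp (c * (B t \<omega> - B s \<omega>))) (exp (c\<^sup>2 * (t - s) / 2))"
proof -
  note D = normal_increment[OF st]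
  have s0: "0 < sqrt (t - s)" using st by simp
  have gen: "has_bochner_integral M (\<lambda>\<omega>. f (B t \<omega> - B s \<omega>)) x"
    if "has_bochner_integral lborel (\<lambda>y. normal_density 0 (sqrt (t - s)) y * f y) x"
      "f \<in> borel_measurable borel" for f :: "real \<Rightarrow> real" and x
    using distributed_integrable[OF D, of f] distributed_integral[OF D, of f] that
    by (auto simp: has_bochner_integral_iff)
  show "has_bochner_integral M (\<lambda>\<omega>. B t \<omega> - B s \<omega>) 0"
    using normal_moment_nz_1[OF s0, of 0] by (intro gen) auto
  show "has_bochner_integral M (\<lambda>\<omega>. (B t \<omega> - B s \<omega>)\<^sup>2) (t - s)"
    using normal_moment_even[OF s0, of 0 1] st by (intro gen) (auto simp: diff_divide_distrib)
  show "has_bochner_integral M (\<lambda>\<omega>. exp (c * (B t \<omega> - B s \<omega>))) (exp (c\<^sup>2 * (t - s) / 2))"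
    using has_bochner_integral_normal_exp[OF s0, of c] st by (intro gen) auto
qed

text \<open>The form in which independence of increments enters the inductions over partitions. Degenerate
intervals are allowed, as they are in partitions.\<close>

lemma mult_increment:
  fixes X :: "'a \<Rightarrow> real"
  assumes st: "0 \<le> s" "s \<le> t" "t \<le> T"
    and X: "X \<in> borel_measurable (F s)" "integrable M X"
  shows "has_bochner_integral M (\<lambda>\<omega>. X \<omega> * (B t \<omega> - B s \<omega>)) 0"
    and "has_bochner_integral M (\<lambda>\<omega>. X \<omega> * (B t \<omega> - B s \<omega>)\<^sup>2) (expectation X * (t - s))"
    and "has_bochner_integral M (\<lambda>\<omega>. X \<omega> * exp (c * (B t \<omega> - B s \<omega>)))
      (expectation X * exp (c\<^sup>2 * (t - s) / 2))"
proof -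
  have 1: "integrable M (\<lambda>\<omega>. X \<omega> * f (B t \<omega> - B s \<omega>)) \<and>
      expectation (\<lambda>\<omega>. X \<omega> * f (B t \<omega> - B s \<omega>)) = expectation X * v"
    if "s < t" "f \<in> borel_measurable borel" "has_bochner_integral M (\<lambda>\<omega>. f (B t \<omega> - B s \<omega>)) v"
    for f v
    using indep_mult[OF st(1) that(1) st(3) X that(2)] that(3) by (simp add: has_bochner_integral_iff)
  show "has_bochner_integral M (\<lambda>\<omega>. X \<omega> * (B t \<omega> - B s \<omega>)) 0"
  proof (cases "s = t")
    case False
    thus ?thesis using 1[OF _ _ increment_moments(1)] st by (simp add: has_bochner_integral_iff)
  qed (simp add: has_bochner_integral_zero)
  show "has_bochner_integral M (\<lambda>\<omega>. X \<omega> * (B t \<omega> - B s \<omega>)\<^sup>2) (expectation X * (t - s))"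
  proof (cases "s = t")
    case False
    thus ?thesis using 1[OF _ _ increment_moments(2)] st by (simp add: has_bochner_integral_iff)
  qed (simp add: has_bochner_integral_zero)
  show "has_bochner_integral M (\<lambda>\<omega>. X \<omega> * exp (c * (B t \<omega> - B s \<omega>)))
      (expectation X * exp (c\<^sup>2 * (t - s) / 2))"
  proof (cases "s = t")
    case False
    thus ?thesis using 1[OF _ _ increment_moments(3)[of s t c]] st by (simp add: has_bochner_integral_iff)
  next
    case True
    thus ?thesis using X(2) by (simp add: has_bochner_integral_iff)
  qed
qed

definition step_process :: "real \<Rightarrow> nat \<Rightarrow> (nat \<Rightarrow> real) \<Rightarrow> (nat \<Rightarrow> 'a \<Rightarrow> real) \<Rightarrow> bool" where
  "step_process t m \<tau> H \<longleftrightarrow> 0 \<le> \<tau> 0 \<and> (\<forall>k<m. \<tau> k \<le> \<tau> (Suc k)) \<and> \<tau> m \<le> t \<and>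
     (\<forall>k<m. H k \<in> borel_measurable (F (\<tau> k)) \<and> (\<exists>C. \<forall>\<omega>\<in>space (F (\<tau> k)). \<bar>H k \<omega>\<bar> \<le> C))"

lemma step_process_restrict:
  assumes "step_process t (Suc m) \<tau> H"
  shows "step_process (\<tau> m) m \<tau> H"
  using assms by (simp add: step_process_def)

lemma step_process_partition:
  assumes "step_process t m \<tau> H"
  shows "j \<le> k \<Longrightarrow> k \<le> m \<Longrightarrow> \<tau> j \<le> \<tau> k" and "k \<le> m \<Longrightarrow> 0 \<le> \<tau> k" and "k \<le> m \<Longrightarrow> \<tau> k \<le> t"
proof -
  have mono: "\<tau> j \<le> \<tau> k" if "j \<le> k" "k \<le> m" for j k
    using that
  proof (induction k rule: dec_induct)
    case (step n)
    hence "\<tau> n \<le> \<tau> (Suc n)" "\<tau> j \<le> \<tau> n" using assms by (simp_all add: step_process_def)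
    thus ?case by linarith
  qed simp
  show "j \<le> k \<Longrightarrow> k \<le> m \<Longrightarrow> \<tau> j \<le> \<tau> k" by (rule mono)
  show "k \<le> m \<Longrightarrow> 0 \<le> \<tau> k" using mono[of 0 k] assms by (auto simp: step_process_def)
  show "k \<le> m \<Longrightarrow> \<tau> k \<le> t" using mono[of k m] assms by (auto simp: step_process_def)
qed

text \<open>Induction over the partition: the integral up to \<open>\<tau> m\<close> belongs to the past of the next increment, so
the cross term has mean zero.\<close>

lemma step_integral_isometry:
  assumes "step_process t m \<tau> H" and "t \<le> T"
  defines "S \<equiv> \<lambda>\<omega>. \<Sum>k<m. H k \<omega> * (B (\<tau> (Suc k)) \<omega> - B (\<tau> k) \<omega>)"
  shows "S \<in> borel_measurable (F (\<tau> m)) \<and> has_bochner_integral M S 0 \<and>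
    has_bochner_integral M (\<lambda>\<omega>. (S \<omega>)\<^sup>2) (\<Sum>k<m. expectation (\<lambda>\<omega>. (H k \<omega>)\<^sup>2) * (\<tau> (Suc k) - \<tau> k))"
  using assms(1,2) unfolding S_def
proof (induction m arbitrary: t)
  case (Suc m)
  let ?S = "\<lambda>\<omega>. \<Sum>k<m. H k \<omega> * (B (\<tau> (Suc k)) \<omega> - B (\<tau> k) \<omega>)"
  let ?D = "\<lambda>\<omega>. B (\<tau> (Suc m)) \<omega> - B (\<tau> m) \<omega>"
  note part = step_process_partition[OF Suc.prems(1)]
  have tm: "0 \<le> \<tau> m" "\<tau> m \<le> \<tau> (Suc m)" "\<tau> (Suc m) \<le> T" "\<tau> m \<le> T"
    using part(1)[of m "Suc m"] part(2)[of m] part(3)[of "Suc m"] Suc.prems(2) by auto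
  note IH = Suc.IH[OF step_process_restrict[OF Suc.prems(1)] tm(4)]
  hence S: "?S \<in> borel_measurable (F (\<tau> m))" "has_bochner_integral M ?S 0"
    "has_bochner_integral M (\<lambda>\<omega>. (?S \<omega>)\<^sup>2) (\<Sum>k<m. expectation (\<lambda>\<omega>. (H k \<omega>)\<^sup>2) * (\<tau> (Suc k) - \<tau> k))"
    by blast+
  have H: "H m \<in> borel_measurable (F (\<tau> m))" and "\<exists>C. \<forall>\<omega>\<in>space (F (\<tau> m)). \<bar>H m \<omega>\<bar> \<le> C"
    using Suc.prems(1) by (auto simp: step_process_def)
  then obtain C where C: "\<And>\<omega>. \<omega> \<in> space M \<Longrightarrow> \<bar>H m \<omega>\<bar> \<le> C"
    using space_F tm by auto
  have HM [measurable]: "H m \<in> borel_measurable M" using H tm by (auto intro: measurable_from_F)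
  have Hi: "integrable M (H m)"
    using C by (intro integrable_const_bound[where B=C] AE_I2) auto
  have H2i: "integrable M (\<lambda>\<omega>. (H m \<omega>)\<^sup>2)"
  proof (rule integrable_const_bound[where B="C\<^sup>2"])
    show "AE \<omega> in M. norm ((H m \<omega>)\<^sup>2) \<le> C\<^sup>2"
      using power_mono[OF C, of _ 2] by (intro AE_I2) simp
  qed simp
  have SHi: "integrable M (\<lambda>\<omega>. ?S \<omega> * H m \<omega>)"
  proof (rule Bochner_Integration.integrable_bound)
    show "integrable M (\<lambda>\<omega>. C * ?S \<omega>)" using S(2) by (auto simp: has_bochner_integral_iff)
    show "(\<lambda>\<omega>. ?S \<omega> * H m \<omega>) \<in> borel_measurable M"
      using S(2) by (auto simp: has_bochner_integral_iff)
    show "AE \<omega> in M. norm (?S \<omega> * H m \<omega>) \<le> norm (C * ?S \<omega>)"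
    proof (rule AE_I2)
      fix \<omega> assume "\<omega> \<in> space M"
      from C[OF this] have "\<bar>H m \<omega>\<bar> \<le> \<bar>C\<bar>" by linarith
      thus "norm (?S \<omega> * H m \<omega>) \<le> norm (C * ?S \<omega>)"
        by (simp add: abs_mult mult.commute[of "\<bar>C\<bar>"] mult_left_mono)
    qed
  qed
  have D: "?D \<in> borel_measurable (F (\<tau> (Suc m)))"
    using adapted[of "\<tau> (Suc m)"] measurable_F_mono[of "\<tau> m" "\<tau> (Suc m)" "B (\<tau> m)"] adapted[of "\<tau> m"] tm
    by (auto intro!: borel_measurable_diff)
  have m1: "(\<lambda>\<omega>. ?S \<omega> + H m \<omega> * ?D \<omega>) \<in> borel_measurable (F (\<tau> (Suc m)))"
    using D measurable_F_mono[OF tm(1-3) S(1)] measurable_F_mono[OF tm(1-3) H]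
    by (intro borel_measurable_add borel_measurable_times)
  note hd = mult_increment(1)[OF tm(1-3) H Hi]
  have m2: "has_bochner_integral M (\<lambda>\<omega>. ?S \<omega> + H m \<omega> * ?D \<omega>) (0 + 0)"
    by (rule has_bochner_integral_add[OF S(2) hd])
  have "has_bochner_integral M (\<lambda>\<omega>. (?S \<omega> * H m \<omega>) * ?D \<omega>) 0"
    by (rule mult_increment(1)[OF tm(1-3) borel_measurable_times[OF S(1) H] SHi])
  from has_bochner_integral_mult_right[OF this, of 2]
  have cross: "has_bochner_integral M (\<lambda>\<omega>. 2 * (?S \<omega> * H m \<omega> * ?D \<omega>)) 0" by simp
  have sq: "has_bochner_integral M (\<lambda>\<omega>. (H m \<omega>)\<^sup>2 * (?D \<omega>)\<^sup>2)
      (expectation (\<lambda>\<omega>. (H m \<omega>)\<^sup>2) * (\<tau> (Suc m) - \<tau> m))"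
    by (rule mult_increment(2)[OF tm(1-3) borel_measurable_power[OF H] H2i])
  have m3: "has_bochner_integral M (\<lambda>\<omega>. (?S \<omega> + H m \<omega> * ?D \<omega>)\<^sup>2)
      (\<Sum>k<Suc m. expectation (\<lambda>\<omega>. (H k \<omega>)\<^sup>2) * (\<tau> (Suc k) - \<tau> k))"
    using has_bochner_integral_add[OF has_bochner_integral_add[OF S(3) cross] sq]
    by (simp add: power2_eq_square algebra_simps)
  show ?case using m1 m2 m3 by simp
qed (simp add: has_bochner_integral_zero)

text \<open>With deterministic coefficients the step integral is a sum of independent Gaussian variables and the
exponential moments multiply.\<close>

lemma step_integral_exp:
  assumes "step_process t m \<tau> (\<lambda>k _. h k)" and "t \<le> T"
  defines "S \<equiv> \<lambda>\<omega>. \<Sum>k<m. h k * (B (\<tau> (Suc k)) \<omega> - B (\<tau> k) \<omega>)"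
  shows "S \<in> borel_measurable (F (\<tau> m)) \<and> has_bochner_integral M (\<lambda>\<omega>. exp (c * S \<omega>))
    (exp (c\<^sup>2 * (\<Sum>k<m. (h k)\<^sup>2 * (\<tau> (Suc k) - \<tau> k)) / 2))"
  using assms(1,2) unfolding S_def
proof (induction m arbitrary: t)
  case 0
  show ?case by (simp add: has_bochner_integral_iff prob_space)
next
  case (Suc m)
  let ?S = "\<lambda>\<omega>. \<Sum>k<m. h k * (B (\<tau> (Suc k)) \<omega> - B (\<tau> k) \<omega>)"
  let ?D = "\<lambda>\<omega>. B (\<tau> (Suc m)) \<omega> - B (\<tau> m) \<omega>"
  note part = step_process_partition[OF Suc.prems(1)]
  have tm: "0 \<le> \<tau> m" "\<tau> m \<le> \<tau> (Suc m)" "\<tau> (Suc m) \<le> T" "\<tau> m \<le> T"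
    using part(1)[of m "Suc m"] part(2)[of m] part(3)[of "Suc m"] Suc.prems(2) by auto
  note IH = Suc.IH[OF step_process_restrict[OF Suc.prems(1)] tm(4)]
  have m1: "(\<lambda>\<omega>. ?S \<omega> + h m * ?D \<omega>) \<in> borel_measurable (F (\<tau> (Suc m)))"
    using adapted[of "\<tau> (Suc m)"] measurable_F_mono[of "\<tau> m" "\<tau> (Suc m)" "B (\<tau> m)"]
      adapted[of "\<tau> m"] tm measurable_F_mono[OF tm(1-3), of ?S] IH
    by (intro borel_measurable_add borel_measurable_times borel_measurable_diff) auto
  have E: "(\<lambda>\<omega>. exp (c * ?S \<omega>)) \<in> borel_measurable (F (\<tau> m))"
    using IH by (intro measurable_compose[OF _ borel_measurable_exp] borel_measurable_times) auto
  have Ei: "integrable M (\<lambda>\<omega>. exp (c * ?S \<omega>))"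
    using IH by (auto simp: has_bochner_integral_iff)
  have Ev: "expectation (\<lambda>\<omega>. exp (c * ?S \<omega>)) = exp (c\<^sup>2 * (\<Sum>k<m. (h k)\<^sup>2 * (\<tau> (Suc k) - \<tau> k)) / 2)"
    using IH by (auto simp: has_bochner_integral_iff)
  have m2: "has_bochner_integral M (\<lambda>\<omega>. exp (c * ?S \<omega>) * exp (c * h m * ?D \<omega>))
      (expectation (\<lambda>\<omega>. exp (c * ?S \<omega>)) * exp ((c * h m)\<^sup>2 * (\<tau> (Suc m) - \<tau> m) / 2))"
    by (rule mult_increment(3)[OF tm(1-3) E Ei])
  have "has_bochner_integral M (\<lambda>\<omega>. exp (c * (?S \<omega> + h m * ?D \<omega>)))
      (exp (c\<^sup>2 * (\<Sum>k<Suc m. (h k)\<^sup>2 * (\<tau> (Suc k) - \<tau> k)) / 2))"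
    using m2 unfolding Ev
    by (simp add: exp_add[symmetric] algebra_simps power_mult_distrib add_divide_distrib
        diff_divide_distrib)
  with m1 show ?case by simp
qed

lemma elementary_iff_step_process:
  "elementary F B t \<phi> Z \<longleftrightarrow> (\<exists>m \<tau> H. step_process t m \<tau> H \<and>
     \<phi> = (\<lambda>s \<omega>. \<Sum>k<m. H k \<omega> * indicator {\<tau> k<..\<tau> (Suc k)} s) \<and>
     Z = (\<lambda>\<omega>. \<Sum>k<m. H k \<omega> * (B (\<tau> (Suc k)) \<omega> - B (\<tau> k) \<omega>)))"
  unfolding elementary_def step_process_def by (simp only: conj_assoc)

lemma elementary_integral_mean_zero:
  assumes "elementary F B t \<phi> Z" "t \<le> T"
  shows "has_bochner_integral M Z 0"
proof -
  from assms(1) obtain m \<tau> H where "step_process t m \<tau> H"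
    and "Z = (\<lambda>\<omega>. \<Sum>k<m. H k \<omega> * (B (\<tau> (Suc k)) \<omega> - B (\<tau> k) \<omega>))"
    unfolding elementary_iff_step_process by blast
  with step_integral_isometry[OF this(1) assms(2)] show ?thesis by blast
qed

end

text \<open>A function deviates in mean square from a constant \<open>H\<close> at least as much as its mean \<open>h\<close> does:
\<open>\<integral> (f - H)\<^sup>2 = \<integral> (f - h)\<^sup>2 + (b - a) (H - h)\<^sup>2\<close>.\<close>

lemma interval_mean_minimises_deviation:
  fixes f :: "real \<Rightarrow> real"
  assumes ab: "a \<le> b" and f [measurable]: "f \<in> borel_measurable borel"
    and C: "\<And>s. s \<in> {a<..b} \<Longrightarrow> \<bar>f s\<bar> \<le> C" "0 \<le> C"
  obtains h where "\<bar>h\<bar> \<le> C"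
    "\<And>H. ennreal ((H - h)\<^sup>2 * (b - a)) \<le> (\<integral>\<^sup>+s\<in>{a<..b}. ennreal ((f s - H)\<^sup>2) \<partial>lborel)"
proof (cases "a = b")
  case True
  thus ?thesis using C(2) by (intro that[of 0]) auto
next
  case False
  hence ab: "a < b" using assms(1) by simp
  define N where "N = restrict_space lborel {a<..b}"
  have spN: "space N = {a<..b}" by (simp add: N_def space_restrict_space)
  have em: "emeasure N (space N) = ennreal (b - a)"
    using ab unfolding spN by (simp add: N_def emeasure_restrict_space)
  interpret N: finite_measure N by standard (simp add: em)
  have mN: "measure N (space N) = b - a" using em ab by (simp add: measure_def)
  have [measurable]: "f \<in> borel_measurable N"
    unfolding N_def by (rule measurable_restrict_space1) simp
  have fi: "integrable N f"
    using C(1) by (intro N.integrable_const_bound[where B=C] AE_I2) (auto simp: spN)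
  have f2i: "integrable N (\<lambda>s. (f s)\<^sup>2)"
  proof (rule N.integrable_const_bound[where B="C\<^sup>2"])
    show "AE s in N. norm ((f s)\<^sup>2) \<le> C\<^sup>2"
      using power_mono[OF C(1), of _ 2] by (intro AE_I2) (simp add: spN)
  qed simp
  define h where "h = (\<integral>s. f s \<partial>N) / (b - a)"
  have hm: "(\<integral>s. f s \<partial>N) = h * (b - a)" using ab by (simp add: h_def)
  have dev: "(\<integral>s. (f s - H)\<^sup>2 \<partial>N) = (\<integral>s. (f s)\<^sup>2 \<partial>N) - 2 * H * (h * (b - a)) + H\<^sup>2 * (b - a)"
    and devi: "integrable N (\<lambda>s. (f s - H)\<^sup>2)" for H
    using fi f2i by (simp_all add: power2_diff hm mN mult_ac)
  show ?thesis
  proof (rule that)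
    have "\<bar>\<integral>s. f s \<partial>N\<bar> \<le> (\<integral>s. \<bar>f s\<bar> \<partial>N)" by (rule integral_abs_bound)
    also have "\<dots> \<le> (\<integral>s. C \<partial>N)" using fi C(1) by (intro integral_mono) (auto simp: spN)
    also have "\<dots> = C * (b - a)" by (simp add: mN)
    finally show "\<bar>h\<bar> \<le> C" using ab by (simp add: h_def divide_le_eq)
  next
    fix H
    have "0 \<le> (\<integral>s. (f s - h)\<^sup>2 \<partial>N)" by simp
    hence "(H - h)\<^sup>2 * (b - a) \<le> (\<integral>s. (f s - H)\<^sup>2 \<partial>N)"
      unfolding dev by (simp add: power2_eq_square algebra_simps)
    hence "ennreal ((H - h)\<^sup>2 * (b - a)) \<le> (\<integral>\<^sup>+s. ennreal ((f s - H)\<^sup>2) \<partial>N)"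
      using devi by (subst nn_integral_eq_integral) (auto intro: ennreal_leI)
    also have "\<dots> = (\<integral>\<^sup>+s\<in>{a<..b}. ennreal ((f s - H)\<^sup>2) \<partial>lborel)"
      unfolding N_def by (subst nn_integral_restrict_space) auto
    finally show "ennreal ((H - h)\<^sup>2 * (b - a)) \<le> \<dots>" .
  qed
qed

text \<open>At each time at most one interval of the partition is active, and outside all of them the left-hand
side vanishes.\<close>

lemma sum_partition_deviation_le:
  fixes f :: "real \<Rightarrow> real" and \<tau> x :: "nat \<Rightarrow> real"
  assumes mono: "\<And>j k. j \<le> k \<Longrightarrow> k \<le> m \<Longrightarrow> \<tau> j \<le> \<tau> k" and range: "0 \<le> \<tau> 0" "\<tau> m \<le> t"
    and f [measurable]: "f \<in> borel_measurable borel"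
  shows "(\<Sum>k<m. \<integral>\<^sup>+s\<in>{\<tau> k<..\<tau> (Suc k)}. ennreal ((f s - x k)\<^sup>2) \<partial>lborel)
    \<le> (\<integral>\<^sup>+s\<in>{0..t}. ennreal ((f s - (\<Sum>k<m. x k * indicator {\<tau> k<..\<tau> (Suc k)} s))\<^sup>2) \<partial>lborel)"
proof -
  have "(\<Sum>k<m. \<integral>\<^sup>+s\<in>{\<tau> k<..\<tau> (Suc k)}. ennreal ((f s - x k)\<^sup>2) \<partial>lborel)
      = (\<integral>\<^sup>+s. (\<Sum>k<m. ennreal ((f s - x k)\<^sup>2) * indicator {\<tau> k<..\<tau> (Suc k)} s) \<partial>lborel)"
    by (subst nn_integral_sum) auto
  also have "\<dots> \<le> (\<integral>\<^sup>+s\<in>{0..t}. ennreal ((f s - (\<Sum>k<m. x k * indicator {\<tau> k<..\<tau> (Suc k)} s))\<^sup>2) \<partial>lborel)"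
  proof (rule nn_integral_mono)
    fix s :: real
    show "(\<Sum>k<m. ennreal ((f s - x k)\<^sup>2) * indicator {\<tau> k<..\<tau> (Suc k)} s)
      \<le> ennreal ((f s - (\<Sum>k<m. x k * indicator {\<tau> k<..\<tau> (Suc k)} s))\<^sup>2) * indicator {0..t} s"
    proof (cases "\<exists>k<m. s \<in> {\<tau> k<..\<tau> (Suc k)}")
      case True
      then obtain k where k: "k < m" "s \<in> {\<tau> k<..\<tau> (Suc k)}" by blast
      have other: "s \<notin> {\<tau> j<..\<tau> (Suc j)}" if "j < m" "j \<noteq> k" for j
        using mono[of "Suc j" k] mono[of "Suc k" j] that k by (cases "j < k") auto
      have single: "(\<Sum>j<m. g j) = g k" if "\<And>j. j < m \<Longrightarrow> j \<noteq> k \<Longrightarrow> g j = 0"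
        for g :: "nat \<Rightarrow> 'b::comm_monoid_add"
        using k that by (subst sum.remove[of _ k]) auto
      have e1: "(\<Sum>k<m. ennreal ((f s - x k)\<^sup>2) * indicator {\<tau> k<..\<tau> (Suc k)} s) = ennreal ((f s - x k)\<^sup>2)"
        using k(2) other by (subst single) (simp_all del: greaterThanAtMost_iff)
      have e2: "(\<Sum>k<m. x k * indicator {\<tau> k<..\<tau> (Suc k)} s) = x k"
        using k(2) other by (subst single) (simp_all del: greaterThanAtMost_iff)
      have "s \<in> {0..t}"
        using mono[of 0 k] mono[of "Suc k" m] range k by auto
      thus ?thesis unfolding e1 e2 by simp
    next
      case False
      hence "(\<Sum>k<m. ennreal ((f s - x k)\<^sup>2) * indicator {\<tau> k<..\<tau> (Suc k)} s) = 0"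
        by (intro sum.neutral) (auto simp del: greaterThanAtMost_iff)
      thus ?thesis by simp
    qed
  qed
  finally show ?thesis .
qed

context brownian_filtration
begin

text \<open>Step integrals have mean zero, and \<open>L\<^sup>2\<close>-convergence on a probability space implies convergence of the
means.\<close>

lemma ito_integral_mean_zero:
  assumes I: "ito_integral M F B t \<xi> I" and t: "t \<le> T"
  shows "has_bochner_integral M I 0"
proof -
  from I obtain \<phi> Z where [measurable]: "I \<in> borel_measurable M"
    and el: "\<And>j :: nat. elementary F B t (\<phi> j) (Z j)"
    and lim: "(\<lambda>j. \<integral>\<^sup>+\<omega>. ennreal ((I \<omega> - Z j \<omega>)\<^sup>2) \<partial>M) \<longlonglongrightarrow> 0"
    unfolding ito_integral_def by blast
  have Z: "integrable M (Z j)" "expectation (Z j) = 0" for j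
    using elementary_integral_mean_zero[OF el t] by (auto simp: has_bochner_integral_iff)
  have [measurable]: "Z j \<in> borel_measurable M" for j using Z(1) by auto
  have ev: "eventually (\<lambda>j. (\<integral>\<^sup>+\<omega>. ennreal ((I \<omega> - Z j \<omega>)\<^sup>2) \<partial>M) < \<infinity>) sequentially"
    using order_tendstoD(2)[OF lim, of \<infinity>] by simp
  have int: "integrable M I" if "(\<integral>\<^sup>+\<omega>. ennreal ((I \<omega> - Z j \<omega>)\<^sup>2) \<partial>M) < \<infinity>" for j
    using Bochner_Integration.integrable_add[OF L1_le_L2(1)[OF _ that] Z(1)[of j]] by simp
  have Ii: "integrable M I"
    using int eventually_happens[OF ev] by auto
  have "eventually (\<lambda>j. ennreal ((expectation I)\<^sup>2) \<le> (\<integral>\<^sup>+\<omega>. ennreal ((I \<omega> - Z j \<omega>)\<^sup>2) \<partial>M)) sequentially"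
    using ev
  proof eventually_elim
    case (elim j)
    have "\<bar>expectation I\<bar> = \<bar>expectation (\<lambda>\<omega>. I \<omega> - Z j \<omega>)\<bar>" using Ii Z by simp
    also have "\<dots> \<le> expectation (\<lambda>\<omega>. \<bar>I \<omega> - Z j \<omega>\<bar>)" by (rule integral_abs_bound)
    finally have "(expectation I)\<^sup>2 \<le> (expectation (\<lambda>\<omega>. \<bar>I \<omega> - Z j \<omega>\<bar>))\<^sup>2"
      by (metis abs_ge_zero power2_abs power_mono)
    thus ?case using L1_le_L2(2)[OF _ elim] by (auto intro: order_trans[OF ennreal_leI])
  qed
  hence "ennreal ((expectation I)\<^sup>2) \<le> 0"
    by (intro tendsto_lowerbound[OF lim]) auto
  hence "expectation I = 0" by (simp add: ennreal_eq_0_iff[symmetric] flip: ennreal_eq_0_iff)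
  thus ?thesis using Ii by (simp add: has_bochner_integral_iff)
qed

text \<open>A random step process that approximates a deterministic function \<open>f\<close> is replaced by the step function
on the same partition whose coefficients are the means of \<open>f\<close>. For each outcome the squared difference
of the two is at most the approximation error, so by the isometry the integrals are as close as the
approximation is good. The new coefficients are bounded by \<open>C\<close>, which bounds the Gaussian variance.\<close>

lemma deterministic_step_approximation:
  fixes f :: "real \<Rightarrow> real"
  assumes el: "elementary F B t \<phi> Z" and t: "t \<le> T"
    and f: "f \<in> borel_measurable borel" and C: "\<And>s. s \<in> {0..t} \<Longrightarrow> \<bar>f s\<bar> \<le> C"
  obtains Z' where "integrable M Z'"
    "(\<integral>\<^sup>+\<omega>. ennreal ((Z \<omega> - Z' \<omega>)\<^sup>2) \<partial>M)
      \<le> (\<integral>\<^sup>+\<omega>. (\<integral>\<^sup>+s\<in>{0..t}. ennreal ((f s - \<phi> s \<omega>)\<^sup>2) \<partial>lborel) \<partial>M)"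
    "\<And>c. (\<integral>\<^sup>+\<omega>. ennreal (exp (c * Z' \<omega>)) \<partial>M) \<le> ennreal (exp (c\<^sup>2 * (C\<^sup>2 * t) / 2))"
proof -
  from el obtain m \<tau> H where sp: "step_process t m \<tau> H"
    and \<phi>: "\<phi> = (\<lambda>s \<omega>. \<Sum>k<m. H k \<omega> * indicator {\<tau> k<..\<tau> (Suc k)} s)"
    and Z: "Z = (\<lambda>\<omega>. \<Sum>k<m. H k \<omega> * (B (\<tau> (Suc k)) \<omega> - B (\<tau> k) \<omega>))"
    unfolding elementary_iff_step_process by (elim exE conjE) (rule that)
  note part = step_process_partition[OF sp]
  have t0: "0 \<le> t" using part(2,3)[of 0] by simp
  have C0: "0 \<le> C" using C[of 0] t0 by auto
  have "\<exists>h. \<bar>h\<bar> \<le> C \<and> (\<forall>x. ennreal ((x - h)\<^sup>2 * (\<tau> (Suc k) - \<tau> k))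
      \<le> (\<integral>\<^sup>+s\<in>{\<tau> k<..\<tau> (Suc k)}. ennreal ((f s - x)\<^sup>2) \<partial>lborel))" if "k < m" for k
  proof -
    have k: "0 \<le> \<tau> k" "\<tau> k \<le> \<tau> (Suc k)" "\<tau> (Suc k) \<le> t"
      using part(1)[of k "Suc k"] part(2)[of k] part(3)[of "Suc k"] that by auto
    have Ck: "\<bar>f s\<bar> \<le> C" if "s \<in> {\<tau> k<..\<tau> (Suc k)}" for s
      using that k by (intro C) simp
    obtain h where "\<bar>h\<bar> \<le> C" "\<And>x. ennreal ((x - h)\<^sup>2 * (\<tau> (Suc k) - \<tau> k))
      \<le> (\<integral>\<^sup>+s\<in>{\<tau> k<..\<tau> (Suc k)}. ennreal ((f s - x)\<^sup>2) \<partial>lborel)"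
      by (rule interval_mean_minimises_deviation[OF k(2) f Ck C0], assumption, rule that)
    thus ?thesis by (intro exI[of _ h] conjI allI)
  qed
  hence "\<forall>k\<in>{..<m}. \<exists>h. \<bar>h\<bar> \<le> C \<and> (\<forall>x. ennreal ((x - h)\<^sup>2 * (\<tau> (Suc k) - \<tau> k))
      \<le> (\<integral>\<^sup>+s\<in>{\<tau> k<..\<tau> (Suc k)}. ennreal ((f s - x)\<^sup>2) \<partial>lborel))" by simp
  from bchoice[OF this] obtain h where h': "\<forall>k\<in>{..<m}. \<bar>h k\<bar> \<le> C \<and>
    (\<forall>x. ennreal ((x - h k)\<^sup>2 * (\<tau> (Suc k) - \<tau> k))
      \<le> (\<integral>\<^sup>+s\<in>{\<tau> k<..\<tau> (Suc k)}. ennreal ((f s - x)\<^sup>2) \<partial>lborel))" ..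
  have h: "\<bar>h k\<bar> \<le> C"
    "ennreal ((x - h k)\<^sup>2 * (\<tau> (Suc k) - \<tau> k))
      \<le> (\<integral>\<^sup>+s\<in>{\<tau> k<..\<tau> (Suc k)}. ennreal ((f s - x)\<^sup>2) \<partial>lborel)" if "k < m" for k x
    using bspec[OF h', of k] that by simp_all
  define Z' where "Z' = (\<lambda>\<omega>. \<Sum>k<m. h k * (B (\<tau> (Suc k)) \<omega> - B (\<tau> k) \<omega>))"
  have sph: "step_process t m \<tau> (\<lambda>k _. h k)"
    using sp by (auto simp: step_process_def)
  have spD: "step_process t m \<tau> (\<lambda>k \<omega>. H k \<omega> - h k)"
    unfolding step_process_def
  proof (intro conjI allI impI)
    fix k assume k: "k < m"
    from sp k obtain K where "\<forall>\<omega>\<in>space (F (\<tau> k)). \<bar>H k \<omega>\<bar> \<le> K" by (auto simp: step_process_def)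
    hence "\<forall>\<omega>\<in>space (F (\<tau> k)). \<bar>H k \<omega> - h k\<bar> \<le> K + \<bar>h k\<bar>" by fastforce
    thus "\<exists>K. \<forall>\<omega>\<in>space (F (\<tau> k)). \<bar>H k \<omega> - h k\<bar> \<le> K" by blast
  qed (use sp in \<open>auto simp: step_process_def\<close>)
  have D2: "integrable M (\<lambda>\<omega>. (H k \<omega> - h k)\<^sup>2)" if k: "k < m" for k
  proof -
    have rng: "0 \<le> \<tau> k" "\<tau> k \<le> T" using part(2,3)[of k] k t by auto
    have mH: "(\<lambda>\<omega>. H k \<omega> - h k) \<in> borel_measurable M"
      using spD[unfolded step_process_def] k by (intro measurable_from_F[OF rng]) blast
    obtain K where "\<forall>\<omega>\<in>space (F (\<tau> k)). \<bar>H k \<omega> - h k\<bar> \<le> K"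
      using spD[unfolded step_process_def] k by blast
    hence K: "\<And>\<omega>. \<omega> \<in> space M \<Longrightarrow> \<bar>H k \<omega> - h k\<bar> \<le> K" using space_F[OF rng] by simp
    show ?thesis
    proof (rule integrable_const_bound[where B="K\<^sup>2"])
      show "AE \<omega> in M. norm ((H k \<omega> - h k)\<^sup>2) \<le> K\<^sup>2"
        using power_mono[OF K, of _ 2] by (intro AE_I2) simp
    qed (use mH in simp)
  qed
  have \<tau>: "\<tau> k \<le> \<tau> (Suc k)" if "k < m" for k using part(1)[of k "Suc k"] that by simp
  note iso = step_integral_isometry[OF spD t]
  have ZZ: "(\<Sum>k<m. (H k \<omega> - h k) * (B (\<tau> (Suc k)) \<omega> - B (\<tau> k) \<omega>)) = Z \<omega> - Z' \<omega>" for \<omega>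
    by (simp add: Z Z'_def sum_subtractf left_diff_distrib)
  show ?thesis
  proof (rule that)
    show "integrable M Z'"
      using step_integral_isometry[OF sph t] by (simp add: Z'_def has_bochner_integral_iff)
  next
    have "(\<integral>\<^sup>+\<omega>. ennreal ((Z \<omega> - Z' \<omega>)\<^sup>2) \<partial>M)
        = ennreal (\<Sum>k<m. expectation (\<lambda>\<omega>. (H k \<omega> - h k)\<^sup>2) * (\<tau> (Suc k) - \<tau> k))"
      using iso unfolding ZZ
      by (subst nn_integral_eq_integral) (auto simp: has_bochner_integral_iff)
    also have "\<dots> = (\<Sum>k<m. ennreal (expectation (\<lambda>\<omega>. (H k \<omega> - h k)\<^sup>2 * (\<tau> (Suc k) - \<tau> k))))"
      using \<tau> by (subst sum_ennreal) (auto intro!: mult_nonneg_nonneg)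
    also have "\<dots> = (\<Sum>k<m. \<integral>\<^sup>+\<omega>. ennreal ((H k \<omega> - h k)\<^sup>2 * (\<tau> (Suc k) - \<tau> k)) \<partial>M)"
      using D2 \<tau> by (intro sum.cong refl nn_integral_eq_integral[symmetric]) auto
    also have "\<dots> = (\<integral>\<^sup>+\<omega>. (\<Sum>k<m. ennreal ((H k \<omega> - h k)\<^sup>2 * (\<tau> (Suc k) - \<tau> k))) \<partial>M)"
      using borel_measurable_integrable[OF D2]
      by (intro nn_integral_sum[symmetric] measurable_compose[OF _ measurable_ennreal]
          borel_measurable_times) auto
    also have "\<dots> \<le> (\<integral>\<^sup>+\<omega>. (\<integral>\<^sup>+s\<in>{0..t}. ennreal ((f s - \<phi> s \<omega>)\<^sup>2) \<partial>lborel) \<partial>M)"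
    proof (rule nn_integral_mono)
      fix \<omega>
      have "(\<Sum>k<m. ennreal ((H k \<omega> - h k)\<^sup>2 * (\<tau> (Suc k) - \<tau> k)))
          \<le> (\<Sum>k<m. \<integral>\<^sup>+s\<in>{\<tau> k<..\<tau> (Suc k)}. ennreal ((f s - H k \<omega>)\<^sup>2) \<partial>lborel)"
        by (rule sum_mono, rule h(2)) simp
      also have "\<dots> \<le> (\<integral>\<^sup>+s\<in>{0..t}. ennreal ((f s - \<phi> s \<omega>)\<^sup>2) \<partial>lborel)"
        unfolding \<phi>
        using part(2)[of 0] part(3)[of m] by (intro sum_partition_deviation_le part(1) f) simp_all
      finally show "(\<Sum>k<m. ennreal ((H k \<omega> - h k)\<^sup>2 * (\<tau> (Suc k) - \<tau> k))) \<le> \<dots>" .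
    qed
    finally show "(\<integral>\<^sup>+\<omega>. ennreal ((Z \<omega> - Z' \<omega>)\<^sup>2) \<partial>M) \<le> \<dots>" .
  next
    fix c
    have "(\<Sum>k<m. (h k)\<^sup>2 * (\<tau> (Suc k) - \<tau> k)) \<le> (\<Sum>k<m. C\<^sup>2 * (\<tau> (Suc k) - \<tau> k))"
      using h(1) \<tau> by (intro sum_mono mult_right_mono) (use C0 in \<open>auto simp: abs_le_square_iff[symmetric]\<close>)
    also have "\<dots> = C\<^sup>2 * (\<tau> m - \<tau> 0)"
      by (simp add: sum_distrib_left[symmetric] sum_lessThan_telescope)
    also have "\<dots> \<le> C\<^sup>2 * t" using part(2)[of 0] part(3)[of m] by (intro mult_left_mono) auto
    finally have "c\<^sup>2 * (\<Sum>k<m. (h k)\<^sup>2 * (\<tau> (Suc k) - \<tau> k)) / 2 \<le> c\<^sup>2 * (C\<^sup>2 * t) / 2"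
      by (intro divide_right_mono mult_left_mono) auto
    note le = this
    have "has_bochner_integral M (\<lambda>\<omega>. exp (c * Z' \<omega>))
        (exp (c\<^sup>2 * (\<Sum>k<m. (h k)\<^sup>2 * (\<tau> (Suc k) - \<tau> k)) / 2))"
      using step_integral_exp[OF sph t, of c] unfolding Z'_def by (rule conjunct2)
    hence "(\<integral>\<^sup>+\<omega>. ennreal (exp (c * Z' \<omega>)) \<partial>M)
        = ennreal (exp (c\<^sup>2 * (\<Sum>k<m. (h k)\<^sup>2 * (\<tau> (Suc k) - \<tau> k)) / 2))"
      by (simp add: has_bochner_integral_iff nn_integral_eq_integral)
    with le show "(\<integral>\<^sup>+\<omega>. ennreal (exp (c * Z' \<omega>)) \<partial>M) \<le> ennreal (exp (c\<^sup>2 * (C\<^sup>2 * t) / 2))"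
      by (simp add: ennreal_leI)
  qed
qed

text \<open>The Gaussian approximants have uniformly bounded exponential moments and converge almost surely along
a subsequence; Fatou's lemma transfers the bound to the limit.\<close>

lemma ito_integral_exp_moment:
  fixes f :: "real \<Rightarrow> real"
  assumes I: "ito_integral M F B t (\<lambda>s _. f s) I" and t: "0 \<le> t" "t \<le> T"
    and f: "f \<in> borel_measurable (restrict_space borel {0..t})"
    and C: "\<And>s. s \<in> {0..t} \<Longrightarrow> \<bar>f s\<bar> \<le> C"
  shows "(\<integral>\<^sup>+\<omega>. ennreal (exp (c * I \<omega>)) \<partial>M) \<le> ennreal (exp (c\<^sup>2 * (C\<^sup>2 * t) / 2))"
proof -
  from I obtain \<phi> Z where Im [measurable]: "I \<in> borel_measurable M"
    and el: "\<And>j :: nat. elementary F B t (\<phi> j) (Z j)"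
    and lim1: "(\<lambda>j. \<integral>\<^sup>+\<omega>. (\<integral>\<^sup>+s\<in>{0..t}. ennreal ((f s - \<phi> j s \<omega>)\<^sup>2) \<partial>lborel) \<partial>M) \<longlonglongrightarrow> 0"
    and lim2: "(\<lambda>j. \<integral>\<^sup>+\<omega>. ennreal ((I \<omega> - Z j \<omega>)\<^sup>2) \<partial>M) \<longlonglongrightarrow> 0"
    unfolding ito_integral_def by blast
  \<comment> \<open>The approximation lemma takes a function measurable on the whole line; only its values on \<open>[0,t]\<close> matter.\<close>
  define g where "g s = f s * indicator {0..t} s" for s
  have gm: "g \<in> borel_measurable borel"
    using f by (subst (asm) borel_measurable_restrict_space_iff) (auto simp: g_def[abs_def] mult.commute)
  have gC: "\<bar>g s\<bar> \<le> C" if "s \<in> {0..t}" for s using C[OF that] that by (simp add: g_def)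
  have gf: "(\<integral>\<^sup>+s\<in>{0..t}. ennreal ((g s - \<phi> j s \<omega>)\<^sup>2) \<partial>lborel)
      = (\<integral>\<^sup>+s\<in>{0..t}. ennreal ((f s - \<phi> j s \<omega>)\<^sup>2) \<partial>lborel)" for j \<omega>
    by (intro nn_integral_cong) (auto simp: g_def indicator_def)
  define a where "a j = (\<integral>\<^sup>+\<omega>. (\<integral>\<^sup>+s\<in>{0..t}. ennreal ((f s - \<phi> j s \<omega>)\<^sup>2) \<partial>lborel) \<partial>M)" for j
  define b where "b j = (\<integral>\<^sup>+\<omega>. ennreal ((I \<omega> - Z j \<omega>)\<^sup>2) \<partial>M)" for j
  have "\<exists>Z'. integrable M Z' \<and> (\<integral>\<^sup>+\<omega>. ennreal ((Z j \<omega> - Z' \<omega>)\<^sup>2) \<partial>M) \<le> a j \<and>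
      (\<integral>\<^sup>+\<omega>. ennreal (exp (c * Z' \<omega>)) \<partial>M) \<le> ennreal (exp (c\<^sup>2 * (C\<^sup>2 * t) / 2))" for j
    by (rule deterministic_step_approximation[OF el[of j] t(2) gm gC]) (auto simp: gf a_def)
  hence "\<exists>Z'. \<forall>j. integrable M (Z' j) \<and> (\<integral>\<^sup>+\<omega>. ennreal ((Z j \<omega> - Z' j \<omega>)\<^sup>2) \<partial>M) \<le> a j \<and>
      (\<integral>\<^sup>+\<omega>. ennreal (exp (c * Z' j \<omega>)) \<partial>M) \<le> ennreal (exp (c\<^sup>2 * (C\<^sup>2 * t) / 2))"
    by (intro choice allI)
  then obtain Z' where Z': "\<forall>j. integrable M (Z' j) \<and>
      (\<integral>\<^sup>+\<omega>. ennreal ((Z j \<omega> - Z' j \<omega>)\<^sup>2) \<partial>M) \<le> a j \<and>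
      (\<integral>\<^sup>+\<omega>. ennreal (exp (c * Z' j \<omega>)) \<partial>M) \<le> ennreal (exp (c\<^sup>2 * (C\<^sup>2 * t) / 2))" ..
  have Z'i: "integrable M (Z' j)"
    and ZZ': "(\<integral>\<^sup>+\<omega>. ennreal ((Z j \<omega> - Z' j \<omega>)\<^sup>2) \<partial>M) \<le> a j"
    and Z'e: "(\<integral>\<^sup>+\<omega>. ennreal (exp (c * Z' j \<omega>)) \<partial>M) \<le> ennreal (exp (c\<^sup>2 * (C\<^sup>2 * t) / 2))" for j
    using spec[OF Z', of j] by simp_all
  have Zi: "integrable M (Z j)" for j
    using elementary_integral_mean_zero[OF el t(2)] by (simp add: has_bochner_integral_iff)
  have [measurable]: "Z j \<in> borel_measurable M" "Z' j \<in> borel_measurable M" for j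
    using Zi Z'i by auto
  have Ii: "integrable M I" using ito_integral_mean_zero[OF I t(2)] by (simp add: has_bochner_integral_iff)
  have d: "(\<integral>\<^sup>+\<omega>. ennreal ((Z' j \<omega> - I \<omega>)\<^sup>2) \<partial>M) \<le> 2 * b j + 2 * a j" for j
  proof -
    have "(\<integral>\<^sup>+\<omega>. ennreal ((Z' j \<omega> - I \<omega>)\<^sup>2) \<partial>M)
        \<le> (\<integral>\<^sup>+\<omega>. 2 * ennreal ((I \<omega> - Z j \<omega>)\<^sup>2) + 2 * ennreal ((Z j \<omega> - Z' j \<omega>)\<^sup>2) \<partial>M)"
    proof (rule nn_integral_mono)
      fix \<omega>
      have "0 \<le> ((I \<omega> - Z j \<omega>) - (Z j \<omega> - Z' j \<omega>))\<^sup>2" by simp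
      hence "(Z' j \<omega> - I \<omega>)\<^sup>2 \<le> 2 * (I \<omega> - Z j \<omega>)\<^sup>2 + 2 * (Z j \<omega> - Z' j \<omega>)\<^sup>2"
        by (simp add: power2_eq_square algebra_simps)
      hence "ennreal ((Z' j \<omega> - I \<omega>)\<^sup>2) \<le> ennreal (2 * (I \<omega> - Z j \<omega>)\<^sup>2 + 2 * (Z j \<omega> - Z' j \<omega>)\<^sup>2)"
        by (rule ennreal_leI)
      thus "ennreal ((Z' j \<omega> - I \<omega>)\<^sup>2)
          \<le> 2 * ennreal ((I \<omega> - Z j \<omega>)\<^sup>2) + 2 * ennreal ((Z j \<omega> - Z' j \<omega>)\<^sup>2)"
        by (simp add: ennreal_plus ennreal_mult)
    qed
    also have "\<dots> = 2 * b j + 2 * (\<integral>\<^sup>+\<omega>. ennreal ((Z j \<omega> - Z' j \<omega>)\<^sup>2) \<partial>M)"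
      unfolding b_def by (subst nn_integral_add) (auto simp: nn_integral_cmult)
    finally show ?thesis
      by (rule order_trans) (intro add_left_mono mult_left_mono ZZ', simp)
  qed
  have "(\<lambda>j. 2 * b j + 2 * a j) \<longlonglongrightarrow> 2 * 0 + 2 * 0"
    unfolding a_def b_def
    by (intro tendsto_add ennreal_tendsto_cmult lim1 lim2) auto
  hence "(\<lambda>j. 2 * b j + 2 * a j) \<longlonglongrightarrow> 0" by simp
  note lim = this
  have L1: "(\<lambda>j. expectation (\<lambda>\<omega>. norm (Z' j \<omega> - I \<omega>))) \<longlonglongrightarrow> 0"
  proof (rule LIMSEQ_I)
    fix r :: real assume r: "0 < r"
    have "0 < ennreal (r\<^sup>2)" using r by simp
    hence "eventually (\<lambda>j. 2 * b j + 2 * a j < ennreal (r\<^sup>2)) sequentially"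
      by (rule order_tendstoD(2)[OF lim])
    hence "eventually (\<lambda>j. norm (expectation (\<lambda>\<omega>. norm (Z' j \<omega> - I \<omega>)) - 0) < r) sequentially"
    proof eventually_elim
      case (elim j)
      have fin: "(\<integral>\<^sup>+\<omega>. ennreal ((Z' j \<omega> - I \<omega>)\<^sup>2) \<partial>M) < ennreal (r\<^sup>2)"
        by (rule le_less_trans[OF d elim])
      have "ennreal ((expectation (\<lambda>\<omega>. \<bar>Z' j \<omega> - I \<omega>\<bar>))\<^sup>2) \<le> (\<integral>\<^sup>+\<omega>. ennreal ((Z' j \<omega> - I \<omega>)\<^sup>2) \<partial>M)"
        using less_trans[OF fin ennreal_less_top] by (intro L1_le_L2(2)) simp_all
      also note fin
      finally have "(expectation (\<lambda>\<omega>. \<bar>Z' j \<omega> - I \<omega>\<bar>))\<^sup>2 < r\<^sup>2"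
        by (simp add: ennreal_less_iff)
      hence "expectation (\<lambda>\<omega>. \<bar>Z' j \<omega> - I \<omega>\<bar>) < r" using r by (simp add: power2_less_imp_less)
      thus ?case by simp
    qed
    thus "\<exists>no. \<forall>n\<ge>no. norm (expectation (\<lambda>\<omega>. norm (Z' n \<omega> - I \<omega>)) - 0) < r"
      unfolding eventually_sequentially .
  qed
  \<comment> \<open>Fatou needs almost sure convergence, available along a subsequence.\<close>
  obtain q where "strict_mono q" and q: "AE \<omega> in M. (\<lambda>n. Z' (q n) \<omega> - I \<omega>) \<longlonglongrightarrow> 0"
    using tendsto_L1_AE_subseq[OF _ L1] Z'i Ii by auto
  have "(\<integral>\<^sup>+\<omega>. ennreal (exp (c * I \<omega>)) \<partial>M)
      = (\<integral>\<^sup>+\<omega>. liminf (\<lambda>n. ennreal (exp (c * Z' (q n) \<omega>))) \<partial>M)"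
  proof (rule nn_integral_cong_AE, use q in eventually_elim)
    case (elim \<omega>)
    have "(\<lambda>n. ennreal (exp (c * Z' (q n) \<omega>))) \<longlonglongrightarrow> ennreal (exp (c * I \<omega>))"
      using LIM_zero_cancel[OF elim] by (intro tendsto_intros) 
    thus ?case by (rule lim_imp_Liminf[OF sequentially_bot, symmetric])
  qed
  also have "\<dots> \<le> liminf (\<lambda>n. \<integral>\<^sup>+\<omega>. ennreal (exp (c * Z' (q n) \<omega>)) \<partial>M)"
    by (rule nn_integral_liminf) simp
  also have "\<dots> \<le> liminf (\<lambda>n. ennreal (exp (c\<^sup>2 * (C\<^sup>2 * t) / 2)))"
    by (intro Liminf_mono always_eventually allI Z'e)
  also have "\<dots> = ennreal (exp (c\<^sup>2 * (C\<^sup>2 * t) / 2))" by (simp add: Liminf_const)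
  finally show ?thesis .
qed

end

section \<open>The driving noises\<close>

lemma space_natural_filtration [simp]: "space (natural_filtration M W K t) = space M"
  by (auto simp: natural_filtration_def intro!: space_measure_of)

lemma sets_natural_filtration:
  "sets (natural_filtration M W K t) = sigma_sets (space M)
     {W k s -` B \<inter> space M | k s B. k \<in> K \<and> s \<in> {0..t} \<and> B \<in> sets borel}"
  unfolding natural_filtration_def by (rule sets_measure_of) auto

lemma sets_natural_filtration_mono:
  assumes "K \<subseteq> K'" "s \<le> t"
  shows "sets (natural_filtration M W K s) \<subseteq> sets (natural_filtration M W K' t)"
  unfolding sets_natural_filtration using assms by (intro sigma_sets_mono') fastforce

lemma natural_filtration_adapted:
  assumes "k \<in> K" "0 \<le> s" "s \<le> t"
  shows "W k s \<in> borel_measurable (natural_filtration M W K t)"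
  by (rule measurableI) (use assms in \<open>auto simp: sets_natural_filtration intro!: sigma_sets.Basic\<close>)

lemma subalgebra_natural_filtration:
  assumes "\<And>k s. k \<in> K \<Longrightarrow> 0 \<le> s \<Longrightarrow> s \<le> t \<Longrightarrow> W k s \<in> borel_measurable M"
  shows "subalgebra M (natural_filtration M W K t)"
  unfolding subalgebra_def sets_natural_filtration using assms
  by (auto intro!: sets.sigma_sets_subset measurable_sets)

text \<open>An increment of \<open>W k\<close> is independent of the past of \<open>W k\<close> by the Brownian property, and together with
that past it is independent of \<open>W j\<close>. The intersections of an event in the past of \<open>W k\<close> with one in the
past of \<open>W j\<close> form an intersection-stable generator of the joint past, so independence of the
increment extends from them to the whole filtration.\<close>

lemma (in prob_space) independent_noises_brownian_filtration:
  fixes W :: "nat \<Rightarrow> real \<Rightarrow> 'a \<Rightarrow> real"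
  assumes bm: "\<And>l. l \<in> {j, k} \<Longrightarrow> standard_brownian_motion M T (W l)"
    and indep: "indep_set (sets (natural_filtration M W {k} T)) (sets (natural_filtration M W {j} T))"
    and K: "k \<in> K" "K \<subseteq> {j, k}"
  shows "brownian_filtration M (natural_filtration M W K) (W k) T"
proof
  have meas: "W l s \<in> borel_measurable M" if "l \<in> {j, k}" "0 \<le> s" "s \<le> T" for l s
    using bm[of l] that by (auto simp: standard_brownian_motion_def)
  fix s assume s: "0 \<le> s" "s \<le> T"
  show "subalgebra M (natural_filtration M W K s)"
    using K s by (intro subalgebra_natural_filtration meas) auto
  show "W k s \<in> borel_measurable (natural_filtration M W K s)"
    using K s by (intro natural_filtration_adapted) auto
next
  fix s t assume "0 \<le> s" "s \<le> t" "t \<le> T"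
  thus "sets (natural_filtration M W K s) \<subseteq> sets (natural_filtration M W K t)"
    by (intro sets_natural_filtration_mono) auto
next
  fix s t assume st: "0 \<le> s" "s < t" "t \<le> T"
  have bmk: "standard_brownian_motion M T (W k)" by (rule bm) simp
  show "distributed M lborel (\<lambda>\<omega>. W k t \<omega> - W k s \<omega>) (normal_density 0 (sqrt (t - s)))"
    using bmk st by (auto simp: standard_brownian_motion_def)
  let ?D = "sets (vimage_algebra (space M) (\<lambda>\<omega>. W k t \<omega> - W k s \<omega>) borel)"
  let ?F = "\<lambda>l r. sets (natural_filtration M W {l} r)"
  define A where "A = {a \<inter> c | a c. a \<in> ?F k s \<and> c \<in> ?F j s}"
  have "sets (natural_filtration M (\<lambda>_::unit. W k) UNIV s) = ?F k s"
    unfolding sets_natural_filtration by simp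
  moreover have "indep_set (sets (natural_filtration M (\<lambda>_::unit. W k) UNIV s)) ?D"
    using bmk st by (auto simp: standard_brownian_motion_def)
  ultimately have incr: "indep_set (?F k s) ?D" by simp
  have Fk: "?F k s \<subseteq> ?F k T" "?F j s \<subseteq> ?F j T"
    using st by (simp_all add: sets_natural_filtration_mono)
  \<comment> \<open>Events about the increment belong to the history of \<open>W k\<close> up to the horizon.\<close>
  have DT: "?D \<subseteq> ?F k T"
  proof -
    have "(\<lambda>\<omega>. W k t \<omega> - W k s \<omega>) \<in> borel_measurable (natural_filtration M W {k} T)"
      using st by (intro borel_measurable_diff natural_filtration_adapted) auto
    from measurable_sets[OF this] show ?thesis
      by (auto simp: sets_vimage_algebra2)
  qed
  have "indep_set A ?D"
    unfolding indep_sets2_eq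
  proof (intro conjI ballI)
    show "A \<subseteq> events"
      using indep_setD_ev1[OF indep] indep_setD_ev2[OF indep] Fk
      unfolding A_def by (intro subsetI) (elim CollectE exE conjE, hypsubst, rule sets.Int; blast)
    show "?D \<subseteq> events" using indep_setD_ev2[OF incr] .
    fix x b assume "x \<in> A" and b: "b \<in> ?D"
    then obtain a c where x: "x = a \<inter> c" and a: "a \<in> ?F k s" and c: "c \<in> ?F j s" by (auto simp: A_def)
    have "prob (x \<inter> b) = prob ((a \<inter> b) \<inter> c)" by (simp add: x Int_ac)
    also have "\<dots> = prob (a \<inter> b) * prob c"
      using a b c Fk DT by (intro indep_setD[OF indep] sets.Int) auto
    also have "prob (a \<inter> b) = prob a * prob b" by (rule indep_setD[OF incr a b])
    also have "prob a * prob b * prob c = (prob a * prob c) * prob b" by simp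
    also have "prob a * prob c = prob x"
      unfolding x using a c Fk by (intro indep_setD[OF indep, symmetric]) auto
    finally show "prob (x \<inter> b) = prob x * prob b" .
  qed
  moreover have "Int_stable A"
  proof (rule Int_stableI)
    fix x y assume "x \<in> A" "y \<in> A"
    then obtain a c a' c' where "x = a \<inter> c" "y = a' \<inter> c'"
      and mem: "a \<in> ?F k s" "c \<in> ?F j s" "a' \<in> ?F k s" "c' \<in> ?F j s" unfolding A_def by blast
    hence "x \<inter> y = (a \<inter> a') \<inter> (c \<inter> c')" by blast
    moreover have "a \<inter> a' \<in> ?F k s" "c \<inter> c' \<in> ?F j s" using mem by auto
    ultimately show "x \<inter> y \<in> A" unfolding A_def by blast
  qed
  moreover have "Int_stable ?D" by (auto intro!: Int_stableI)
  ultimately have "indep_set (sigma_sets (space M) A) (sigma_sets (space M) ?D)"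
    by (rule indep_set_sigma_sets)
  moreover have "sets (natural_filtration M W K s) \<subseteq> sigma_sets (space M) A"
    unfolding sets_natural_filtration[of _ _ K]
  proof (rule sigma_sets_mono, clarify)
    fix l r B assume l: "l \<in> K" "r \<in> {0..s}" "B \<in> sets (borel :: real measure)"
    have mem: "W l r -` B \<inter> space M \<in> ?F l s"
      using l measurable_sets[OF natural_filtration_adapted[of l "{l}" r s W M]] by auto
    have top: "space M \<in> ?F l' s" for l' using sets.top[of "natural_filtration M W {l'} s"] by simp
    have "W l r -` B \<inter> space M \<in> A"
    proof (cases "l = k")
      case True
      thus ?thesis using mem top[of j] unfolding A_def by blast
    next
      case False
      hence "l = j" using l K by auto
      thus ?thesis using mem top[of k] unfolding A_def by blast
    qed
    thus "W l r -` B \<inter> space M \<in> sigma_sets (space M) A" by blast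
  qed
  moreover have "?D \<subseteq> sigma_sets (space M) ?D" by auto
  ultimately show "indep_set (sets (natural_filtration M W K s)) ?D"
    unfolding indep_set_def by (elim indep_sets_mono_sets) (auto split: bool.split)
qed

context contract_model
begin

abbreviation "T \<equiv> horizon md"
abbreviation "M \<equiv> prb md"

text \<open>The two filtrations of the model: that of the common noise alone, which carries the log-price, and that
of an agent.\<close>

lemma noise_brownian_filtration:
  assumes i: "i \<in> {1..agents md}" and K: "K = {0} \<and> k = 0 \<or> K = {0, i} \<and> k \<in> {0, i}"
  shows "brownian_filtration M (natural_filtration M (noise md) K) (noise md k) T"
proof -
  define j where "j = (if k = 0 then i else 0)"
  have k: "k \<le> agents md" "j \<le> agents md" "j \<noteq> k" using i K by (auto simp: j_def)
  show ?thesis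
  proof (rule independent_noises_brownian_filtration)
    fix l assume "l \<in> {j, k}"
    thus "standard_brownian_motion M T (noise md l)" using k by (intro noise_brownian) auto
  next
    let ?F = "\<lambda>k. sets (natural_filtration M (noise md) {k} T)"
    have "prob (a \<inter> c) = prob a * prob c" if "a \<in> ?F k" "c \<in> ?F j" for a c
    proof -
      have "prob (\<Inter>l\<in>{k, j}. if l = k then a else c) = (\<Prod>l\<in>{k, j}. prob (if l = k then a else c))"
        using that k by (intro indep_setsD[OF noise_indep]) auto
      thus ?thesis using k by (simp add: Int_commute)
    qed
    thus "indep_set (?F k) (?F j)"
      using noise_indep k unfolding indep_sets2_eq indep_sets_def by auto
  qed (use K i in \<open>auto simp: j_def\<close>)
qed

lemma ito_integrals_mean_zero:
  assumes i: "i \<in> {1..agents md}" and I: "ito_integrals M (noise md) {0, i} T c I"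
  shows "has_bochner_integral M I 0"
proof -
  from I obtain Y where Y: "\<And>k. k \<in> {0, i} \<Longrightarrow>
      ito_integral M (natural_filtration M (noise md) {0, i}) (noise md k) T (c k) (Y k)"
    and I: "I = (\<lambda>\<omega>. \<Sum>k\<in>{0, i}. Y k \<omega>)"
    unfolding ito_integrals_def by blast
  have "has_bochner_integral M (Y k) 0" if k: "k \<in> {0, i}" for k
  proof -
    interpret brownian_filtration M "natural_filtration M (noise md) {0, i}" "noise md k" T
      using noise_brownian_filtration[OF i] k by blast
    show ?thesis by (rule ito_integral_mean_zero[OF Y[OF k]]) simp
  qed
  hence "has_bochner_integral M (\<lambda>\<omega>. \<Sum>k\<in>{0, i}. Y k \<omega>) (\<Sum>k\<in>{0, i}. 0)"
    by (intro has_bochner_integral_sum)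
  thus ?thesis by (simp add: I)
qed

end

section \<open>Measurability in time and state\<close>

text \<open>Approximation by the process sampled on the grid of mesh \<open>1 / (n + 1)\<close>.\<close>

lemma borel_measurable_continuous_process:
  fixes X :: "real \<Rightarrow> 'a \<Rightarrow> real"
  assumes X: "\<And>t. X t \<in> borel_measurable M"
    and cont: "\<And>\<omega>. \<omega> \<in> space M \<Longrightarrow> continuous_on UNIV (\<lambda>t. X t \<omega>)"
  shows "(\<lambda>(t, \<omega>). X t \<omega>) \<in> borel_measurable (borel \<Otimes>\<^sub>M M)"
proof (rule borel_measurable_LIMSEQ_metric)
  fix n :: nat
  have [measurable]: "(\<lambda>p :: real \<times> 'a. \<lfloor>real (Suc n) * fst p\<rfloor>) \<in> borel \<Otimes>\<^sub>M M \<rightarrow>\<^sub>M count_space UNIV"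
    by measurable
  show "(\<lambda>p. X (real_of_int \<lfloor>real (Suc n) * fst p\<rfloor> / real (Suc n)) (snd p)) \<in> borel_measurable (borel \<Otimes>\<^sub>M M)"
    by (rule measurable_compose_countable'[where I=UNIV and f="\<lambda>k p. X (real_of_int k / real (Suc n)) (snd p)"])
      (auto intro!: measurable_compose[OF measurable_snd X])
next
  fix p :: "real \<times> 'a" assume "p \<in> space (borel \<Otimes>\<^sub>M M)"
  then obtain t :: real and \<omega> where p: "p = (t, \<omega>)" "\<omega> \<in> space M" by (auto simp: space_pair_measure)
  have "(\<lambda>n. real_of_int \<lfloor>real (Suc n) * t\<rfloor> / real (Suc n)) \<longlonglongrightarrow> t"
  proof (rule tendsto_sandwich)
    show "(\<lambda>n. t - 1 / real (Suc n)) \<longlonglongrightarrow> t"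
      using tendsto_diff[OF tendsto_const[of t] LIMSEQ_inverse_real_of_nat] by (simp add: inverse_eq_divide)
    show "(\<lambda>n. t) \<longlonglongrightarrow> t" by simp
    show "\<forall>\<^sub>F n in sequentially. t - 1 / real (Suc n) \<le> real_of_int \<lfloor>real (Suc n) * t\<rfloor> / real (Suc n)"
    proof (rule always_eventually, rule allI)
      fix n
      have "real (Suc n) * t - 1 \<le> real_of_int \<lfloor>real (Suc n) * t\<rfloor>" by linarith
      hence "(real (Suc n) * t - 1) / real (Suc n) \<le> real_of_int \<lfloor>real (Suc n) * t\<rfloor> / real (Suc n)"
        by (rule divide_right_mono) simp
      thus "t - 1 / real (Suc n) \<le> real_of_int \<lfloor>real (Suc n) * t\<rfloor> / real (Suc n)"
        by (simp add: diff_divide_distrib del: of_nat_Suc)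
    qed
    show "\<forall>\<^sub>F n in sequentially. real_of_int \<lfloor>real (Suc n) * t\<rfloor> / real (Suc n) \<le> t"
    proof (rule always_eventually, rule allI)
      fix n
      have "real_of_int \<lfloor>real (Suc n) * t\<rfloor> \<le> real (Suc n) * t" by linarith
      thus "real_of_int \<lfloor>real (Suc n) * t\<rfloor> / real (Suc n) \<le> t"
        by (simp add: divide_le_eq mult.commute del: of_nat_Suc)
    qed
  qed
  note lim = this
  have "isCont (\<lambda>t. X t \<omega>) t"
    using cont[OF p(2)] by (simp add: continuous_on_eq_continuous_at)
  from isCont_tendsto_compose[OF this lim]
  show "(\<lambda>n. X (real_of_int \<lfloor>real (Suc n) * fst p\<rfloor> / real (Suc n)) (snd p))
      \<longlonglongrightarrow> (case p of (t, \<omega>) \<Rightarrow> X t \<omega>)"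
    unfolding p by (simp del: of_nat_Suc)
qed

text \<open>Processes are meaningful on \<open>[0,T]\<close> only. Clamping the time argument extends them to all times, so
that measurability can be expressed on the product of the whole real line with the state space.\<close>

lemma borel_measurable_continuous_on_horizon:
  fixes X :: "real \<Rightarrow> 'a \<Rightarrow> real"
  assumes T: "0 \<le> T" and X: "\<And>t. t \<in> {0..T} \<Longrightarrow> X t \<in> borel_measurable M"
    and cont: "\<And>\<omega>. \<omega> \<in> space M \<Longrightarrow> continuous_on {0..T} (\<lambda>t. X t \<omega>)"
  shows "(\<lambda>(t, \<omega>). X (clamp 0 T t) \<omega>) \<in> borel_measurable (borel \<Otimes>\<^sub>M M)"
proof (rule borel_measurable_continuous_process)
  fix t
  have "clamp 0 T t \<in> {0..T}" using clamp_in_interval[of 0 T t] T by (simp add: cbox_interval)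
  thus "X (clamp 0 T t) \<in> borel_measurable M" by (rule X)
next
  fix \<omega> assume "\<omega> \<in> space M"
  hence "continuous_on (cbox 0 T) (\<lambda>t. X t \<omega>)" using cont by (simp add: cbox_interval)
  thus "continuous_on UNIV (\<lambda>t. X (clamp 0 T t) \<omega>)" by (rule clamp_continuous_on)
qed

lemma measurable_clamp:
  "0 \<le> T \<Longrightarrow> clamp 0 T \<in> borel \<rightarrow>\<^sub>M restrict_space borel {0..T::real}"
  using clamp_in_interval[of 0 T]
  by (intro measurable_restrict_space2 borel_measurable_continuous_onI
      clamp_continuous_on[where f="\<lambda>x. x", simplified]) (auto simp: cbox_interval)

lemma clamp_eq [simp]: "t \<in> {0..T} \<Longrightarrow> clamp 0 T t = (t :: real)"
  by (rule clamp_cancel_cbox) (simp add: cbox_interval)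

lemma borel_measurable_set_lebesgue_integral:
  fixes Y :: "real \<Rightarrow> 'a \<Rightarrow> real"
  assumes Y: "(\<lambda>(t, \<omega>). Y t \<omega>) \<in> borel_measurable (borel \<Otimes>\<^sub>M M)"
  shows "(\<lambda>\<omega>. LINT t:{a..b}|lborel. Y t \<omega>) \<in> borel_measurable M"
proof -
  have "(\<lambda>(\<omega>, t). Y t \<omega>) \<in> borel_measurable (M \<Otimes>\<^sub>M lborel)"
    using measurable_compose[OF measurable_pair_swap' Y[unfolded measurable_lborel2[symmetric]]]
    by (simp add: case_prod_unfold measurable_cong_sets[OF sets_pair_measure_cong[OF refl sets_lborel] refl])
  hence "(\<lambda>(\<omega>, t). indicator {a..b} t *\<^sub>R Y t \<omega>) \<in> borel_measurable (M \<Otimes>\<^sub>M lborel)"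
    by (simp add: case_prod_unfold)
  thus ?thesis
    unfolding set_lebesgue_integral_def
    by (intro lborel.borel_measurable_lebesgue_integral) (simp add: case_prod_unfold)
qed

lemma (in prob_space) nn_integral_time_swap:
  fixes Y :: "real \<Rightarrow> 'a \<Rightarrow> ennreal"
  assumes Y: "(\<lambda>(t, \<omega>). Y t \<omega>) \<in> borel_measurable (borel \<Otimes>\<^sub>M M)" and A: "A \<in> sets borel"
  shows "(\<integral>\<^sup>+\<omega>. (\<integral>\<^sup>+t\<in>A. Y t \<omega> \<partial>lborel) \<partial>M) = (\<integral>\<^sup>+t\<in>A. (\<integral>\<^sup>+\<omega>. Y t \<omega> \<partial>M) \<partial>lborel)"
proof -
  interpret pair_sigma_finite lborel M by standard
  have m: "(\<lambda>(t, \<omega>). Y t \<omega>) \<in> borel_measurable (lborel \<Otimes>\<^sub>M M)"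
    using Y by (simp add: measurable_cong_sets[OF sets_pair_measure_cong[OF sets_lborel refl] refl])
  have m2: "(\<lambda>(t, \<omega>). Y t \<omega> * indicator A t) \<in> borel_measurable (lborel \<Otimes>\<^sub>M M)"
    using m A by (simp add: case_prod_unfold)
  have "(\<integral>\<^sup>+\<omega>. (\<integral>\<^sup>+t. Y t \<omega> * indicator A t \<partial>lborel) \<partial>M)
      = (\<integral>\<^sup>+t. (\<integral>\<^sup>+\<omega>. Y t \<omega> * indicator A t \<partial>M) \<partial>lborel)"
    using Fubini'[OF m2] by simp
  also have "\<dots> = (\<integral>\<^sup>+t\<in>A. (\<integral>\<^sup>+\<omega>. Y t \<omega> \<partial>M) \<partial>lborel)"
    using measurable_compose[OF measurable_Pair1' m] by (intro nn_integral_cong nn_integral_multc) auto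
  finally show ?thesis .
qed

section \<open>Exponential moments of the log-price\<close>

context contract_model
begin

lemma logprice_measurable: "t \<in> {0..T} \<Longrightarrow> logprice md t \<in> borel_measurable M"
  and logprice_continuous: "\<omega> \<in> space M \<Longrightarrow> continuous_on {0..T} (\<lambda>t. logprice md t \<omega>)"
  using logprice_dynamics by (auto simp: ito_process_def)

lemma logprice_jointly_measurable:
  "(\<lambda>(t, \<omega>). logprice md (clamp 0 T t) \<omega>) \<in> borel_measurable (borel \<Otimes>\<^sub>M M)"
  using horizon_pos
  by (intro borel_measurable_continuous_on_horizon logprice_measurable logprice_continuous) auto

text \<open>By the dynamics this is \<open>w\<^sub>0 + r\<^sub>0 \<integral>\<^sub>0\<^sup>t \<nu> ds + \<integral>\<^sub>0\<^sup>t \<sigma>\<^sub>0 dW\<^sup>0\<close>, up to a null set that depends on \<open>t\<close>. Expressed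
through the log-price, it is a process with continuous paths.\<close>

definition logprice_noise :: "real \<Rightarrow> 'a \<Rightarrow> real" where
  "logprice_noise t \<omega> = logprice md t \<omega> + logprice_rate md * (LINT s:{0..t}|lborel. logprice md s \<omega>)"

lemma logprice_noise_continuous:
  assumes "\<omega> \<in> space M"
  shows "continuous_on {0..T} (\<lambda>t. logprice_noise t \<omega>)"
  unfolding logprice_noise_def using logprice_continuous[OF assms]
  by (intro continuous_intros continuous_on_set_lebesgue_integral set_integrable_continuous_Icc)

lemma logprice_noise_measurable:
  assumes t: "t \<in> {0..T}"
  shows "logprice_noise t \<in> borel_measurable M"
proof -
  have "(LINT s:{0..t}|lborel. logprice md s \<omega>) = (LINT s:{0..t}|lborel. logprice md (clamp 0 T s) \<omega>)" for \<omega>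
    using t by (intro set_lebesgue_integral_cong) auto
  thus ?thesis
    unfolding logprice_noise_def[abs_def] using logprice_measurable[OF t]
      borel_measurable_set_lebesgue_integral[OF logprice_jointly_measurable, of 0 t]
    by (simp add: borel_measurable_add borel_measurable_times)
qed

text \<open>The drift condition of the dynamics makes \<open>r\<^sub>0 \<nu>\<close> integrable, because the log-price itself has
continuous paths. The factor \<open>r\<^sub>0\<close> stays inside the integrals because it may vanish.\<close>

lemma logprice_noise_decomposition:
  obtains c\<^sub>0 where "0 \<le> c\<^sub>0" "\<And>t. t \<in> {0..T} \<Longrightarrow> \<exists>I.
    ito_integral M (natural_filtration M (noise md) {0}) (noise md 0) t (\<lambda>s _. logprice_vol md s) I \<and>
    (AE \<omega> in M. \<bar>logprice_noise t \<omega>\<bar> \<le> c\<^sub>0 + \<bar>I \<omega>\<bar>)"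
proof -
  let ?r = "logprice_rate md" and ?\<nu> = "logprice_level md" and ?w = "logprice md"
  let ?a = "\<lambda>t \<omega>. ?r * (?\<nu> t - ?w t \<omega>)"
  have AEa: "AE \<omega> in M. set_integrable lborel {0..T} (\<lambda>s. ?a s \<omega>)"
    using logprice_dynamics by (auto simp: ito_process_def)
  have wi: "set_integrable lborel {0..t} (\<lambda>s. ?w s \<omega>)" if "\<omega> \<in> space M" "t \<in> {0..T}" for \<omega> t
    using that by (intro set_integrable_continuous_Icc continuous_on_subset[OF logprice_continuous]) auto
  have ri: "set_integrable lborel {0..T} (\<lambda>s. ?r * ?\<nu> s)"
  proof -
    obtain \<omega> where w: "\<omega> \<in> space M" and "set_integrable lborel {0..T} (\<lambda>s. ?a s \<omega>)"
      using AE_witness[OF AEa] by blast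
    hence "set_integrable lborel {0..T} (\<lambda>s. ?a s \<omega> + ?r * ?w s \<omega>)"
      using wi[OF w, of T] horizon_pos by (intro set_integral_add) auto
    thus ?thesis by (simp add: algebra_simps)
  qed
  define N where "N = (LINT s:{0..T}|lborel. \<bar>?r * ?\<nu> s\<bar>)"
  have N: "\<bar>LINT s:{0..t}|lborel. ?r * ?\<nu> s\<bar> \<le> N" if t: "t \<in> {0..T}" for t
  proof -
    have "\<bar>LINT s:{0..t}|lborel. ?r * ?\<nu> s\<bar> \<le> (LINT s:{0..t}|lborel. \<bar>?r * ?\<nu> s\<bar>)"
      unfolding set_lebesgue_integral_def
      by (rule order_trans[OF integral_abs_bound]) (simp add: abs_mult)
    also have "\<dots> \<le> N"
      unfolding N_def set_lebesgue_integral_def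
      using set_integrable_abs[OF set_integrable_subset[OF ri, of "{0..t}"]] set_integrable_abs[OF ri] t
      by (intro integral_mono) (auto simp: set_integrable_def indicator_def)
    finally show ?thesis .
  qed
  have N0: "0 \<le> N" using N[of 0] horizon_pos by fastforce
  show ?thesis
  proof (rule that)
    show "0 \<le> \<bar>logprice_init md\<bar> + N" using N0 by simp
    fix t assume t: "t \<in> {0..T}"
    then obtain I where "ito_integrals M (noise md) {0} t (\<lambda>_ t _. logprice_vol md t) I"
      and eq: "AE \<omega> in M. ?w t \<omega> = logprice_init md + (LINT s:{0..t}|lborel. ?a s \<omega>) + I \<omega>"
      using logprice_dynamics unfolding ito_process_def by blast
    hence ito: "ito_integral M (natural_filtration M (noise md) {0}) (noise md 0) t (\<lambda>s _. logprice_vol md s) I"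
      by (auto simp: ito_integrals_def)
    moreover have "AE \<omega> in M. \<bar>logprice_noise t \<omega>\<bar> \<le> \<bar>logprice_init md\<bar> + N + \<bar>I \<omega>\<bar>"
      using eq AE_space
    proof eventually_elim
      case (elim \<omega>)
      have 1: "set_integrable lborel {0..t} (\<lambda>s. ?r * ?\<nu> s)"
        by (rule set_integrable_subset[OF ri]) (use t in auto)
      have 2: "set_integrable lborel {0..t} (\<lambda>s. ?r * ?w s \<omega>)"
        using wi[OF elim(2) t] by simp
      have "(LINT s:{0..t}|lborel. ?a s \<omega>) = (LINT s:{0..t}|lborel. ?r * ?\<nu> s - ?r * ?w s \<omega>)"
        by (simp add: right_diff_distrib)
      also have "\<dots> = (LINT s:{0..t}|lborel. ?r * ?\<nu> s) - (LINT s:{0..t}|lborel. ?r * ?w s \<omega>)"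
        by (rule set_integral_diff(2)[OF 1 2])
      also have "(LINT s:{0..t}|lborel. ?r * ?w s \<omega>) = ?r * (LINT s:{0..t}|lborel. ?w s \<omega>)"
        by (rule set_integral_mult_right)
      finally have "logprice_noise t \<omega> = logprice_init md + (LINT s:{0..t}|lborel. ?r * ?\<nu> s) + I \<omega>"
        using elim(1) unfolding logprice_noise_def by linarith
      thus ?case using N[OF t] by linarith
    qed
    ultimately show "\<exists>I. ito_integral M (natural_filtration M (noise md) {0}) (noise md 0) t (\<lambda>s _. logprice_vol md s) I \<and>
      (AE \<omega> in M. \<bar>logprice_noise t \<omega>\<bar> \<le> \<bar>logprice_init md\<bar> + N + \<bar>I \<omega>\<bar>)" by blast
  qed
qed

lemma logprice_noise_exp_moment:
  obtains E where "\<And>t. t \<in> {0..T} \<Longrightarrow> (\<integral>\<^sup>+\<omega>. ennreal (exp (c * \<bar>logprice_noise t \<omega>\<bar>)) \<partial>M) \<le> ennreal E"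
proof -
  obtain c\<^sub>0 where c0: "0 \<le> c\<^sub>0" and dec: "\<And>t. t \<in> {0..T} \<Longrightarrow> \<exists>I.
    ito_integral M (natural_filtration M (noise md) {0}) (noise md 0) t (\<lambda>s _. logprice_vol md s) I \<and>
    (AE \<omega> in M. \<bar>logprice_noise t \<omega>\<bar> \<le> c\<^sub>0 + \<bar>I \<omega>\<bar>)"
    by (rule logprice_noise_decomposition, rule that)
  obtain C where C: "\<And>s. s \<in> {0..T} \<Longrightarrow> \<bar>logprice_vol md s\<bar> \<le> C"
    using logprice_vol_bounded unfolding bounded_iff by fastforce
  have C0: "0 \<le> C" using C[of 0] horizon_pos by fastforce
  interpret brownian_filtration M "natural_filtration M (noise md) {0}" "noise md 0" T
    using noise_brownian_filtration[of 1 "{0}" 0] agents_pos by simp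
  define e where "e = exp (c\<^sup>2 * (C\<^sup>2 * T) / 2)"
  have e0: "0 \<le> e" by (simp add: e_def)
  show ?thesis
  proof (rule that)
    fix t assume t: "t \<in> {0..T}"
    obtain I where I: "ito_integral M (natural_filtration M (noise md) {0}) (noise md 0) t (\<lambda>s _. logprice_vol md s) I"
      and AE: "AE \<omega> in M. \<bar>logprice_noise t \<omega>\<bar> \<le> c\<^sub>0 + \<bar>I \<omega>\<bar>"
      using dec[OF t] by blast
    have [measurable]: "I \<in> borel_measurable M" using I by (auto simp: ito_integral_def)
    have vol: "logprice_vol md \<in> borel_measurable (restrict_space borel {0..t})"
      using measurable_restrict_mono[OF logprice_vol_measurable, of "{0..t}"] t by auto
    have moment: "(\<integral>\<^sup>+\<omega>. ennreal (exp (x * I \<omega>)) \<partial>M) \<le> ennreal e" if "x\<^sup>2 = c\<^sup>2" for x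
    proof -
      have "(\<integral>\<^sup>+\<omega>. ennreal (exp (x * I \<omega>)) \<partial>M) \<le> ennreal (exp (x\<^sup>2 * (C\<^sup>2 * t) / 2))"
        using t C by (intro ito_integral_exp_moment[OF I _ _ vol]) auto
      also have "\<dots> \<le> ennreal e"
        unfolding e_def using t that by (intro ennreal_leI) (auto intro!: mult_left_mono divide_right_mono)
      finally show ?thesis .
    qed
    have "(\<integral>\<^sup>+\<omega>. ennreal (exp (c * \<bar>logprice_noise t \<omega>\<bar>)) \<partial>M)
        \<le> (\<integral>\<^sup>+\<omega>. ennreal (exp (\<bar>c\<bar> * c\<^sub>0)) * (ennreal (exp (c * I \<omega>)) + ennreal (exp (- c * I \<omega>))) \<partial>M)"
    proof (rule nn_integral_mono_AE, use AE in eventually_elim)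
      case (elim \<omega>)
      have "c * \<bar>logprice_noise t \<omega>\<bar> \<le> \<bar>c\<bar> * \<bar>logprice_noise t \<omega>\<bar>"
        by (intro mult_right_mono) auto
      also have "\<dots> \<le> \<bar>c\<bar> * (c\<^sub>0 + \<bar>I \<omega>\<bar>)" using elim by (intro mult_left_mono) auto
      finally have "exp (c * \<bar>logprice_noise t \<omega>\<bar>) \<le> exp (\<bar>c\<bar> * c\<^sub>0) * exp \<bar>c * I \<omega>\<bar>"
        by (simp add: exp_add[symmetric] algebra_simps abs_mult)
      also have "\<dots> \<le> exp (\<bar>c\<bar> * c\<^sub>0) * (exp (c * I \<omega>) + exp (- c * I \<omega>))"
        by (intro mult_left_mono) (auto simp: abs_if)
      finally show ?case by (simp add: ennreal_mult ennreal_plus[symmetric] ennreal_leI del: ennreal_plus flip: ennreal_mult)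
    qed
    also have "\<dots> = ennreal (exp (\<bar>c\<bar> * c\<^sub>0)) *
        ((\<integral>\<^sup>+\<omega>. ennreal (exp (c * I \<omega>)) \<partial>M) + (\<integral>\<^sup>+\<omega>. ennreal (exp (- c * I \<omega>)) \<partial>M))"
      by (subst nn_integral_cmult) (auto intro!: arg_cong2[where f="(*)"] nn_integral_add)
    also have "\<dots> \<le> ennreal (exp (\<bar>c\<bar> * c\<^sub>0)) * (ennreal e + ennreal e)"
      by (intro mult_left_mono add_mono moment) auto
    also have "\<dots> = ennreal (exp (\<bar>c\<bar> * c\<^sub>0) * (e + e))"
      using e0 by (subst ennreal_mult) (auto simp flip: ennreal_plus)
    finally show "(\<integral>\<^sup>+\<omega>. ennreal (exp (c * \<bar>logprice_noise t \<omega>\<bar>)) \<partial>M) \<le> ennreal (exp (\<bar>c\<bar> * c\<^sub>0) * (e + e))" .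
  qed
qed

text \<open>The log-price is bounded by its driving noise at time \<open>t\<close> plus a time average of the noise. The
exponential of the sum is at most the sum of the exponentials of twice the summands, and Jensen's
inequality in time and Fubini's theorem reduce the second one to fixed times.\<close>

lemma exp_logprice_bounded_mean:
  obtains E where "\<And>t. t \<in> {0..T} \<Longrightarrow> (\<integral>\<^sup>+\<omega>. ennreal (exp (logprice md t \<omega>)) \<partial>M) \<le> ennreal E"
proof -
  define R where "R = \<bar>logprice_rate md\<bar> * exp (\<bar>logprice_rate md\<bar> * T)"
  obtain E\<^sub>1 where E1: "\<And>t. t \<in> {0..T} \<Longrightarrow>
      (\<integral>\<^sup>+\<omega>. ennreal (exp (2 * \<bar>logprice_noise t \<omega>\<bar>)) \<partial>M) \<le> ennreal E\<^sub>1"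
    using logprice_noise_exp_moment[of 2] by blast
  \<comment> \<open>The factor \<open>T\<close> comes from the normalisation of the time average, the factor 2 from splitting the product.\<close>
  obtain E\<^sub>2 where E2: "\<And>t. t \<in> {0..T} \<Longrightarrow>
      (\<integral>\<^sup>+\<omega>. ennreal (exp (T * 2 * R * \<bar>logprice_noise t \<omega>\<bar>)) \<partial>M) \<le> ennreal E\<^sub>2"
    using logprice_noise_exp_moment[of "T * 2 * R"] by blast
  let ?g = logprice_noise
  let ?Y = "\<lambda>s \<omega>. ennreal (exp (T * 2 * R * \<bar>?g (clamp 0 T s) \<omega>\<bar>))"
  define B where "B \<omega> = (\<integral>\<^sup>+s\<in>{0..T}. ?Y s \<omega> \<partial>lborel) / ennreal T" for \<omega>
  have gm: "(\<lambda>(t, \<omega>). ?g (clamp 0 T t) \<omega>) \<in> borel_measurable (borel \<Otimes>\<^sub>M M)"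
    using horizon_pos by (intro borel_measurable_continuous_on_horizon
        logprice_noise_measurable logprice_noise_continuous) auto
  have Ym: "(\<lambda>(s, \<omega>). ?Y s \<omega>) \<in> borel_measurable (borel \<Otimes>\<^sub>M M)"
    using gm by (simp add: case_prod_unfold)
  have Ym': "(\<lambda>(\<omega>, s). ?Y s \<omega> * indicator {0..T} s) \<in> borel_measurable (M \<Otimes>\<^sub>M lborel)"
    using measurable_compose[OF measurable_pair_swap' Ym[unfolded measurable_lborel2[symmetric]]]
    by (simp add: case_prod_unfold measurable_cong_sets[OF sets_pair_measure_cong[OF refl sets_lborel] refl])
  have Bm [measurable]: "B \<in> borel_measurable M"
    unfolding B_def using lborel.borel_measurable_nn_integral[OF Ym'] by simp
  have B: "(\<integral>\<^sup>+\<omega>. B \<omega> \<partial>M) \<le> ennreal E\<^sub>2"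
  proof -
    have "(\<integral>\<^sup>+\<omega>. B \<omega> \<partial>M) = (\<integral>\<^sup>+\<omega>. (\<integral>\<^sup>+s\<in>{0..T}. ?Y s \<omega> \<partial>lborel) \<partial>M) / ennreal T"
      unfolding B_def using lborel.borel_measurable_nn_integral[OF Ym']
      by (intro nn_integral_divide) simp
    also have "(\<integral>\<^sup>+\<omega>. (\<integral>\<^sup>+s\<in>{0..T}. ?Y s \<omega> \<partial>lborel) \<partial>M) = (\<integral>\<^sup>+s\<in>{0..T}. (\<integral>\<^sup>+\<omega>. ?Y s \<omega> \<partial>M) \<partial>lborel)"
      by (rule nn_integral_time_swap[OF Ym]) simp
    also have "\<dots> \<le> (\<integral>\<^sup>+s\<in>{0..T}. ennreal E\<^sub>2 \<partial>lborel)"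
      using E2 by (intro nn_integral_mono) (auto simp: indicator_def)
    also have "\<dots> = ennreal E\<^sub>2 * ennreal T"
      using horizon_pos by (simp add: nn_integral_cmult_indicator)
    finally show ?thesis
      using horizon_pos by (simp add: ennreal_mult_divide_eq divide_right_mono_ennreal)
  qed
  show ?thesis
  proof (rule that)
    fix t assume t: "t \<in> {0..T}"
    have "(\<integral>\<^sup>+\<omega>. ennreal (exp (logprice md t \<omega>)) \<partial>M)
        \<le> (\<integral>\<^sup>+\<omega>. ennreal (exp (2 * \<bar>?g t \<omega>\<bar>)) + B \<omega> \<partial>M)"
    proof (rule nn_integral_mono)
      fix \<omega> assume w: "\<omega> \<in> space M"
      have gc: "continuous_on {0..T} (\<lambda>s. 2 * R * \<bar>?g s \<omega>\<bar>)"
        by (intro continuous_intros logprice_noise_continuous w)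
      define L where "L = (LINT s:{0..T}|lborel. 2 * R * \<bar>?g s \<omega>\<bar>)"
      have "\<bar>logprice md t \<omega>\<bar> \<le> \<bar>?g t \<omega>\<bar> + R * (LINT s:{0..T}|lborel. \<bar>?g s \<omega>\<bar>)"
        unfolding R_def using t
        by (intro linear_ode_bound[OF logprice_continuous[OF w]]) (auto simp: logprice_noise_def)
      also have "R * (LINT s:{0..T}|lborel. \<bar>?g s \<omega>\<bar>) = L / 2"
        unfolding L_def by (subst set_integral_mult_right) simp
      finally have "logprice md t \<omega> \<le> \<bar>?g t \<omega>\<bar> + L / 2" by linarith
      also have "\<dots> \<le> max (2 * \<bar>?g t \<omega>\<bar>) L" by linarith
      finally have "exp (logprice md t \<omega>) \<le> exp (max (2 * \<bar>?g t \<omega>\<bar>) L)" by simp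
      also have "\<dots> \<le> exp (2 * \<bar>?g t \<omega>\<bar>) + exp L" by (auto simp: max_def)
      finally have "ennreal (exp (logprice md t \<omega>)) \<le> ennreal (exp (2 * \<bar>?g t \<omega>\<bar>)) + ennreal (exp L)"
        by (simp add: ennreal_leI flip: ennreal_plus)
      also have "ennreal (exp L) \<le> (\<integral>\<^sup>+s\<in>{0..T}. ennreal (exp (T * (2 * R * \<bar>?g s \<omega>\<bar>))) \<partial>lborel) / ennreal T"
        unfolding L_def by (rule exp_integral_le[OF horizon_pos gc])
      also have "\<dots> = B \<omega>"
        unfolding B_def by (intro arg_cong2[where f="(/)"] nn_integral_cong) (auto simp: indicator_def mult.assoc)
      finally show "ennreal (exp (logprice md t \<omega>)) \<le> ennreal (exp (2 * \<bar>?g t \<omega>\<bar>)) + B \<omega>"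
        by (simp add: add_left_mono)
    qed
    also have "\<dots> = (\<integral>\<^sup>+\<omega>. ennreal (exp (2 * \<bar>?g t \<omega>\<bar>)) \<partial>M) + (\<integral>\<^sup>+\<omega>. B \<omega> \<partial>M)"
      using logprice_noise_measurable[OF t] by (intro nn_integral_add) auto
    also have "\<dots> \<le> ennreal E\<^sub>1 + ennreal E\<^sub>2" by (intro add_mono E1 t B)
    also have "\<dots> \<le> ennreal (\<bar>E\<^sub>1\<bar> + \<bar>E\<^sub>2\<bar>)"
      by (subst ennreal_plus) (auto intro!: add_mono ennreal_leI)
    finally show "(\<integral>\<^sup>+\<omega>. ennreal (exp (logprice md t \<omega>)) \<partial>M) \<le> ennreal (\<bar>E\<^sub>1\<bar> + \<bar>E\<^sub>2\<bar>)" .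
  qed
qed

end

section \<open>Load states\<close>

context contract_model
begin

text \<open>The Lipschitz bound comes from the bounded derivative.\<close>

lemma load_drift_estimates:
  assumes i: "i \<in> {1..agents md}"
  obtains K where "0 \<le> K"
    "\<And>x u. u \<in> control_set md i \<Longrightarrow> \<bar>load_drift md i x u\<bar> \<le> K * (1 + \<bar>x\<bar> + \<bar>u\<bar>)"
    "\<And>x y u. u \<in> control_set md i \<Longrightarrow> \<bar>load_drift md i x u - load_drift md i y u\<bar> \<le> K * \<bar>x - y\<bar>"
proof -
  obtain K where K: "\<And>x u. u \<in> control_set md i \<Longrightarrow>
      (\<exists>D. ((\<lambda>x. load_drift md i x u) has_real_derivative D) (at x) \<and> \<bar>D\<bar> \<le> K)"
    "\<And>x u. u \<in> control_set md i \<Longrightarrow> \<bar>load_drift md i x u\<bar> \<le> K * (1 + \<bar>x\<bar> + \<bar>u\<bar>)"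
    using load_drift_bounds[OF i] by blast
  have K0: "K \<le> max 0 K" by simp
  show ?thesis
  proof (rule that)
    show "0 \<le> max 0 K" by simp
    fix x u assume u: "u \<in> control_set md i"
    show "\<bar>load_drift md i x u\<bar> \<le> max 0 K * (1 + \<bar>x\<bar> + \<bar>u\<bar>)"
      by (rule order_trans[OF K(2)[OF u] mult_right_mono[OF K0]]) simp
    fix y
    have "\<forall>z. \<exists>D. ((\<lambda>x. load_drift md i x u) has_real_derivative D) (at z) \<and> \<bar>D\<bar> \<le> K"
      using K(1)[OF u] by blast
    from choice[OF this] obtain D where
      D: "\<forall>z. ((\<lambda>x. load_drift md i x u) has_real_derivative D z) (at z) \<and> \<bar>D z\<bar> \<le> K" ..
    have "norm (load_drift md i x u - load_drift md i y u) \<le> K * norm (x - y)"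
      by (rule field_differentiable_bound[of UNIV "\<lambda>x. load_drift md i x u" D]) (use D in auto)
    also have "\<dots> \<le> max 0 K * norm (x - y)" by (rule mult_right_mono[OF K0]) simp
    finally show "\<bar>load_drift md i x u - load_drift md i y u\<bar> \<le> max 0 K * \<bar>x - y\<bar>" by simp
  qed
qed

lemma load_state_measurable: "load_state md i u x \<Longrightarrow> t \<in> {0..T} \<Longrightarrow> x t \<in> borel_measurable M"
  and load_state_continuous: "load_state md i u x \<Longrightarrow> \<omega> \<in> space M \<Longrightarrow> continuous_on {0..T} (\<lambda>t. x t \<omega>)"
  by (auto simp: load_state_def ito_process_def)

text \<open>One null set serves for all times, since both sides are continuous in time.\<close>

lemma load_state_integral_equation:
  assumes x: "load_state md i u x"
  shows "AE \<omega> in M. set_integrable lborel {0..T} (\<lambda>s. load_drift md i (x s \<omega>) (u s \<omega>)) \<and>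
    (\<forall>t\<in>{0..T}. x t \<omega> = load_init md i + (LINT s:{0..t}|lborel. load_drift md i (x s \<omega>) (u s \<omega>)))"
proof -
  let ?f = "\<lambda>\<omega> s. load_drift md i (x s \<omega>) (u s \<omega>)"
  have int: "AE \<omega> in M. set_integrable lborel {0..T} (?f \<omega>)"
    using x by (auto simp: load_state_def ito_process_def)
  have "AE \<omega> in M. x t \<omega> = load_init md i + (LINT s:{0..t}|lborel. ?f \<omega> s)" if "t \<in> {0..T}" for t
  proof -
    have "\<exists>I. ito_integrals M (noise md) {} t (\<lambda>_ _ _. 0) I \<and>
        (AE \<omega> in M. x t \<omega> = load_init md i + (LINT s:{0..t}|lborel. ?f \<omega> s) + I \<omega>)"
      using x that by (simp add: load_state_def ito_process_def)
    thus ?thesis by (simp add: ito_integrals_def)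
  qed
  hence "AE \<omega> in M. \<forall>t\<in>\<rat> \<inter> {0..T}. x t \<omega> = load_init md i + (LINT s:{0..t}|lborel. ?f \<omega> s)"
    by (subst AE_ball_countable) (auto intro: countable_Int1 countable_rat)
  with int AE_space show ?thesis
  proof eventually_elim
    case (elim \<omega>)
    have "continuous_on {0..T} (\<lambda>t. x t \<omega> - (load_init md i + (LINT s:{0..t}|lborel. ?f \<omega> s)))"
      by (intro continuous_intros load_state_continuous[OF x elim(2)]
          continuous_on_set_lebesgue_integral elim(1))
    from continuous_zero_on_rationals[OF horizon_pos this] elim(1,3)
    show ?case by auto
  qed
qed

lemma controls_bounded:
  assumes i: "i \<in> {1..agents md}" and u: "u \<in> controls md i"
  obtains C where "0 \<le> C" "\<And>t \<omega>. t \<in> {0..T} \<Longrightarrow> \<omega> \<in> space M \<Longrightarrow> \<bar>u t \<omega>\<bar> \<le> C"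
proof -
  from compact_imp_bounded[OF control_set_compact[OF i]] obtain C
    where C: "\<forall>v\<in>control_set md i. norm v \<le> C" unfolding bounded_iff by blast
  have "\<bar>u t \<omega>\<bar> \<le> max 0 C" if "t \<in> {0..T}" "\<omega> \<in> space M" for t \<omega>
  proof -
    have "u t \<omega> \<in> control_set md i" using u that by (auto simp: controls_def)
    with C have "norm (u t \<omega>) \<le> C" ..
    thus ?thesis by simp
  qed
  thus ?thesis by (intro that[of "max 0 C"]) simp_all
qed

lemma control_in_set:
  "u \<in> controls md i \<Longrightarrow> t \<in> {0..T} \<Longrightarrow> \<omega> \<in> space M \<Longrightarrow> u t \<omega> \<in> control_set md i"
  by (auto simp: controls_def)

text \<open>Gronwall's inequality with linear growth and bounded controls; the bound is deterministic.\<close>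

lemma load_state_bounded:
  assumes i: "i \<in> {1..agents md}" and u: "u \<in> controls md i" and x: "load_state md i u x"
  obtains R where "0 \<le> R" "AE \<omega> in M. \<forall>t\<in>{0..T}. \<bar>x t \<omega>\<bar> \<le> R"
proof -
  obtain K where K: "0 \<le> K"
    "\<And>x u. u \<in> control_set md i \<Longrightarrow> \<bar>load_drift md i x u\<bar> \<le> K * (1 + \<bar>x\<bar> + \<bar>u\<bar>)"
    by (rule load_drift_estimates[OF i], rule that)
  obtain C where C: "0 \<le> C" "\<And>t \<omega>. t \<in> {0..T} \<Longrightarrow> \<omega> \<in> space M \<Longrightarrow> \<bar>u t \<omega>\<bar> \<le> C"
    by (rule controls_bounded[OF i u], rule that)
  define A where "A = \<bar>load_init md i\<bar> + K * (1 + C) * T"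
  have A0: "0 \<le> A" using K C horizon_pos by (auto simp: A_def)
  show ?thesis
  proof (rule that[of "A * exp (K * T)"])
    show "0 \<le> A * exp (K * T)" using A0 by simp
    show "AE \<omega> in M. \<forall>t\<in>{0..T}. \<bar>x t \<omega>\<bar> \<le> A * exp (K * T)"
      using load_state_integral_equation[OF x] AE_space
    proof eventually_elim
      case (elim \<omega>)
      note xc = load_state_continuous[OF x elim(2)]
      let ?f = "\<lambda>s. load_drift md i (x s \<omega>) (u s \<omega>)"
      have ac: "continuous_on {0..T} (\<lambda>s. \<bar>x s \<omega>\<bar>)" by (intro continuous_intros xc)
      have le: "\<bar>x t \<omega>\<bar> \<le> A + K * (LINT s:{0..t}|lborel. \<bar>x s \<omega>\<bar>)" if t: "t \<in> {0..T}" for t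
      proof -
        have ci: "set_integrable lborel {0..t} (\<lambda>s. K * (1 + C))"
          and xi: "set_integrable lborel {0..t} (\<lambda>s. K * \<bar>x s \<omega>\<bar>)"
          using t by (auto intro!: set_integrable_continuous_Icc continuous_intros continuous_on_subset[OF xc])
        have "\<bar>LINT s:{0..t}|lborel. ?f s\<bar> \<le> (LINT s:{0..t}|lborel. K * (1 + C) + K * \<bar>x s \<omega>\<bar>)"
        proof (rule set_integral_abs_le)
          show "set_integrable lborel {0..t} ?f"
            by (rule set_integrable_subset[of _ "{0..T}"]) (use elim t in auto)
          show "set_integrable lborel {0..t} (\<lambda>s. K * (1 + C) + K * \<bar>x s \<omega>\<bar>)"
            by (rule set_integral_add(1)[OF ci xi])
          fix s assume s: "s \<in> {0..t}"
          hence s: "s \<in> {0..T}" using t by auto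
          have "\<bar>?f s\<bar> \<le> K * (1 + \<bar>x s \<omega>\<bar> + \<bar>u s \<omega>\<bar>)"
            by (rule K(2)[OF control_in_set[OF u s elim(2)]])
          also have "\<dots> \<le> K * (1 + \<bar>x s \<omega>\<bar> + C)" using C(2)[OF s elim(2)] K(1) by (intro mult_left_mono) auto
          finally show "\<bar>?f s\<bar> \<le> K * (1 + C) + K * \<bar>x s \<omega>\<bar>" by (simp add: algebra_simps)
        qed
        also have "\<dots> = (LINT s:{0..t}|lborel. K * (1 + C)) + (LINT s:{0..t}|lborel. K * \<bar>x s \<omega>\<bar>)"
          by (rule set_integral_add(2)[OF ci xi])
        also have "(LINT s:{0..t}|lborel. K * \<bar>x s \<omega>\<bar>) = K * (LINT s:{0..t}|lborel. \<bar>x s \<omega>\<bar>)"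
          by (rule set_integral_mult_right)
        also have "(LINT s:{0..t}|lborel. K * (1 + C)) = K * (1 + C) * t"
          using t by (simp add: set_lebesgue_integral_def)
        also have "K * (1 + C) * t \<le> K * (1 + C) * T" using t K C by (intro mult_left_mono) auto
        finally show ?thesis using elim(1) t unfolding A_def by fastforce
      qed
      show ?case
      proof
        fix t assume t: "t \<in> {0..T}"
        have "\<bar>x t \<omega>\<bar> \<le> A * exp (K * t)" by (rule gronwall[OF ac K(1) le t])
        also have "\<dots> \<le> A * exp (K * T)" using t A0 K(1) by (auto intro!: mult_left_mono)
        finally show "\<bar>x t \<omega>\<bar> \<le> A * exp (K * T)" .
      qed
    qed
  qed
qed

lemma load_state_unique:
  assumes i: "i \<in> {1..agents md}" and u: "u \<in> controls md i"
    and x: "load_state md i u x" and y: "load_state md i u y"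
  shows "AE \<omega> in M. \<forall>t\<in>{0..T}. x t \<omega> = y t \<omega>"
proof -
  obtain K where K: "0 \<le> K"
    "\<And>x y u. u \<in> control_set md i \<Longrightarrow> \<bar>load_drift md i x u - load_drift md i y u\<bar> \<le> K * \<bar>x - y\<bar>"
    by (rule load_drift_estimates[OF i], rule that)
  show ?thesis
    using load_state_integral_equation[OF x] load_state_integral_equation[OF y] AE_space
  proof eventually_elim
    case (elim \<omega>)
    note xc = load_state_continuous[OF x elim(3)] load_state_continuous[OF y elim(3)]
    let ?f = "\<lambda>s. load_drift md i (x s \<omega>) (u s \<omega>)" and ?g = "\<lambda>s. load_drift md i (y s \<omega>) (u s \<omega>)"
    have ac: "continuous_on {0..T} (\<lambda>s. \<bar>x s \<omega> - y s \<omega>\<bar>)" by (intro continuous_intros xc)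
    have le: "\<bar>x t \<omega> - y t \<omega>\<bar> \<le> 0 + K * (LINT s:{0..t}|lborel. \<bar>x s \<omega> - y s \<omega>\<bar>)" if t: "t \<in> {0..T}" for t
    proof -
      have fi: "set_integrable lborel {0..t} ?f" and gi: "set_integrable lborel {0..t} ?g"
        by (rule set_integrable_subset[of _ "{0..T}"], use elim t in auto)+
      have xi: "set_integrable lborel {0..t} (\<lambda>s. K * \<bar>x s \<omega> - y s \<omega>\<bar>)"
        using t by (auto intro!: set_integrable_continuous_Icc continuous_intros continuous_on_subset[OF xc(1)]
            continuous_on_subset[OF xc(2)])
      have "x t \<omega> - y t \<omega> = (LINT s:{0..t}|lborel. ?f s) - (LINT s:{0..t}|lborel. ?g s)"
        using elim(1,2) t by simp
      also have "\<dots> = (LINT s:{0..t}|lborel. ?f s - ?g s)"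
        by (rule set_integral_diff(2)[OF fi gi, symmetric])
      finally have "\<bar>x t \<omega> - y t \<omega>\<bar> = \<bar>LINT s:{0..t}|lborel. ?f s - ?g s\<bar>" by simp
      also have "\<dots> \<le> (LINT s:{0..t}|lborel. K * \<bar>x s \<omega> - y s \<omega>\<bar>)"
        using t by (intro set_integral_abs_le set_integral_diff(1) fi gi xi K(2)
            control_in_set[OF u _ elim(3)]) auto
      also have "\<dots> = K * (LINT s:{0..t}|lborel. \<bar>x s \<omega> - y s \<omega>\<bar>)"
        by (rule set_integral_mult_right)
      finally show ?thesis by simp
    qed
    show ?case using gronwall[OF ac K(1) le] by fastforce
  qed
qed

end

section \<open>Expected payoffs\<close>

context contract_model
begin

definition payoff_rate ::
  "nat \<Rightarrow> (real \<Rightarrow> 'a \<Rightarrow> real) \<Rightarrow> (real \<Rightarrow> 'a \<Rightarrow> real) \<Rightarrow> real \<Rightarrow> 'a \<Rightarrow> real" where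
  "payoff_rate i x u t \<omega> =
     rP md i t (logprice md t \<omega>) (x t \<omega>) (u t \<omega>) + rA md i t (x t \<omega>) (u t \<omega>)"

definition total_payoff ::
  "nat \<Rightarrow> (real \<Rightarrow> 'a \<Rightarrow> real) \<Rightarrow> (real \<Rightarrow> 'a \<Rightarrow> real) \<Rightarrow> 'a \<Rightarrow> real" where
  "total_payoff i x u \<omega> = (LINT t:{0..T}|lborel. payoff_rate i x u t \<omega>)"

text \<open>The integrability in time is part of the admissibility of a payoff and cannot be derived from the load
equation, since \<open>l\<^sub>i\<close> and \<open>p\<^sub>i\<close> are arbitrary measurable functions.\<close>

definition integrable_state ::
  "nat \<Rightarrow> (real \<Rightarrow> 'a \<Rightarrow> real) \<Rightarrow> (real \<Rightarrow> 'a \<Rightarrow> real) \<Rightarrow> bool" where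
  "integrable_state i x u \<longleftrightarrow> load_state md i u x \<and>
     (AE \<omega> in M. set_integrable lborel {0..T} (\<lambda>t. payoff_rate i x u t \<omega>))"

text \<open>The terms with \<open>\<mu>\<^sub>i\<close> enter the two rates with opposite signs. What remains involves \<open>l\<^sub>i\<close> and \<open>p\<^sub>i\<close>
only through their difference.\<close>

lemma payoff_rate_eq:
  "payoff_rate i x u t \<omega> = exp (logprice md t \<omega>) * (p_coeff md i t - l_coeff md i t)
     + (comfort md i (x t \<omega>) (u t \<omega>) - exp (logprice md t \<omega>) * u t \<omega>)"
  by (simp add: payoff_rate_def rP_def rA_def algebra_simps)

text \<open>The comfort function does not depend on time, so the assumed growth bound on \<open>r\<^sub>i\<^sup>A\<close>, used at time \<open>0\<close>
only, bounds it on bounded sets.\<close>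

lemma payoff_rate_estimate:
  assumes i: "i \<in> {1..agents md}" and u: "u \<in> controls md i" and x: "load_state md i u x"
  obtains D where "0 \<le> D" "AE \<omega> in M. \<forall>t\<in>{0..T}.
    \<bar>payoff_rate i x u t \<omega> - exp (logprice md t \<omega>) * (p_coeff md i t - l_coeff md i t)\<bar>
      \<le> D * (1 + exp (logprice md t \<omega>))"
proof -
  obtain C where C: "0 \<le> C" "\<And>t \<omega>. t \<in> {0..T} \<Longrightarrow> \<omega> \<in> space M \<Longrightarrow> \<bar>u t \<omega>\<bar> \<le> C"
    by (rule controls_bounded[OF i u], rule that)
  obtain R where R: "0 \<le> R" "AE \<omega> in M. \<forall>t\<in>{0..T}. \<bar>x t \<omega>\<bar> \<le> R"
    by (rule load_state_bounded[OF i u x], rule that)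
  obtain B\<^sub>0 B\<^sub>1 where B: "\<forall>t\<in>{0..T}. \<forall>x. \<forall>u\<in>control_set md i. \<bar>rA md i t x u\<bar> \<le> B\<^sub>0 + B\<^sub>1 * \<bar>x\<bar>"
    using rA_bound[OF i] by blast
  define D where "D = C + \<bar>B\<^sub>0\<bar> + \<bar>B\<^sub>1\<bar> * R + \<bar>mu_coeff md i 0\<bar> * (\<bar>l_coeff md i 0\<bar> + C)"
  have D: "0 \<le> D" "C \<le> D" using C(1) R(1) by (auto simp: D_def)
  show ?thesis
  proof (rule that[OF D(1)], use R(2) AE_space in eventually_elim, rule ballI)
    fix \<omega> t assume xR: "\<forall>t\<in>{0..T}. \<bar>x t \<omega>\<bar> \<le> R" and w: "\<omega> \<in> space M" and t: "t \<in> {0..T}"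
    let ?x = "x t \<omega>" and ?u = "u t \<omega>" and ?e = "exp (logprice md t \<omega>)"
    have uC: "\<bar>?u\<bar> \<le> C" by (rule C(2)[OF t w])
    have "\<bar>rA md i 0 ?x ?u\<bar> \<le> B\<^sub>0 + B\<^sub>1 * \<bar>?x\<bar>"
      using B control_in_set[OF u t w] horizon_pos by simp
    also have "B\<^sub>1 * \<bar>?x\<bar> \<le> \<bar>B\<^sub>1\<bar> * R"
      using xR t by (intro mult_mono) auto
    finally have 1: "\<bar>rA md i 0 ?x ?u\<bar> \<le> \<bar>B\<^sub>0\<bar> + \<bar>B\<^sub>1\<bar> * R" by linarith
    have 2: "\<bar>mu_coeff md i 0 * (l_coeff md i 0 + ?u)\<bar> \<le> \<bar>mu_coeff md i 0\<bar> * (\<bar>l_coeff md i 0\<bar> + C)"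
      using uC by (simp add: abs_mult mult_left_mono)
    have "comfort md i ?x ?u = rA md i 0 ?x ?u + mu_coeff md i 0 * (l_coeff md i 0 + ?u)"
      by (simp add: rA_def)
    hence 3: "\<bar>comfort md i ?x ?u\<bar> \<le> D" using 1 2 C(1) unfolding D_def by linarith
    have "\<bar>?e * ?u\<bar> \<le> ?e * D" using uC D(2) by (simp add: abs_mult mult_left_mono)
    with 3 have "\<bar>comfort md i ?x ?u - ?e * ?u\<bar> \<le> D + ?e * D" by linarith
    thus "\<bar>payoff_rate i x u t \<omega> - ?e * (p_coeff md i t - l_coeff md i t)\<bar> \<le> D * (1 + ?e)"
      by (simp add: payoff_rate_eq algebra_simps)
  qed
qed

text \<open>A statement about deterministic functions that is read off from a single path: there the payoff rate is
integrable and \<open>exp w\<close> is bounded away from zero.\<close>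

lemma price_spread_integrable:
  assumes i: "i \<in> {1..agents md}" and u: "u \<in> controls md i" and x: "integrable_state i x u"
  shows "set_integrable lborel {0..T} (\<lambda>t. p_coeff md i t - l_coeff md i t)"
proof -
  have ls: "load_state md i u x"
    and ai: "AE \<omega> in M. set_integrable lborel {0..T} (\<lambda>t. payoff_rate i x u t \<omega>)"
    using x by (auto simp: integrable_state_def)
  obtain D where D: "0 \<le> D" and est: "AE \<omega> in M. \<forall>t\<in>{0..T}.
    \<bar>payoff_rate i x u t \<omega> - exp (logprice md t \<omega>) * (p_coeff md i t - l_coeff md i t)\<bar>
      \<le> D * (1 + exp (logprice md t \<omega>))"
    by (rule payoff_rate_estimate[OF i u ls], rule that)
  have good_AE: "AE \<omega> in M. set_integrable lborel {0..T} (\<lambda>t. payoff_rate i x u t \<omega>) \<and>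
    (\<forall>t\<in>{0..T}. \<bar>payoff_rate i x u t \<omega> - exp (logprice md t \<omega>) * (p_coeff md i t - l_coeff md i t)\<bar>
      \<le> D * (1 + exp (logprice md t \<omega>)))"
    using ai est by eventually_elim blast
  obtain \<omega> where w: "\<omega> \<in> space M"
    and good: "set_integrable lborel {0..T} (\<lambda>t. payoff_rate i x u t \<omega>) \<and>
    (\<forall>t\<in>{0..T}. \<bar>payoff_rate i x u t \<omega> - exp (logprice md t \<omega>) * (p_coeff md i t - l_coeff md i t)\<bar>
      \<le> D * (1 + exp (logprice md t \<omega>)))"
    by (rule AE_witness[OF good_AE], rule that)
  note int = conjunct1[OF good] and le = bspec[OF conjunct2[OF good]]
  have "continuous_on {0..T} (\<lambda>t. exp (- logprice md t \<omega>))"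
    by (intro continuous_intros logprice_continuous w)
  hence "compact ((\<lambda>t. exp (- logprice md t \<omega>)) ` {0..T})" by (rule compact_continuous_image) simp
  from compact_imp_bounded[OF this] obtain c where c: "\<forall>t\<in>{0..T}. exp (- logprice md t \<omega>) \<le> c"
    unfolding bounded_iff by auto
  have c0: "0 \<le> c" using c horizon_pos exp_ge_zero[of "- logprice md 0 \<omega>"]
    by (meson atLeastAtMost_iff le_less order_trans)
  let ?b = "\<lambda>t. c * \<bar>payoff_rate i x u t \<omega>\<bar> + (c * D + D)"
  show ?thesis
  proof (rule set_integrable_bound)
    show "set_integrable lborel {0..T} ?b"
      by (rule set_integral_add(1)[OF set_integrable_mult_right[OF set_integrable_abs[OF int]]],
          intro set_integrable_continuous_Icc continuous_intros)
    have "(\<lambda>t. p_coeff md i t - l_coeff md i t) \<in> borel_measurable (restrict_space borel {0..T})"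
      by (intro borel_measurable_diff p_measurable l_measurable i)
    thus "set_borel_measurable lborel {0..T} (\<lambda>t. p_coeff md i t - l_coeff md i t)"
      by (simp add: set_borel_measurable_def borel_measurable_restrict_space_iff)
    show "AE t in lborel. t \<in> {0..T} \<longrightarrow> norm (p_coeff md i t - l_coeff md i t) \<le> norm (?b t)"
    proof (intro AE_I2 impI)
      fix t assume t: "t \<in> {0..T}"
      let ?e = "exp (logprice md t \<omega>)" and ?e' = "exp (- logprice md t \<omega>)"
      let ?q = "\<bar>payoff_rate i x u t \<omega>\<bar>" and ?d = "p_coeff md i t - l_coeff md i t"
      have "\<bar>?e * ?d\<bar> \<le> ?q + D * (1 + ?e)" using le[OF t] by linarith
      hence le': "?e' * \<bar>?e * ?d\<bar> \<le> ?e' * (?q + D * (1 + ?e))" by (intro mult_left_mono) auto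
      have ee: "?e' * ?e = 1" by (simp add: exp_add[symmetric])
      have "?e' * \<bar>?e * ?d\<bar> = (?e' * ?e) * \<bar>?d\<bar>" by (simp add: abs_mult)
      moreover have "?e' * (?q + D * (1 + ?e)) = ?e' * ?q + ?e' * D + D * (?e' * ?e)"
        by (simp add: algebra_simps)
      ultimately have "\<bar>?d\<bar> \<le> ?e' * ?q + ?e' * D + D" using le' unfolding ee by simp
      also have "?e' * ?q \<le> c * ?q" using c t by (intro mult_right_mono) auto
      also have "?e' * D \<le> c * D" using c t D by (intro mult_right_mono) auto
      finally have "\<bar>?d\<bar> \<le> ?b t" by simp
      thus "norm ?d \<le> norm (?b t)" by simp
    qed
  qed
qed

lemma measurable_time_function:
  assumes g: "g \<in> borel_measurable (restrict_space borel {0..T})"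
  shows "(\<lambda>p. g (clamp 0 T (fst p))) \<in> borel_measurable (borel \<Otimes>\<^sub>M M)"
  using measurable_compose[OF measurable_fst measurable_compose[OF measurable_clamp g]] horizon_pos
  by simp

lemma control_jointly_measurable:
  assumes i: "i \<in> {1..agents md}" and u: "u \<in> controls md i"
  shows "(\<lambda>p. u (clamp 0 T (fst p)) (snd p)) \<in> borel_measurable (borel \<Otimes>\<^sub>M M)"
proof -
  let ?F = "agent_filtration md i T"
  have u': "(\<lambda>(s, \<omega>). u s \<omega>) \<in> borel_measurable (restrict_space borel {0..T} \<Otimes>\<^sub>M ?F)"
    using u horizon_pos by (auto simp: controls_def progressively_measurable_def)
  have sub: "subalgebra M ?F"
    using noise_brownian i
    by (intro subalgebra_natural_filtration) (auto simp: standard_brownian_motion_def)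
  have "(\<lambda>\<omega>. \<omega>) \<in> M \<rightarrow>\<^sub>M ?F"
    using measurable_from_subalg[OF sub measurable_ident_sets[OF refl]] by simp
  hence "(\<lambda>p. (clamp 0 T (fst p), snd p)) \<in> borel \<Otimes>\<^sub>M M \<rightarrow>\<^sub>M restrict_space borel {0..T} \<Otimes>\<^sub>M ?F"
    using horizon_pos
    by (intro measurable_Pair measurable_compose[OF measurable_fst measurable_clamp]
        measurable_compose[OF measurable_snd]) auto
  from measurable_compose[OF this u'] show ?thesis by simp
qed

lemma payoff_rate_jointly_measurable:
  assumes i: "i \<in> {1..agents md}" and u: "u \<in> controls md i" and x: "load_state md i u x"
  shows "(\<lambda>(t, \<omega>). payoff_rate i x u (clamp 0 T t) \<omega>) \<in> borel_measurable (borel \<Otimes>\<^sub>M M)"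
proof -
  have w [measurable]: "(\<lambda>p. logprice md (clamp 0 T (fst p)) (snd p)) \<in> borel_measurable (borel \<Otimes>\<^sub>M M)"
    using logprice_jointly_measurable by (simp add: case_prod_unfold)
  have [measurable]: "(\<lambda>p. x (clamp 0 T (fst p)) (snd p)) \<in> borel_measurable (borel \<Otimes>\<^sub>M M)"
    using borel_measurable_continuous_on_horizon[of T x M] horizon_pos
      load_state_measurable[OF x] load_state_continuous[OF x] by (simp add: case_prod_unfold)
  note [measurable] = control_jointly_measurable[OF i u]
    measurable_time_function[OF p_measurable[OF i]] measurable_time_function[OF l_measurable[OF i]]
  have "(\<lambda>p. (x (clamp 0 T (fst p)) (snd p), u (clamp 0 T (fst p)) (snd p)))
      \<in> borel \<Otimes>\<^sub>M M \<rightarrow>\<^sub>M (borel :: (real \<times> real) measure)"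
    by measurable
  from measurable_compose[OF this comfort_measurable[OF i]]
  have [measurable]: "(\<lambda>p. comfort md i (x (clamp 0 T (fst p)) (snd p)) (u (clamp 0 T (fst p)) (snd p)))
      \<in> borel_measurable (borel \<Otimes>\<^sub>M M)"
    by simp
  show ?thesis
    unfolding payoff_rate_eq case_prod_unfold by measurable
qed

lemma total_payoff_measurable:
  assumes i: "i \<in> {1..agents md}" and u: "u \<in> controls md i" and x: "load_state md i u x"
  shows "total_payoff i x u \<in> borel_measurable M"
proof -
  have "total_payoff i x u = (\<lambda>\<omega>. LINT t:{0..T}|lborel. payoff_rate i x u (clamp 0 T t) \<omega>)"
    unfolding total_payoff_def[abs_def] by (intro ext set_lebesgue_integral_cong) auto
  thus ?thesis
    using borel_measurable_set_lebesgue_integral[OF payoff_rate_jointly_measurable[OF i u x]] by simp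
qed

text \<open>After exchanging expectation and time integral, the expected absolute payoff is at most the time
integral of a deterministic integrable function times \<open>1 + E[exp w\<^sub>t]\<close>.\<close>

lemma total_payoff_integrable:
  assumes i: "i \<in> {1..agents md}" and u: "u \<in> controls md i" and x: "integrable_state i x u"
  shows "integrable M (total_payoff i x u)"
proof -
  have ls: "load_state md i u x"
    and ai: "AE \<omega> in M. set_integrable lborel {0..T} (\<lambda>t. payoff_rate i x u t \<omega>)"
    using x by (auto simp: integrable_state_def)
  obtain D where D: "0 \<le> D" and est: "AE \<omega> in M. \<forall>t\<in>{0..T}.
    \<bar>payoff_rate i x u t \<omega> - exp (logprice md t \<omega>) * (p_coeff md i t - l_coeff md i t)\<bar>
      \<le> D * (1 + exp (logprice md t \<omega>))"
    by (rule payoff_rate_estimate[OF i u ls], rule that)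
  obtain E where E: "\<And>t. t \<in> {0..T} \<Longrightarrow> (\<integral>\<^sup>+\<omega>. ennreal (exp (logprice md t \<omega>)) \<partial>M) \<le> ennreal E"
    by (rule exp_logprice_bounded_mean, rule that)
  define d where "d t = \<bar>p_coeff md i t - l_coeff md i t\<bar> + D" for t
  have d0: "0 \<le> d t" "D \<le> d t" for t using D by (auto simp: d_def)
  have di: "set_integrable lborel {0..T} d"
    unfolding d_def
    by (rule set_integral_add(1)[OF set_integrable_abs[OF price_spread_integrable[OF i u x]]],
        intro set_integrable_continuous_Icc continuous_intros)
  have dm: "d \<in> borel_measurable (restrict_space borel {0..T})"
    unfolding d_def by (intro borel_measurable_add borel_measurable_abs borel_measurable_diff
        p_measurable l_measurable i borel_measurable_const)
  have dm': "(\<lambda>p. d (clamp 0 T (fst p))) \<in> borel_measurable (borel \<Otimes>\<^sub>M M)"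
    by (rule measurable_time_function[OF dm])
  have wm: "(\<lambda>p. logprice md (clamp 0 T (fst p)) (snd p)) \<in> borel_measurable (borel \<Otimes>\<^sub>M M)"
    using logprice_jointly_measurable by (simp add: case_prod_unfold)
  let ?Y = "\<lambda>t \<omega>. ennreal (d (clamp 0 T t) * (1 + exp (logprice md (clamp 0 T t) \<omega>)))"
  have Ym: "(\<lambda>(t, \<omega>). ?Y t \<omega>) \<in> borel_measurable (borel \<Otimes>\<^sub>M M)"
    using dm' wm by (simp add: case_prod_unfold)
  have "(\<integral>\<^sup>+\<omega>. ennreal (norm (total_payoff i x u \<omega>)) \<partial>M) \<le> (\<integral>\<^sup>+\<omega>. (\<integral>\<^sup>+t\<in>{0..T}. ?Y t \<omega> \<partial>lborel) \<partial>M)"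
  proof (rule nn_integral_mono_AE, use est ai in eventually_elim)
    case (elim \<omega>)
    have "ennreal (norm (total_payoff i x u \<omega>))
        \<le> (\<integral>\<^sup>+t. ennreal (norm (indicator {0..T} t *\<^sub>R payoff_rate i x u t \<omega>)) \<partial>lborel)"
      unfolding total_payoff_def set_lebesgue_integral_def
      by (rule integral_norm_bound_ennreal) (use elim(2) in \<open>simp add: set_integrable_def\<close>)
    also have "\<dots> \<le> (\<integral>\<^sup>+t\<in>{0..T}. ?Y t \<omega> \<partial>lborel)"
    proof (rule nn_integral_mono)
      fix t
      show "ennreal (norm (indicator {0..T} t *\<^sub>R payoff_rate i x u t \<omega>)) \<le> ?Y t \<omega> * indicator {0..T} t"
      proof (cases "t \<in> {0..T}")
        case True
        let ?e = "exp (logprice md t \<omega>)" and ?s = "p_coeff md i t - l_coeff md i t"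
        have "\<bar>payoff_rate i x u t \<omega>\<bar> \<le> \<bar>?e * ?s\<bar> + D * (1 + ?e)"
          using bspec[OF elim(1) True] by linarith
        also have "\<bar>?e * ?s\<bar> = ?e * \<bar>?s\<bar>" by (simp add: abs_mult)
        also have "?e * \<bar>?s\<bar> \<le> (1 + ?e) * \<bar>?s\<bar>" by (rule mult_right_mono) auto
        also have "(1 + ?e) * \<bar>?s\<bar> + D * (1 + ?e) = d t * (1 + ?e)" by (simp add: d_def algebra_simps)
        finally show ?thesis using True by (simp add: ennreal_leI)
      qed simp
    qed
    finally show ?case .
  qed
  also have "\<dots> = (\<integral>\<^sup>+t\<in>{0..T}. (\<integral>\<^sup>+\<omega>. ?Y t \<omega> \<partial>M) \<partial>lborel)"
    by (rule nn_integral_time_swap[OF Ym]) simp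
  also have "\<dots> \<le> (\<integral>\<^sup>+t\<in>{0..T}. ennreal (d t * (1 + \<bar>E\<bar>)) \<partial>lborel)"
  proof (rule nn_integral_mono)
    fix t
    show "(\<integral>\<^sup>+\<omega>. ?Y t \<omega> \<partial>M) * indicator {0..T} t \<le> ennreal (d t * (1 + \<bar>E\<bar>)) * indicator {0..T} t"
    proof (cases "t \<in> {0..T}")
      case True
      have "(\<integral>\<^sup>+\<omega>. ?Y t \<omega> \<partial>M) = (\<integral>\<^sup>+\<omega>. ennreal (d t) * (1 + ennreal (exp (logprice md t \<omega>))) \<partial>M)"
        using True d0 by (intro nn_integral_cong) (simp add: ennreal_mult ennreal_plus)
      also have "\<dots> = ennreal (d t) * (1 + (\<integral>\<^sup>+\<omega>. ennreal (exp (logprice md t \<omega>)) \<partial>M))"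
        using logprice_measurable[OF True]
        by (subst nn_integral_cmult) (auto simp: nn_integral_add emeasure_space_1)
      also have "\<dots> \<le> ennreal (d t) * (1 + ennreal \<bar>E\<bar>)"
        using E[OF True] ennreal_leI[of E "\<bar>E\<bar>"]
        by (intro mult_left_mono add_left_mono) (auto intro: order_trans)
      also have "\<dots> = ennreal (d t * (1 + \<bar>E\<bar>))" using d0 by (simp add: ennreal_mult ennreal_plus)
      finally show ?thesis using True by simp
    qed simp
  qed
  also have "\<dots> < \<infinity>"
  proof -
    have "set_integrable lborel {0..T} (\<lambda>t. d t * (1 + \<bar>E\<bar>))"
      using di by (rule set_integrable_mult_left)
    hence "(\<integral>\<^sup>+t. ennreal (norm (indicator {0..T} t *\<^sub>R (d t * (1 + \<bar>E\<bar>)))) \<partial>lborel) < \<infinity>"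
      by (simp add: set_integrable_def integrable_iff_bounded)
    moreover have "(\<integral>\<^sup>+t\<in>{0..T}. ennreal (d t * (1 + \<bar>E\<bar>)) \<partial>lborel)
        = (\<integral>\<^sup>+t. ennreal (norm (indicator {0..T} t *\<^sub>R (d t * (1 + \<bar>E\<bar>)))) \<partial>lborel)"
      using d0 by (intro nn_integral_cong) (auto simp: indicator_def abs_mult)
    ultimately show ?thesis by simp
  qed
  finally show ?thesis
    using total_payoff_measurable[OF i u ls] by (intro integrableI_bounded) auto
qed

lemma expected_total_payoff_unique:
  assumes i: "i \<in> {1..agents md}" and u: "u \<in> controls md i"
    and x: "load_state md i u x" and y: "load_state md i u y"
  shows "expectation (total_payoff i x u) = expectation (total_payoff i y u)"
proof (rule integral_cong_AE)
  show "AE \<omega> in M. total_payoff i x u \<omega> = total_payoff i y u \<omega>"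
    using load_state_unique[OF i u x y]
    unfolding total_payoff_def payoff_rate_def
    by eventually_elim (intro set_lebesgue_integral_cong, auto)
qed (use total_payoff_measurable[OF i u] x y in auto)

lemma decoupled_payoff_expectation:
  assumes i: "i \<in> {1..agents md}" and u: "u \<in> controls md i"
    and J: "decoupled_payoff md i u \<gamma> \<zeta> J"
  obtains x where "integrable_state i x u" "integrable M J"
    "expectation J = - b_const md i + expectation (total_payoff i x u)"
proof -
  from J obtain x G I where Jm: "J \<in> borel_measurable M" and ls: "load_state md i u x"
    and int: "AE \<omega> in M. set_integrable lborel {0..T} (\<lambda>t. payoff_rate i x u t \<omega>)"
    and G: "ito_integral M (agent_filtration md i) (noise md i) T
        (\<lambda>t \<omega>. sigmaP md i t (logprice md t \<omega>) + sigmaA md i t) G"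
    and I: "ito_integrals M (noise md) {0, i} T (noise_coeffs \<gamma>) I"
    and eq: "AE \<omega> in M. J \<omega> = - b_const md i + total_payoff i x u \<omega> + G \<omega> - I \<omega>"
    unfolding decoupled_payoff_def payoff_rate_def[symmetric] total_payoff_def[symmetric] by blast
  have st: "integrable_state i x u" using ls int by (simp add: integrable_state_def)
  interpret bf: brownian_filtration M "agent_filtration md i" "noise md i" T
    using noise_brownian_filtration[OF i] by blast
  have hb: "has_bochner_integral M (\<lambda>\<omega>. - b_const md i + total_payoff i x u \<omega> + G \<omega> - I \<omega>)
      (- b_const md i + expectation (total_payoff i x u) + 0 - 0)"
    using total_payoff_integrable[OF i u st] bf.ito_integral_mean_zero[OF G]
      ito_integrals_mean_zero[OF i I]
    by (intro has_bochner_integral_add has_bochner_integral_diff)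
      (auto simp: has_bochner_integral_iff prob_space)
  have "has_bochner_integral M J (- b_const md i + expectation (total_payoff i x u) + 0 - 0)"
    using has_bochner_integral_cong_AE[OF Jm _ eq] hb by (auto simp: has_bochner_integral_iff)
  thus ?thesis using that[OF st] by (simp add: has_bochner_integral_iff)
qed

lemma joint_payoff_expectation:
  assumes u: "\<And>i. i \<in> {1..agents md} \<Longrightarrow> u i \<in> controls md i"
    and J: "joint_payoff md u \<gamma> \<zeta> J"
  obtains x where "\<And>i. i \<in> {1..agents md} \<Longrightarrow> integrable_state i (x i) (u i)" "integrable M J"
    "expectation J = (\<Sum>i=1..agents md. - b_const md i + expectation (total_payoff i (x i) (u i)))"
proof -
  let ?rP = "\<lambda>x i \<omega> t. rP md i t (logprice md t \<omega>) (x i t \<omega>) (u i t \<omega>)"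
  from J obtain x v y G where Jm: "J \<in> borel_measurable M"
    and ag: "\<forall>i\<in>{1..agents md}. load_state md i (u i) (x i) \<and>
           benefit_state md i (u i) (\<gamma> i) (x i) (v i) \<and>
           risk_state md i (\<gamma> i) (\<zeta> i) (y i) \<and>
           (AE \<omega> in M. set_integrable lborel {0..T} (?rP x i \<omega>)) \<and>
           ito_integral M (agent_filtration md i) (noise md i) T
              (\<lambda>t \<omega>. sigmaP md i t (logprice md t \<omega>)) (G i)"
    and eq: "AE \<omega> in M. J \<omega> =
           (\<Sum>i=1..agents md. (LINT t:{0..T}|lborel. ?rP x i \<omega> t) + G i \<omega> - v i T \<omega>)"
    unfolding joint_payoff_def by blast
  have agent: "integrable_state i (x i) (u i) \<and> (\<exists>N. has_bochner_integral M N 0 \<and>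
      (AE \<omega> in M. (LINT t:{0..T}|lborel. ?rP x i \<omega> t) + G i \<omega> - v i T \<omega>
        = - b_const md i + total_payoff i (x i) (u i) \<omega> + N \<omega>))" if i: "i \<in> {1..agents md}" for i
  proof -
    from ag i have ls: "load_state md i (u i) (x i)" and bs: "benefit_state md i (u i) (\<gamma> i) (x i) (v i)"
      and Pi: "AE \<omega> in M. set_integrable lborel {0..T} (?rP x i \<omega>)"
      and G: "ito_integral M (agent_filtration md i) (noise md i) T
              (\<lambda>t \<omega>. sigmaP md i t (logprice md t \<omega>)) (G i)" by blast+
    let ?rA = "\<lambda>\<omega> t. rA md i t (x i t \<omega>) (u i t \<omega>)"
    let ?c = "noise_coeffs (\<lambda>t \<omega>. (fst (\<gamma> i t \<omega>), snd (\<gamma> i t \<omega>) - sigmaA md i t))"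
    have Ai: "AE \<omega> in M. set_integrable lborel {0..T} (\<lambda>t. - ?rA \<omega> t)"
      using bs by (simp add: benefit_state_def ito_process_def)
    have "\<exists>I. ito_integrals M (noise md) {0, i} T ?c I \<and>
        (AE \<omega> in M. v i T \<omega> = b_const md i + (LINT t:{0..T}|lborel. - ?rA \<omega> t) + I \<omega>)"
      using bs horizon_pos by (simp add: benefit_state_def ito_process_def)
    then obtain I where I: "ito_integrals M (noise md) {0, i} T ?c I"
      and v: "AE \<omega> in M. v i T \<omega> = b_const md i + (LINT t:{0..T}|lborel. - ?rA \<omega> t) + I \<omega>" by blast
    have both: "AE \<omega> in M. set_integrable lborel {0..T} (?rP x i \<omega>) \<and> set_integrable lborel {0..T} (?rA \<omega>)"
      using Pi Ai
    proof eventually_elim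
      case (elim \<omega>)
      thus ?case using set_integrable_mult_right[OF elim(2), of "- 1"] by simp
    qed
    have "AE \<omega> in M. set_integrable lborel {0..T} (\<lambda>t. payoff_rate i (x i) (u i) t \<omega>)"
      using both unfolding payoff_rate_def by eventually_elim (intro set_integral_add(1), auto)
    hence "integrable_state i (x i) (u i)" using ls by (simp add: integrable_state_def)
    moreover have "has_bochner_integral M (\<lambda>\<omega>. G i \<omega> - I \<omega>) (0 - 0)"
    proof (rule has_bochner_integral_diff)
      interpret bf: brownian_filtration M "agent_filtration md i" "noise md i" T
        using noise_brownian_filtration[OF i] by blast
      show "has_bochner_integral M (G i) 0" by (rule bf.ito_integral_mean_zero[OF G]) simp
      show "has_bochner_integral M I 0" by (rule ito_integrals_mean_zero[OF i I])
    qed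
    moreover have "AE \<omega> in M. (LINT t:{0..T}|lborel. ?rP x i \<omega> t) + G i \<omega> - v i T \<omega>
        = - b_const md i + total_payoff i (x i) (u i) \<omega> + (G i \<omega> - I \<omega>)"
      using both v
    proof eventually_elim
      case (elim \<omega>)
      hence P: "set_integrable lborel {0..T} (?rP x i \<omega>)" and A: "set_integrable lborel {0..T} (?rA \<omega>)" by blast+
      have "total_payoff i (x i) (u i) \<omega> = (LINT t:{0..T}|lborel. ?rP x i \<omega> t) + (LINT t:{0..T}|lborel. ?rA \<omega> t)"
        unfolding total_payoff_def payoff_rate_def by (rule set_integral_add(2)[OF P A])
      moreover have "(LINT t:{0..T}|lborel. - ?rA \<omega> t) = - (LINT t:{0..T}|lborel. ?rA \<omega> t)"
        by (rule set_integral_uminus[OF A])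
      ultimately show ?case using elim(2) by linarith
    qed
    ultimately show ?thesis by auto
  qed
  hence "\<forall>i\<in>{1..agents md}. \<exists>N. has_bochner_integral M N 0 \<and>
      (AE \<omega> in M. (LINT t:{0..T}|lborel. ?rP x i \<omega> t) + G i \<omega> - v i T \<omega>
        = - b_const md i + total_payoff i (x i) (u i) \<omega> + N \<omega>)" by blast
  from bchoice[OF this] obtain N where N: "\<forall>i\<in>{1..agents md}. has_bochner_integral M (N i) 0 \<and>
      (AE \<omega> in M. (LINT t:{0..T}|lborel. ?rP x i \<omega> t) + G i \<omega> - v i T \<omega>
        = - b_const md i + total_payoff i (x i) (u i) \<omega> + N i \<omega>)" ..
  let ?S = "\<lambda>\<omega>. \<Sum>i=1..agents md. - b_const md i + total_payoff i (x i) (u i) \<omega> + N i \<omega>"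
  have "AE \<omega> in M. \<forall>i\<in>{1..agents md}. (LINT t:{0..T}|lborel. ?rP x i \<omega> t) + G i \<omega> - v i T \<omega>
        = - b_const md i + total_payoff i (x i) (u i) \<omega> + N i \<omega>"
    using N by (intro AE_finite_allI) auto
  with eq have JS: "AE \<omega> in M. J \<omega> = ?S \<omega>"
    by eventually_elim simp
  have S: "has_bochner_integral M ?S
      (\<Sum>i=1..agents md. - b_const md i + expectation (total_payoff i (x i) (u i)) + 0)"
  proof (rule has_bochner_integral_sum)
    fix i assume i: "i \<in> {1..agents md}"
    have "integrable M (total_payoff i (x i) (u i))"
      using agent[OF i] by (intro total_payoff_integrable[OF i u[OF i]]) blast
    moreover have "has_bochner_integral M (N i) 0" using N i by blast
    ultimately show "has_bochner_integral M (\<lambda>\<omega>. - b_const md i + total_payoff i (x i) (u i) \<omega> + N i \<omega>)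
      (- b_const md i + expectation (total_payoff i (x i) (u i)) + 0)"
      by (intro has_bochner_integral_add) (auto simp: has_bochner_integral_iff prob_space)
  qed
  have "has_bochner_integral M J (\<Sum>i=1..agents md. - b_const md i + expectation (total_payoff i (x i) (u i)) + 0)"
    using has_bochner_integral_cong_AE[OF Jm _ JS] S by (auto simp: has_bochner_integral_iff)
  thus ?thesis using that[of x] agent by (simp add: has_bochner_integral_iff)
qed

text \<open>The stochastic integrals in the decoupled payoff do not involve the control. Those that occur in one
admissible payoff serve equally for another control.\<close>

lemma decoupled_payoff_transfer:
  assumes i: "i \<in> {1..agents md}" and u: "u \<in> controls md i" and x: "integrable_state i x u"
    and J: "decoupled_payoff md i u' \<gamma> \<zeta> J"
  shows "\<exists>J'. decoupled_payoff md i u \<gamma> \<zeta> J'"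
proof -
  have ls: "load_state md i u x"
    and int: "AE \<omega> in M. set_integrable lborel {0..T} (\<lambda>t. payoff_rate i x u t \<omega>)"
    using x by (auto simp: integrable_state_def)
  from J obtain y G I where y: "risk_state md i \<gamma> \<zeta> y"
    and G: "ito_integral M (agent_filtration md i) (noise md i) T
        (\<lambda>t \<omega>. sigmaP md i t (logprice md t \<omega>) + sigmaA md i t) G"
    and I: "ito_integrals M (noise md) {0, i} T (noise_coeffs \<gamma>) I"
    unfolding decoupled_payoff_def by blast
  have m: "G \<in> borel_measurable M" "I \<in> borel_measurable M"
    using G ito_integrals_mean_zero[OF i I] by (auto simp: ito_integral_def has_bochner_integral_iff)
  have "decoupled_payoff md i u \<gamma> \<zeta> (\<lambda>\<omega>. - b_const md i + total_payoff i x u \<omega> + G \<omega> - I \<omega>)"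
    unfolding decoupled_payoff_def payoff_rate_def[symmetric] total_payoff_def[symmetric]
    using m total_payoff_measurable[OF i u ls]
    by (intro conjI exI[of _ x] exI[of _ y] exI[of _ G] exI[of _ I] ls y int G I) auto
  thus ?thesis by blast
qed

text \<open>Agent by agent, the contribution to the expected joint payoff is the expectation of a payoff that competes
in the risk-neutral problem of that agent. The optimal payoff there may be built from another version of
the load under \<open>u_bar\<close> than \<open>J_bar\<close> is, which uniqueness of the expected payoff makes harmless.\<close>

lemma joint_expectation_le_mean_optimum:
  assumes u: "\<And>i. i \<in> {1..agents md} \<Longrightarrow> u i \<in> controls md i" and J: "joint_payoff md u \<gamma> \<zeta> J"
    and bar: "\<And>i. i \<in> {1..agents md} \<Longrightarrow> mean_solution md i (u_bar i)"
    and J_bar: "joint_payoff md u_bar \<gamma>' \<zeta>' J_bar"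
  shows "integrable M J" "expectation J \<le> expectation J_bar"
proof -
  have ub: "u_bar i \<in> controls md i" if "i \<in> {1..agents md}" for i
    using bar[OF that] by (simp add: mean_solution_def)
  obtain x where x: "\<And>i. i \<in> {1..agents md} \<Longrightarrow> integrable_state i (x i) (u i)" and Ji: "integrable M J"
    and EJ: "expectation J = (\<Sum>i=1..agents md. - b_const md i + expectation (total_payoff i (x i) (u i)))"
    by (rule joint_payoff_expectation[OF _ J], erule u, rule that)
  obtain z where z: "\<And>i. i \<in> {1..agents md} \<Longrightarrow> integrable_state i (z i) (u_bar i)" and "integrable M J_bar"
    and Eb: "expectation J_bar = (\<Sum>i=1..agents md. - b_const md i + expectation (total_payoff i (z i) (u_bar i)))"
    by (rule joint_payoff_expectation[OF _ J_bar], erule ub, rule that)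
  show "integrable M J" by (rule Ji)
  show "expectation J \<le> expectation J_bar"
    unfolding EJ Eb
  proof (rule sum_mono)
    fix i assume i: "i \<in> {1..agents md}"
    from bar[OF i] obtain J\<^sub>0 where J0: "decoupled_payoff md i (u_bar i) no_loading no_loading J\<^sub>0"
      and opt: "\<And>u' J'. u' \<in> controls md i \<Longrightarrow> decoupled_payoff md i u' no_loading no_loading J' \<Longrightarrow>
        expectation J' \<le> expectation J\<^sub>0"
      unfolding mean_solution_def by blast
    obtain J' where J': "decoupled_payoff md i (u i) no_loading no_loading J'"
      using decoupled_payoff_transfer[OF i u[OF i] x[OF i] J0] by blast
    obtain x' where x': "integrable_state i x' (u i)"
      and E': "expectation J' = - b_const md i + expectation (total_payoff i x' (u i))"
      by (rule decoupled_payoff_expectation[OF i u[OF i] J'], rule that)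
    obtain z' where z': "integrable_state i z' (u_bar i)"
      and E0: "expectation J\<^sub>0 = - b_const md i + expectation (total_payoff i z' (u_bar i))"
      by (rule decoupled_payoff_expectation[OF i ub[OF i] J0], rule that)
    have "expectation (total_payoff i (x i) (u i)) = expectation (total_payoff i x' (u i))"
      using x[OF i] x' by (intro expected_total_payoff_unique[OF i u[OF i]]) (auto simp: integrable_state_def)
    moreover have "expectation (total_payoff i (z i) (u_bar i)) = expectation (total_payoff i z' (u_bar i))"
      using z[OF i] z' by (intro expected_total_payoff_unique[OF i ub[OF i]]) (auto simp: integrable_state_def)
    ultimately show "- b_const md i + expectation (total_payoff i (x i) (u i))
        \<le> - b_const md i + expectation (total_payoff i (z i) (u_bar i))"
      using opt[OF u[OF i] J'] E' E0 by simp
  qed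
qed

end

theorem proposition1:
  fixes md :: "'a contract_data"
    and \<theta> :: real
    and u_opt u_star u_bar :: "nat \<Rightarrow> real \<Rightarrow> 'a \<Rightarrow> real"
    and \<gamma>_opt \<gamma>_star \<zeta>_opt \<zeta>_star :: "nat \<Rightarrow> real \<Rightarrow> 'a \<Rightarrow> real \<times> real"
    and J_opt J_star J_bar :: "'a \<Rightarrow> real"
    and \<rho> :: ereal
  assumes model: "contract_model md"
    and theta_pos: "\<theta> > 0"
    and opt: "joint_solution md \<theta> u_opt \<gamma>_opt \<zeta>_opt"
    and star: "\<And>i. i \<in> {1..agents md} \<Longrightarrow>
      decoupled_solution md \<theta> i (u_star i) (\<gamma>_star i) (\<zeta>_star i)"
    and bar: "\<And>i. i \<in> {1..agents md} \<Longrightarrow> mean_solution md i (u_bar i)"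
    and J_opt: "joint_payoff md u_opt \<gamma>_opt \<zeta>_opt J_opt"
    and J_star: "joint_payoff md u_star \<gamma>_star \<zeta>_star J_star"
    and J_bar: "joint_payoff md u_bar (\<lambda>_. no_loading) (\<lambda>_. no_loading) J_bar"
    and mean_pos: "prob_space.expectation (prb md) J_bar > 0"
    and rho: "\<rho> = risk_value (prb md) \<theta> J_star / ereal (prob_space.expectation (prb md) J_bar)"
    and rho_nonneg: "\<rho> \<ge> 0"
  shows "\<rho> * risk_value (prb md) \<theta> J_opt \<le> risk_value (prb md) \<theta> J_star"
proof -
  interpret contract_model md by (rule model)
  have u_opt: "u_opt i \<in> controls md i" if "i \<in> {1..agents md}" for i
    using opt that by (auto simp: joint_solution_def joint_feasible_def)
  note mean = joint_expectation_le_mean_optimum[OF u_opt J_opt bar J_bar]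
  have "risk_value M \<theta> J_opt \<le> ereal (expectation J_opt)"
    using mean(1) theta_pos by (rule risk_value_le_expectation)
  also have "\<dots> \<le> ereal (expectation J_bar)" using mean(2) by simp
  finally have "\<rho> * risk_value M \<theta> J_opt \<le> \<rho> * ereal (expectation J_bar)"
    using rho_nonneg by (rule ereal_mult_left_mono)
  also have "\<dots> = risk_value M \<theta> J_star"
    unfolding rho using mean_pos by (cases "risk_value M \<theta> J_star") auto
  finally show ?thesis .
qed

end
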